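(* Let $\nu$ be a finite positive Borel measure on $[0,1]$, let $c_\nu\in[1,2]$ be its critical index and $c_\nu'$ the dual exponent of $c_\nu$. The Shimorin-type operator $T_\nu$ has a standard Bergman-type $L^p$–$L^q$ estimate if and only if the following condition, according to the value of $c_\nu$, holds: - when $c_\nu=1$: $\nu$ is a finite measure (i.e. no further condition is imposed); - when $1<c_\nu<2$: $\displaystyle\sup_{0<t\le1}\frac{\nu([1-t,1))}{t^{2/c_\nu'}}<\infty$; - when $c_\nu=2$: $\displaystyle\int_{[0,1)}\frac{1}{1-r^2}\,d\nu(r)<\infty$.
   Context: $\mathbb D$ is the open unit disk in $\mathbb C$, $dA$ is the Lebesgue area measure normalized so that $A(\mathbb D)=1$, $|E|$ denotes the normalized area of $E$, and $L^p(\mathbb D)=L^p(\mathbb D,dA)$. For a finite positive Borel measure $\nu$ on $[0,1]$, the Shimorin-type operator is $$T_\nu f(z)=\int_{\mathbb D}\frac{1}{1-z\overline\lambda}\left(\int_0^1\frac{d\nu(r)}{1-rz\overline\lambda}\right)f(\lambda)\,dA(\lambda),\quad z\in\mathbb D.$$ The critical index is $$c_\nu=\sup\left\{1\le c<2:\ \int_0^1\frac{1}{(1-r^2)^{2/c'}}\,d\nu(r)<\infty\right\},$$ where $c'$ denotes the dual exponent, $1/c+1/c'=1$ (with $1'=\infty$, $1/\infty=0$). $T_\nu$ has a standard Bergman-type $L^p$–$L^q$ estimate if the following three conditions all hold: (i) $T_\nu:L^1(\mathbb D)\to L^{c_\nu,\infty}(\mathbb D)$ is bounded; (ii) $T_\nu:L^p(\mathbb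 D)\to L^q(\mathbb D)$ is bounded for every $1<p<c_\nu'$ with $q$ given by $\frac1q=\frac1p+\frac1{c_\nu}-1$; (iii) $T_\nu:L^{c_\nu'}(\mathbb D)\to\operatorname{BMO}(\mathbb D)$ is bounded. Here, for $1\le p<\infty$, $L^{p,\infty}(\mathbb D)$ is the space of measurable $f$ with finite quasi-norm $\|f\|_{L^{p,\infty}(\mathbb D)}=\inf\{C>0:\ |\{z\in\mathbb D:|f(z)|>t\}|\le C^p/t^p\ \text{for all } t>0\}$. The space $\operatorname{BMO}(\mathbb D)$ consists of measurable $f:\mathbb D\to\mathbb C$ with $\|f\|_{\operatorname{BMO}(\mathbb D)}=\sup_{Q\subset\mathbb D}E_Q(|f-E_Q(f)|)<\infty$, the supremum being over all Euclidean cubes (squares) $Q\subset\mathbb D$, where $E_Q(f)=\frac1{|Q|}\int_Q f\,dA$. *)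

theory Defs
  imports "HOL-Analysis.Analysis" "HOL-Probability.Essential_Supremum"
begin

abbreviation unit_disk :: "complex set" where
  "unit_disk \<equiv> ball 0 1"

definition area :: "complex measure" where
  "area = scale_measure (1 / ennreal pi) (lebesgue_on unit_disk)"

definition dual_exponent :: "real \<Rightarrow> ennreal" where
  "dual_exponent c = (if c = 1 then \<infinity> else ennreal (c / (c - 1)))"

text \<open>Powers \<open>x\<close> to the \<open>a\<close> with \<open>x, a \<ge> 0\<close> and the convention that the zeroth power
  of 0 is 1, whereas \<open>0 powr 0 = 0\<close> in the library.\<close>

definition ennpow :: "real \<Rightarrow> real \<Rightarrow> ennreal" where
  "ennpow x a = (if a = 0 then 1 else ennreal (x powr a))"

text \<open>The integral runs over the closed interval \<open>[0,1]\<close> and is \<open>[0,\<infinity>]\<close>-valued: in \<open>ennreal\<close>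
  one has \<open>1 / 0 = \<infinity>\<close> and \<open>2 / \<infinity> = 0\<close>. So an atom of \<open>\<nu>\<close> at 1 makes the integral infinite
  for every \<open>c > 1\<close>, while for \<open>c = 1\<close> the integrand is identically 1.\<close>

definition critical_index :: "real measure \<Rightarrow> real" where
  "critical_index \<nu> = Sup {c. 1 \<le> c \<and> c < 2 \<and>
     (\<integral>\<^sup>+ r. 1 / ennpow (1 - r\<^sup>2) (enn2real (2 / dual_exponent c)) \<partial>\<nu>) < \<infinity>}"

definition shimorin_op :: "real measure \<Rightarrow> (complex \<Rightarrow> complex) \<Rightarrow> complex \<Rightarrow> complex" where
  "shimorin_op \<nu> f z =
     (\<integral>w. 1 / (1 - z * cnj w) * (\<integral>r. 1 / (1 - of_real r * z * cnj w) \<partial>\<nu>) * f w \<partial>area)"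

definition Lp_norm :: "ennreal \<Rightarrow> (complex \<Rightarrow> complex) \<Rightarrow> ennreal" where
  "Lp_norm p f =
     (if p = \<infinity> then esssup area (\<lambda>z. ennreal (norm (f z)))
      else let I = (\<integral>\<^sup>+ z. ennreal (norm (f z) powr enn2real p) \<partial>area)
           in if I = \<infinity> then \<infinity> else ennreal (enn2real I powr (1 / enn2real p)))"

definition weak_Lp_norm :: "real \<Rightarrow> (complex \<Rightarrow> complex) \<Rightarrow> ennreal" where
  "weak_Lp_norm p f = Inf {ennreal C | C. C > 0 \<and>
     (\<forall>t>0. emeasure area {z \<in> unit_disk. norm (f z) > t} \<le> ennreal (C powr p / t powr p))}"

text \<open>A closed square with corner \<open>a\<close> and adjacent sides \<open>w\<close> and \<open>\<i> w\<close>; every orientation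
  is allowed.\<close>

definition square :: "complex \<Rightarrow> complex \<Rightarrow> complex set" where
  "square a w = {a + w * Complex x y | x y. x \<in> {0..1} \<and> y \<in> {0..1}}"

definition squares_in_disk :: "complex set set" where
  "squares_in_disk = {square a w | a w. w \<noteq> 0 \<and> square a w \<subseteq> unit_disk}"

definition average :: "complex set \<Rightarrow> (complex \<Rightarrow> complex) \<Rightarrow> complex" where
  "average Q f = (1 / measure area Q) *\<^sub>R (LINT z:Q|area. f z)"

text \<open>If \<open>f\<close> is not integrable over \<open>Q\<close>, the library sets its average to 0, and then the
  mean oscillation over \<open>Q\<close> is infinite. Finiteness therefore includes integrability over
  all squares.\<close>

definition BMO_norm :: "(complex \<Rightarrow> complex) \<Rightarrow> ennreal" where
  "BMO_norm f = (SUP Q\<in>squares_in_disk.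
     (\<integral>\<^sup>+ z\<in>Q. ennreal (norm (f z - average Q f)) \<partial>area) / emeasure area Q)"

text \<open>A function space is given by its \<open>[0,\<infinity>]\<close>-valued (quasi- or semi-) norm on measurable
  functions.\<close>

definition fun_space :: "((complex \<Rightarrow> complex) \<Rightarrow> ennreal) \<Rightarrow> (complex \<Rightarrow> complex) set" where
  "fun_space N = {f \<in> borel_measurable area. N f < \<infinity>}"

definition bounded_operator ::
  "((complex \<Rightarrow> complex) \<Rightarrow> ennreal) \<Rightarrow> ((complex \<Rightarrow> complex) \<Rightarrow> ennreal) \<Rightarrow>
   ((complex \<Rightarrow> complex) \<Rightarrow> complex \<Rightarrow> complex) \<Rightarrow> bool" where
  "bounded_operator N\<^sub>1 N\<^sub>2 T \<longleftrightarrow>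
     (\<exists>C\<ge>0. \<forall>f\<in>fun_space N\<^sub>1. T f \<in> fun_space N\<^sub>2 \<and> N\<^sub>2 (T f) \<le> ennreal C * N\<^sub>1 f)"

definition standard_Bergman_estimate :: "real measure \<Rightarrow> bool" where
  "standard_Bergman_estimate \<nu> \<longleftrightarrow>
     (let c = critical_index \<nu>; T = shimorin_op \<nu> in
        bounded_operator (Lp_norm 1) (weak_Lp_norm c) T \<and>
        (\<forall>p q::real. 1 < p \<and> ennreal p < dual_exponent c \<and> 1 / q = 1 / p + 1 / c - 1 \<longrightarrow>
           bounded_operator (Lp_norm (ennreal p)) (Lp_norm (ennreal q)) T) \<and>
        bounded_operator (Lp_norm (dual_exponent c)) BMO_norm T)"

end

(*
  In all three cases the condition on nu is equivalent to the kernel bound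
  |K(z,w)| <= C |1 - z cnj w|^(-2/c), c = c_nu, i.e. to
  int dnu(r) / ((1-r) + s) <= C s^(1-2/c) for 0 < s <= 2.

  Given the bound, the L^p-L^q estimates follow from a Schur test whose two conditions are the
  Forelli-Rudin estimate int (1-|w|^2)^(-s) |1 - z cnj w|^(-2) dA(w) <= C (1-|z|^2)^(-s), 0 < s < 1.
  The weak type estimate is deduced from a single L^p-L^q estimate: outside the set where the
  maximal function of f is large, f can be replaced by a bounded function of the same mass. At the
  endpoint, T f satisfies |T f(z) - T f(z')| <= A |z - z'| (1/(1-|z|) + 1/(1-|z'|)), hence grows
  at most logarithmically towards the boundary of a square contained in the disk.

  Conversely, testing the weak type estimate on the indicator of the disk of centre 1 - d and
  radius d/16 gives back the bound on int dnu(r) / ((1-r) + d).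
*)

theory Submission
  imports Defs
begin

section \<open>Normalized area measure and one-dimensional integrals\<close>

text \<open>The conditions for 1 < c see \<nu> only on [0,1), whereas the operator also sees an atom
  at 1. The definition of the critical index closes this gap: such an atom makes its integral
  infinite for every exponent above 1, so \<open>1 < critical_index \<nu>\<close> rules it out. The
  rest is an argument for a fixed exponent c. The three conditions differ because of how the
  integral of 1/((1-r) + s) behaves as s -> 0: for c = 1 the total mass controls it, for 1 < c < 2
  the masses of intervals ending at 1 do, and for c = 2 it has to stay bounded, where a power bound
  on these masses would still allow a logarithm. The size of the kernel is enough except at the
  exponent c', where it leaves a divergence of logarithmic type and differences of the kernel are
  estimated instead. Conversely, the test function needs convergent integrals before any
  quantitative bound is known; the bound for c = 1, which every finite measure satisfies, provides
  them.\<close>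

lemma space_area [simp]: "space area = unit_disk"
  by (simp add: area_def space_scale_measure)

lemma sets_area: "sets area = sets (lebesgue_on unit_disk)"
  by (simp add: area_def)

lemma borel_subset_area: "A \<in> sets borel \<Longrightarrow> A \<inter> unit_disk \<in> sets area"
  by (auto simp: sets_area sets_restrict_space)

lemma measurable_area_borel: "(\<lambda>x. x) \<in> area \<rightarrow>\<^sub>M borel"
proof -
  have "(\<lambda>x. x) \<in> lebesgue_on unit_disk \<rightarrow>\<^sub>M borel"
    by (intro measurable_restrict_space1 measurable_completion) simp
  then show ?thesis
    by (simp add: sets_area cong: measurable_cong_sets)
qed

lemma borel_measurable_cnj [measurable]: "cnj \<in> borel_measurable borel"
  by (intro borel_measurable_continuous_onI continuous_intros)

lemma borel_measurable_area: "f \<in> borel \<rightarrow>\<^sub>M N \<Longrightarrow> f \<in> area \<rightarrow>\<^sub>M N"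
  by (rule measurable_compose[OF measurable_area_borel])

text \<open>\<open>area\<close> carries the Lebesgue sigma-algebra, while the kernels are jointly
  Borel. Joint measurability passes to the product because the identity is measurable from
  \<open>area\<close> to \<open>borel\<close>.\<close>

lemma borel_measurable_pair_area:
  fixes F :: "complex \<Rightarrow> complex \<Rightarrow> 'b"
  assumes "(\<lambda>x. F (fst x) (snd x)) \<in> borel \<rightarrow>\<^sub>M N"
  shows "(\<lambda>x. F (fst x) (snd x)) \<in> area \<Otimes>\<^sub>M area \<rightarrow>\<^sub>M N"
proof -
  have *: "(\<lambda>x. F (fst x) (snd x)) \<in> borel \<Otimes>\<^sub>M borel \<rightarrow>\<^sub>M N"
    using assms by (simp add: borel_prod)
  have "(\<lambda>x. (fst x, snd x)) \<in> area \<Otimes>\<^sub>M area \<rightarrow>\<^sub>M borel \<Otimes>\<^sub>M borel"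
    by (intro measurable_Pair measurable_compose[OF measurable_fst measurable_area_borel]
        measurable_compose[OF measurable_snd measurable_area_borel])
  from measurable_compose[OF this *] show ?thesis by simp
qed

lemma emeasure_area:
  "A \<subseteq> unit_disk \<Longrightarrow> emeasure area A = ennreal (1 / pi) * emeasure lebesgue A"
proof -
  assume A: "A \<subseteq> unit_disk"
  have "1 / ennreal pi = ennreal (1 / pi)"
    using divide_ennreal[of 1 pi] by simp
  then show ?thesis
    using A by (simp add: area_def emeasure_restrict_space)
qed

lemma nn_integral_area:
  assumes "f \<in> borel_measurable area"
  shows "(\<integral>\<^sup>+ z. f z \<partial>area) = ennreal (1 / pi) * (\<integral>\<^sup>+ z. f z * indicator unit_disk z \<partial>lebesgue)"
proof -
  have "1 / ennreal pi = ennreal (1 / pi)"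
    using divide_ennreal[of 1 pi] by simp
  moreover have "f \<in> borel_measurable (lebesgue_on unit_disk)"
    using assms by (simp add: sets_area cong: measurable_cong_sets)
  ultimately show ?thesis
    by (simp add: area_def nn_integral_scale_measure nn_integral_restrict_space)
qed

lemma emeasure_ball_complex: "r \<ge> 0 \<Longrightarrow> emeasure lborel (ball (a::complex) r) = ennreal (pi * r\<^sup>2)"
  by (simp add: emeasure_ball unit_ball_vol_2)

lemma emeasure_area_ball:
  assumes "r \<ge> 0" "ball a r \<subseteq> unit_disk"
  shows "emeasure area (ball a r) = ennreal (r\<^sup>2)"
  using assms by (simp add: emeasure_area emeasure_ball_complex flip: ennreal_mult)

lemma emeasure_area_space [simp]: "emeasure area unit_disk = 1"
  by (simp add: emeasure_area_ball)

interpretation area: finite_measure area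
  by standard simp

lemma emeasure_area_ball_le:
  assumes "r \<ge> 0"
  shows "emeasure area (ball a r \<inter> unit_disk) \<le> ennreal (r\<^sup>2)"
proof -
  have "emeasure area (ball a r \<inter> unit_disk) = ennreal (1 / pi) * emeasure lebesgue (ball a r \<inter> unit_disk)"
    by (simp add: emeasure_area)
  also have "\<dots> \<le> ennreal (1 / pi) * emeasure lebesgue (ball a r)"
    by (intro mult_left_mono emeasure_mono) auto
  also have "\<dots> = ennreal (r\<^sup>2)"
    using assms by (simp add: emeasure_ball_complex flip: ennreal_mult)
  finally show ?thesis .
qed

text \<open>Pulling the centre towards the origin to (1 - s/2) a leaves room for a ball of radius
  s/2 that lies both in the given ball and in the disk. The constant is therefore uniform up to the
  boundary.\<close>

lemma emeasure_area_ball_ge: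
  assumes "0 < s" "s \<le> 1" "a \<in> unit_disk"
  shows "ennreal (s\<^sup>2 / 4) \<le> emeasure area (ball a s \<inter> unit_disk)"
proof -
  define b where "b = (1 - s / 2) *\<^sub>R a"
  have na: "norm a < 1" using assms by simp
  have "a - b = (s / 2) *\<^sub>R a" by (simp add: b_def algebra_simps)
  then have "dist a b = s / 2 * norm a" using assms by (simp add: dist_norm)
  then have 1: "dist a b \<le> s / 2" using na assms by (simp add: mult_le_cancel_left)
  have "norm b = (1 - s / 2) * norm a" using assms by (simp add: b_def)
  also have "\<dots> \<le> 1 - s / 2" using na assms by (simp add: mult_le_cancel_left)
  finally have 2: "norm b \<le> 1 - s / 2" .
  have 3: "ball b (s / 2) \<subseteq> ball a s"
    using 1 by (smt (verit, best) dist_triangle mem_ball subsetI field_sum_of_halves)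
  have 4: "ball b (s / 2) \<subseteq> unit_disk"
  proof
    fix x assume "x \<in> ball b (s / 2)"
    then have "norm (b - x) < s / 2" by (simp add: dist_norm)
    moreover have "norm x \<le> norm b + norm (b - x)"
      by (metis norm_minus_commute norm_triangle_sub)
    ultimately show "x \<in> unit_disk" using 2 by simp
  qed
  have "ennreal (s\<^sup>2 / 4) = emeasure area (ball b (s / 2))"
    using assms 4 by (simp add: emeasure_area_ball power_divide)
  also have "\<dots> \<le> emeasure area (ball a s \<inter> unit_disk)"
    using 3 4 by (intro emeasure_mono borel_subset_area) auto
  finally show ?thesis .
qed

section \<open>Iterated integration in the plane and power integrals on the line\<close>

lemma lborel_complex:
  "lborel = distr (lborel \<Otimes>\<^sub>M lborel) borel (\<lambda>x. Complex (fst x) (snd x))"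
proof (rule lborel_eqI)
  have [measurable]: "(\<lambda>x. Complex (fst x) (snd x)) \<in> borel_measurable (lborel \<Otimes>\<^sub>M lborel)"
    by (simp add: Complex_eq)
  fix l u :: complex
  assume le: "\<And>b. b \<in> Basis \<Longrightarrow> l \<bullet> b \<le> u \<bullet> b"
  have "(\<lambda>x. Complex (fst x) (snd x)) -` box l u = box (Re l) (Re u) \<times> box (Im l) (Im u)"
    by (auto simp: box_def Basis_complex_def)
  moreover have "Re l \<le> Re u" "Im l \<le> Im u"
    using le[of 1] le[of \<i>] by (auto simp: Basis_complex_def)
  ultimately show "emeasure (distr (lborel \<Otimes>\<^sub>M lborel) borel (\<lambda>x. Complex (fst x) (snd x))) (box l u)
      = (\<Prod>b\<in>Basis. (u - l) \<bullet> b)"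
    by (simp add: emeasure_distr space_pair_measure lborel.emeasure_pair_measure_Times
        Basis_complex_def prod.insert ennreal_mult)
qed simp

lemma nn_integral_complex:
  assumes [measurable]: "f \<in> borel_measurable borel"
  shows "(\<integral>\<^sup>+ z. f z \<partial>lborel) = (\<integral>\<^sup>+ x. \<integral>\<^sup>+ y. f (Complex x y) \<partial>lborel \<partial>lborel)"
proof -
  have [measurable]: "(\<lambda>x. Complex (fst x) (snd x)) \<in> borel_measurable (lborel \<Otimes>\<^sub>M lborel)"
    by (simp add: Complex_eq)
  show ?thesis
    by (subst lborel_complex) (simp add: nn_integral_distr lborel.nn_integral_fst[symmetric])
qed

text \<open>Both orders of integration are kept: the inner variable will be the one in which the
  weight 1 - |w|^2 is singular, and this is either coordinate, depending on the region.\<close>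

lemma nn_integral_complex':
  assumes [measurable]: "f \<in> borel_measurable borel"
  shows "(\<integral>\<^sup>+ z. f z \<partial>lborel) = (\<integral>\<^sup>+ y. \<integral>\<^sup>+ x. f (Complex x y) \<partial>lborel \<partial>lborel)"
proof -
  have [measurable]: "(\<lambda>x. Complex (fst x) (snd x)) \<in> borel_measurable (lborel \<Otimes>\<^sub>M lborel)"
    by (simp add: Complex_eq)
  show ?thesis
    by (subst lborel_complex) (simp add: nn_integral_distr lborel_pair.nn_integral_snd[symmetric])
qed

lemma nn_integral_area_le:
  assumes [measurable]: "f \<in> borel_measurable borel"
  shows "(\<integral>\<^sup>+ z. f z \<partial>area) \<le> (\<integral>\<^sup>+ z. f z * indicator unit_disk z \<partial>lborel)"
proof -
  have "(\<integral>\<^sup>+ z. f z \<partial>area) = ennreal (1 / pi) * (\<integral>\<^sup>+ z. f z * indicator unit_disk z \<partial>lebesgue)"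
    by (intro nn_integral_area borel_measurable_area) auto
  also have "\<dots> \<le> 1 * (\<integral>\<^sup>+ z. f z * indicator unit_disk z \<partial>lebesgue)"
  proof (intro mult_right_mono)
    show "ennreal (1 / pi) \<le> 1" using pi_ge_two by (simp add: ennreal_le_1)
  qed simp
  finally show ?thesis by (simp add: nn_integral_completion)
qed

lemma nn_integral_abs_le:
  fixes f :: "real \<Rightarrow> ennreal"
  assumes [measurable]: "f \<in> borel_measurable borel"
  shows "(\<integral>\<^sup>+ x. f \<bar>x - b\<bar> \<partial>lborel) \<le> 2 * (\<integral>\<^sup>+ x. f x * indicator {0..} x \<partial>lborel)"
proof -
  have "(\<integral>\<^sup>+ x. f \<bar>x - b\<bar> \<partial>lborel) = (\<integral>\<^sup>+ x. f \<bar>x\<bar> \<partial>lborel)"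
    using nn_integral_real_affine[of "\<lambda>x. f \<bar>x - b\<bar>" 1 b] by simp
  also have "\<dots> \<le> (\<integral>\<^sup>+ x. f x * indicator {0..} x + f (- x) * indicator {0..} (- x) \<partial>lborel)"
    by (intro nn_integral_mono) (auto simp: indicator_def abs_if)
  also have "\<dots> = (\<integral>\<^sup>+ x. f x * indicator {0..} x \<partial>lborel) + (\<integral>\<^sup>+ x. f (- x) * indicator {0..} (- x) \<partial>lborel)"
    by (intro nn_integral_add) auto
  also have "(\<integral>\<^sup>+ x. f (- x) * indicator {0..} (- x) \<partial>lborel) = (\<integral>\<^sup>+ x. f x * indicator {0..} x \<partial>lborel)"
    using nn_integral_real_affine[of "\<lambda>x. f x * indicator {0..} x" "-1" 0] by simp
  finally show ?thesis by (simp add: mult_2)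
qed

lemma nn_integral_powr_tail:
  fixes m \<sigma> :: real
  assumes "m > 0" "\<sigma> > 0"
  shows "(\<integral>\<^sup>+ x. ennreal ((m + \<bar>x - b\<bar>) powr (- 1 - \<sigma>)) \<partial>lborel) \<le> ennreal (2 / \<sigma> * m powr - \<sigma>)"
proof -
  have "((\<lambda>x. - ((m + x) powr - \<sigma>) / \<sigma>) \<longlongrightarrow> 0) at_top"
  proof -
    have "((\<lambda>x. (m + x) powr - \<sigma>) \<longlongrightarrow> 0) at_top"
      by (intro tendsto_neg_powr filterlim_tendsto_add_at_top[OF tendsto_const] filterlim_ident)
        (use assms in simp)
    from tendsto_divide[OF tendsto_minus[OF this] tendsto_const[of \<sigma>]] show ?thesis
      using assms by simp
  qed
  then have "(\<integral>\<^sup>+ x. ennreal ((m + x) powr (- 1 - \<sigma>)) * indicator {0..} x \<partial>lborel)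
      = ennreal (0 - (- ((m + 0) powr - \<sigma>) / \<sigma>))"
    by (intro nn_integral_FTC_atLeast)
      (use assms in \<open>auto intro!: derivative_eq_intros simp: field_simps minus_diff_commute\<close>)
  then have "2 * (\<integral>\<^sup>+ x. ennreal ((m + x) powr (- 1 - \<sigma>)) * indicator {0..} x \<partial>lborel)
      = ennreal (2 / \<sigma> * m powr - \<sigma>)"
    using assms by (simp add: ennreal_mult[symmetric] flip: ennreal_numeral)
  with nn_integral_abs_le[of "\<lambda>x. ennreal ((m + x) powr (- 1 - \<sigma>))" b] show ?thesis by simp
qed

lemma nn_integral_powr_near:
  fixes h s :: real
  assumes "h > 0" "0 < s" "s < 1"
  shows "(\<integral>\<^sup>+ x. ennreal (\<bar>x - b\<bar> powr - s * indicator {..h} \<bar>x - b\<bar>) \<partial>lborel)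
    \<le> ennreal (2 / (1 - s) * h powr (1 - s))"
proof -
  have "((\<lambda>x. x powr - s) has_integral h powr (- s + 1) / (- s + 1)) {0..h}"
    using assms by (intro has_integral_powr_from_0) auto
  then have "((\<lambda>x. x powr - s * indicator {0..h} x) has_integral h powr (- s + 1) / (- s + 1)) UNIV"
    by (subst (asm) has_integral_restrict_UNIV[symmetric])
      (simp add: indicator_def of_bool_def if_distrib cong: if_cong)
  then have "(\<integral>\<^sup>+ x. ennreal (x powr - s * indicator {0..h} x) \<partial>lborel) = h powr (- s + 1) / (- s + 1)"
    by (intro nn_integral_has_integral_lborel) auto
  moreover have "ennreal (x powr - s * indicator {..h} x) * indicator {0..} x
      = ennreal (x powr - s * indicator {0..h} x)" for x
    by (auto simp: indicator_def)
  ultimately have "2 * (\<integral>\<^sup>+ x. ennreal (x powr - s * indicator {..h} x) * indicator {0..} x \<partial>lborel)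
      = ennreal (2 / (1 - s) * h powr (1 - s))"
    using assms by (simp add: ennreal_mult[symmetric] flip: ennreal_numeral)
  with nn_integral_abs_le[of "\<lambda>x. ennreal (x powr - s * indicator {..h} x)" b] show ?thesis by simp
qed

text \<open>Split at |x - b| = m. Near b the second factor is at most m^(-2) and the pole is
  integrable because s < 1; farther away the first factor is at most m^(-s) and the second has an
  integrable tail. The points a and b are unrelated, so the bound is uniform in both.\<close>

lemma nn_integral_powr_mixed:
  fixes m s :: real
  assumes "m > 0" "0 < s" "s < 1"
  shows "(\<integral>\<^sup>+ x. ennreal (\<bar>x - b\<bar> powr - s * (m + \<bar>x - a\<bar>) powr - 2) \<partial>lborel)
    \<le> ennreal ((2 / (1 - s) + 2) * m powr (- 1 - s))"
proof -
  have "\<bar>x - b\<bar> powr - s * (m + \<bar>x - a\<bar>) powr - 2 \<le>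
      m powr - 2 * (\<bar>x - b\<bar> powr - s * indicator {..m} \<bar>x - b\<bar>) + m powr - s * (m + \<bar>x - a\<bar>) powr (- 1 - 1)" for x
  proof (cases "\<bar>x - b\<bar> \<le> m")
    case True
    have "(m + \<bar>x - a\<bar>) powr - 2 \<le> m powr - 2"
      using assms by (intro powr_mono2') auto
    then have "\<bar>x - b\<bar> powr - s * (m + \<bar>x - a\<bar>) powr - 2 \<le> \<bar>x - b\<bar> powr - s * m powr - 2"
      by (intro mult_left_mono) auto
    also have "\<dots> = m powr - 2 * (\<bar>x - b\<bar> powr - s * indicator {..m} \<bar>x - b\<bar>)"
      using True by simp
    finally have "\<bar>x - b\<bar> powr - s * (m + \<bar>x - a\<bar>) powr - 2
      \<le> m powr - 2 * (\<bar>x - b\<bar> powr - s * indicator {..m} \<bar>x - b\<bar>)" .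
    moreover have "0 \<le> m powr - s * (m + \<bar>x - a\<bar>) powr (- 1 - 1)"
      by simp
    ultimately show ?thesis by linarith
  next
    case False
    have "\<bar>x - b\<bar> powr - s \<le> m powr - s"
      using assms False by (intro powr_mono2') auto
    then show ?thesis using False by (simp add: mult_right_mono)
  qed
  then have "(\<integral>\<^sup>+ x. ennreal (\<bar>x - b\<bar> powr - s * (m + \<bar>x - a\<bar>) powr - 2) \<partial>lborel)
    \<le> (\<integral>\<^sup>+ x. ennreal (m powr - 2) * ennreal (\<bar>x - b\<bar> powr - s * indicator {..m} \<bar>x - b\<bar>)
         + ennreal (m powr - s) * ennreal ((m + \<bar>x - a\<bar>) powr (- 1 - 1)) \<partial>lborel)"
    by (intro nn_integral_mono) (simp add: ennreal_leI flip: ennreal_mult ennreal_plus)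
  also have "\<dots> = ennreal (m powr - 2) * (\<integral>\<^sup>+ x. ennreal (\<bar>x - b\<bar> powr - s * indicator {..m} \<bar>x - b\<bar>) \<partial>lborel)
         + ennreal (m powr - s) * (\<integral>\<^sup>+ x. ennreal ((m + \<bar>x - a\<bar>) powr (- 1 - 1)) \<partial>lborel)"
    by (simp add: nn_integral_add nn_integral_cmult)
  also have "\<dots> \<le> ennreal (m powr - 2) * ennreal (2 / (1 - s) * m powr (1 - s))
       + ennreal (m powr - s) * ennreal (2 / 1 * m powr - 1)"
    using assms by (intro add_mono mult_left_mono nn_integral_powr_near nn_integral_powr_tail) auto
  also have "\<dots> = ennreal (m powr - 2 * (2 / (1 - s) * m powr (1 - s)) + m powr - s * (2 / 1 * m powr - 1))"
    using assms by (simp del: times_divide_eq_left times_divide_eq_right flip: ennreal_mult ennreal_plus)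
  also have "m powr - 2 * (2 / (1 - s) * m powr (1 - s)) + m powr - s * (2 / 1 * m powr - 1)
      = 2 / (1 - s) * (m powr - 2 * m powr (1 - s)) + 2 * (m powr - s * m powr - 1)"
    by (simp add: mult_ac)
  also have "\<dots> = (2 / (1 - s) + 2) * m powr (- 1 - s)"
  proof -
    have "m powr - 2 * m powr (1 - s) = m powr (- 1 - s)" "m powr - s * m powr - 1 = m powr (- 1 - s)"
      by (simp_all only: powr_add[symmetric]) (simp_all add: minus_diff_commute)
    then show ?thesis by (simp only: distrib_right)
  qed
  finally show ?thesis .
qed

text \<open>The pole in the inner variable may move with y, since the one-dimensional estimate is
  uniform in it. This lets the pole follow an arc of the unit circle.\<close>

lemma nn_integral_powr_mixed2:
  fixes m s :: real
  assumes "m > 0" "0 < s" "s < 1"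
  shows "(\<integral>\<^sup>+ y. \<integral>\<^sup>+ x. ennreal (\<bar>x - b y\<bar> powr - s * (m + \<bar>x - x0\<bar> + \<bar>y - y0\<bar>) powr - 2) \<partial>lborel \<partial>lborel)
    \<le> ennreal ((2 / (1 - s) + 2) * (2 / s) * m powr - s)"
proof -
  have "(\<integral>\<^sup>+ y. \<integral>\<^sup>+ x. ennreal (\<bar>x - b y\<bar> powr - s * (m + \<bar>x - x0\<bar> + \<bar>y - y0\<bar>) powr - 2) \<partial>lborel \<partial>lborel)
    \<le> (\<integral>\<^sup>+ y. ennreal (2 / (1 - s) + 2) * ennreal ((m + \<bar>y - y0\<bar>) powr (- 1 - s)) \<partial>lborel)"
  proof (intro nn_integral_mono)
    fix y
    show "(\<integral>\<^sup>+ x. ennreal (\<bar>x - b y\<bar> powr - s * (m + \<bar>x - x0\<bar> + \<bar>y - y0\<bar>) powr - 2) \<partial>lborel)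
      \<le> ennreal (2 / (1 - s) + 2) * ennreal ((m + \<bar>y - y0\<bar>) powr (- 1 - s))"
      using nn_integral_powr_mixed[of "m + \<bar>y - y0\<bar>" s "b y" x0] assms
      by (simp add: ennreal_mult add_ac)
  qed
  also have "\<dots> = ennreal (2 / (1 - s) + 2) * (\<integral>\<^sup>+ y. ennreal ((m + \<bar>y - y0\<bar>) powr (- 1 - s)) \<partial>lborel)"
    by (simp add: nn_integral_cmult)
  also have "\<dots> \<le> ennreal (2 / (1 - s) + 2) * ennreal (2 / s * m powr - s)"
    using assms by (intro mult_left_mono nn_integral_powr_tail) auto
  also have "\<dots> = ennreal ((2 / (1 - s) + 2) * (2 / s) * m powr - s)"
    by (subst ennreal_mult[symmetric]) (use assms in \<open>auto simp: mult.assoc\<close>)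
  finally show ?thesis .
qed

section \<open>Forelli-Rudin estimates\<close>

text \<open>This says that the pseudohyperbolic distance is at most 1. It is what allows the kernel
  to be compared with Euclidean distances.\<close>

lemma norm_one_minus_ge_diff:
  fixes z w :: complex
  assumes "z \<in> unit_disk" "w \<in> unit_disk"
  shows "norm (z - w) \<le> norm (1 - z * cnj w)"
proof (rule power2_le_imp_le)
  have "(norm z)\<^sup>2 \<le> 1" "(norm w)\<^sup>2 \<le> 1" using assms by (auto simp: power_le_one)
  then have "0 \<le> (1 - (norm z)\<^sup>2) * (1 - (norm w)\<^sup>2)" by simp
  also have "\<dots> = (norm (1 - z * cnj w))\<^sup>2 - (norm (z - w))\<^sup>2"
    unfolding cmod_power2 by (simp add: power2_eq_square algebra_simps)
  finally show "(norm (z - w))\<^sup>2 \<le> (norm (1 - z * cnj w))\<^sup>2" by simp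
qed simp

lemma norm_one_minus_ge:
  fixes z w :: complex
  assumes "w \<in> unit_disk"
  shows "1 - norm z \<le> norm (1 - z * cnj w)"
proof -
  have "norm (z * cnj w) \<le> norm z" using assms by (simp add: norm_mult mult_left_le)
  moreover have "1 - norm (z * cnj w) \<le> norm (1 - z * cnj w)"
    using norm_triangle_ineq2[of 1 "z * cnj w"] by simp
  ultimately show ?thesis by simp
qed

lemma norm_one_minus_commute:
  fixes z w :: complex
  shows "norm (1 - z * cnj w) = norm (1 - w * cnj z)"
proof -
  have "norm (1 - z * cnj w) = norm (cnj (1 - z * cnj w))" by (simp only: complex_mod_cnj)
  then show ?thesis by (simp add: mult.commute)
qed

lemma norm_one_minus_pos:
  fixes z w :: complex
  assumes "z \<in> unit_disk" "w \<in> unit_disk"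
  shows "0 < norm (1 - z * cnj w)"
  using norm_one_minus_ge[of w z] assms by (simp del: zero_less_norm_iff)

lemma norm_one_minus_le:
  fixes z w :: complex
  assumes "z \<in> unit_disk" "w \<in> unit_disk"
  shows "norm (1 - z * cnj w) \<le> 2"
proof -
  have "norm (z * cnj w) \<le> 1" using assms by (simp add: norm_mult mult_le_one)
  then show ?thesis using norm_triangle_ineq4[of 1 "z * cnj w"] by simp
qed

text \<open>Averaging three lower bounds of |1 - z cnj w|, namely 1 - |z| and the two coordinate
  distances, gives the factor 3. The result is a sum over coordinates, suited to iterated
  integration.\<close>

lemma kernel_powr_le:
  fixes z w :: complex
  assumes "z \<in> unit_disk" "w \<in> unit_disk" "0 \<le> t"
  shows "norm (1 - z * cnj w) powr - t
    \<le> 3 powr t * (1 - norm z + \<bar>Re w - Re z\<bar> + \<bar>Im w - Im z\<bar>) powr - t"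
proof -
  let ?d = "1 - norm z + \<bar>Re w - Re z\<bar> + \<bar>Im w - Im z\<bar>"
  have "\<bar>Re w - Re z\<bar> \<le> norm (z - w)" "\<bar>Im w - Im z\<bar> \<le> norm (z - w)"
    using abs_Re_le_cmod[of "z - w"] abs_Im_le_cmod[of "z - w"] by (simp_all add: abs_minus_commute)
  then have "?d / 3 \<le> norm (1 - z * cnj w)"
    using norm_one_minus_ge_diff[OF assms(1,2)] norm_one_minus_ge[OF assms(2), of z] by simp
  moreover have "0 < ?d" using assms by simp
  ultimately have "norm (1 - z * cnj w) powr - t \<le> (?d / 3) powr - t"
    using assms by (intro powr_mono2') auto
  also have "\<dots> = 3 powr t * ?d powr - t"
    using \<open>0 < ?d\<close> by (simp add: powr_divide powr_minus field_simps)
  finally show ?thesis .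
qed

text \<open>With a = sqrt (1 - y^2), the weight base factors as (a - |x|)(a + |x|). The restriction
  |y| \<le> |x| forces y^2 \<le> 1/2 and keeps the second factor above 1/2, so only the linear zero
  of the first one matters.\<close>

lemma weight_powr_le_half:
  fixes x y s :: real
  assumes "x\<^sup>2 + y\<^sup>2 < 1" "\<bar>y\<bar> \<le> \<bar>x\<bar>" "0 < s" "s < 1"
  shows "(1 - (x\<^sup>2 + y\<^sup>2)) powr - s
    \<le> 2 * (\<bar>x - sqrt (1 - y\<^sup>2)\<bar> powr - s + \<bar>x - - sqrt (1 - y\<^sup>2)\<bar> powr - s)"
proof -
  let ?a = "sqrt (1 - y\<^sup>2)"
  have "y\<^sup>2 \<le> x\<^sup>2" using assms by (simp add: abs_le_square_iff)
  then have y: "y\<^sup>2 \<le> 1 / 2" using assms by simp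
  then have a2: "?a\<^sup>2 = 1 - y\<^sup>2" by simp
  have "1 / 2 \<le> ?a" using y by (intro real_le_rsqrt) (auto simp: power2_eq_square)
  have "\<bar>x\<bar> < ?a" using assms by (intro real_less_rsqrt) auto
  have "(?a - \<bar>x\<bar>) / 2 \<le> (?a - \<bar>x\<bar>) * (?a + \<bar>x\<bar>)"
    using \<open>1 / 2 \<le> ?a\<close> \<open>\<bar>x\<bar> < ?a\<close> mult_left_mono[of "1 / 2" "?a + \<bar>x\<bar>" "?a - \<bar>x\<bar>"] by simp
  also have "\<dots> = 1 - (x\<^sup>2 + y\<^sup>2)"
    using a2 by (simp add: algebra_simps power2_eq_square)
  finally have "(1 - (x\<^sup>2 + y\<^sup>2)) powr - s \<le> ((?a - \<bar>x\<bar>) / 2) powr - s"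
    using assms \<open>\<bar>x\<bar> < ?a\<close> by (intro powr_mono2') auto
  also have "\<dots> = 2 powr s * (?a - \<bar>x\<bar>) powr - s"
    using \<open>\<bar>x\<bar> < ?a\<close> by (simp add: powr_divide powr_minus field_simps)
  also have "\<dots> \<le> 2 powr 1 * (?a - \<bar>x\<bar>) powr - s"
    using assms by (intro mult_right_mono powr_mono) auto
  also have "(?a - \<bar>x\<bar>) powr - s \<le> \<bar>x - ?a\<bar> powr - s + \<bar>x - - ?a\<bar> powr - s"
  proof (cases "x \<ge> 0")
    case True
    then have "\<bar>x - ?a\<bar> = ?a - \<bar>x\<bar>" using \<open>\<bar>x\<bar> < ?a\<close> by simp
    then show ?thesis by simp
  next
    case False
    then have "\<bar>x - - ?a\<bar> = ?a - \<bar>x\<bar>" using \<open>\<bar>x\<bar> < ?a\<close> by simp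
    then show ?thesis by simp
  qed
  finally show ?thesis by simp
qed

text \<open>One of the two regions always applies. Adding up all four poles removes the case
  distinction from the integrals.\<close>

lemma weight_powr_le:
  fixes x y s :: real
  assumes "x\<^sup>2 + y\<^sup>2 < 1" "0 < s" "s < 1"
  shows "(1 - (x\<^sup>2 + y\<^sup>2)) powr - s
    \<le> 2 * (\<bar>x - sqrt (1 - y\<^sup>2)\<bar> powr - s + \<bar>x - - sqrt (1 - y\<^sup>2)\<bar> powr - s
        + \<bar>y - sqrt (1 - x\<^sup>2)\<bar> powr - s + \<bar>y - - sqrt (1 - x\<^sup>2)\<bar> powr - s)"
proof (cases "\<bar>y\<bar> \<le> \<bar>x\<bar>")
  case True
  then show ?thesis using weight_powr_le_half[of x y s] assms
    by (smt (verit) powr_ge_zero)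
next
  case False
  then show ?thesis using weight_powr_le_half[of y x s] assms
    by (smt (verit) powr_ge_zero)
qed

text \<open>The coordinate bound for the kernel (factor 9) times the four-pole bound for the weight
  (factor 2) gives four integrals with a single moving pole, each taken first in the coordinate that
  carries the pole.\<close>

lemma Forelli_Rudin_boundary_weight:
  fixes s :: real
  assumes "0 < s" "s < 1"
  obtains C where "C > 0"
    "\<And>z. z \<in> unit_disk \<Longrightarrow>
      (\<integral>\<^sup>+ w. ennreal (norm (1 - z * cnj w) powr - 2 * (1 - (norm w)\<^sup>2) powr - s) \<partial>area)
        \<le> ennreal (C * (1 - (norm z)\<^sup>2) powr - s)"
proof
  define C\<^sub>1 where "C\<^sub>1 = (2 / (1 - s) + 2) * (2 / s)"
  have C1: "C\<^sub>1 > 0" using assms by (auto simp: C\<^sub>1_def intro!: mult_pos_pos add_pos_pos divide_pos_pos)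
  then show "144 * C\<^sub>1 > 0" by simp
  fix z :: complex assume z: "z \<in> unit_disk"
  let ?m = "1 - norm z"
  have m: "0 < ?m" using z by simp
  define D where "D x y = (?m + \<bar>x - Re z\<bar> + \<bar>y - Im z\<bar>) powr - 2" for x y
  define E where "E b x y = ennreal (\<bar>x - b y\<bar> powr - s * D x y)" for b x y
  define E' where "E' b x y = ennreal (\<bar>y - b x\<bar> powr - s * D x y)" for b x y
  have [measurable]: "(\<lambda>w. D (fst w) (snd w)) \<in> borel_measurable (lborel \<Otimes>\<^sub>M lborel)"
    unfolding D_def by measurable
  define r where "r y = sqrt (1 - y\<^sup>2)" for y :: real
  define r' where "r' y = - sqrt (1 - y\<^sup>2)" for y :: real
  have [measurable]: "r \<in> borel_measurable borel" "r' \<in> borel_measurable borel"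
    unfolding r_def r'_def by measurable
  have D0: "D x y \<ge> 0" for x y by (simp add: D_def)
  have [measurable]: "(\<lambda>x. D x y) \<in> borel_measurable borel" "(\<lambda>y. D x y) \<in> borel_measurable borel" for x y
    unfolding D_def by measurable
  have pt: "ennreal (norm (1 - z * cnj w) powr - 2 * (1 - (norm w)\<^sup>2) powr - s) * indicator unit_disk w
    \<le> ennreal 18 * (E r (Re w) (Im w) + E r' (Re w) (Im w) + E' r (Re w) (Im w) + E' r' (Re w) (Im w))" for w
  proof (cases "w \<in> unit_disk")
    case True
    define x where "x = Re w"
    define y where "y = Im w"
    have nw: "(norm w)\<^sup>2 = x\<^sup>2 + y\<^sup>2" by (simp add: cmod_power2 x_def y_def)
    have "(norm w)\<^sup>2 < 1" using True by (simp add: power_less_one_iff)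
    then have "(1 - (norm w)\<^sup>2) powr - s
        \<le> 2 * (\<bar>x - r y\<bar> powr - s + \<bar>x - r' y\<bar> powr - s + \<bar>y - r x\<bar> powr - s + \<bar>y - r' x\<bar> powr - s)"
      using weight_powr_le[of x y s] assms by (simp add: nw r_def r'_def)
    moreover have "norm (1 - z * cnj w) powr - 2 \<le> 9 * D x y"
      using kernel_powr_le[OF z True, of 2] by (simp add: D_def x_def y_def)
    ultimately have "norm (1 - z * cnj w) powr - 2 * (1 - (norm w)\<^sup>2) powr - s \<le> 9 * D x y *
        (2 * (\<bar>x - r y\<bar> powr - s + \<bar>x - r' y\<bar> powr - s + \<bar>y - r x\<bar> powr - s + \<bar>y - r' x\<bar> powr - s))"
      by (intro mult_mono) (auto intro: D0)
    also have "\<dots> = 18 * (\<bar>x - r y\<bar> powr - s * D x y + \<bar>x - r' y\<bar> powr - s * D x y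
        + \<bar>y - r x\<bar> powr - s * D x y + \<bar>y - r' x\<bar> powr - s * D x y)"
      by (simp add: algebra_simps)
    finally show ?thesis using True D0
      by (simp add: E_def E'_def x_def[symmetric] y_def[symmetric] ennreal_leI
          del: ennreal_numeral flip: ennreal_mult ennreal_plus)
  qed simp
  have mE: "(\<lambda>w. E b (Re w) (Im w)) \<in> borel_measurable borel" "(\<lambda>w. E' b (Re w) (Im w)) \<in> borel_measurable borel"
    if [measurable]: "b \<in> borel_measurable borel" for b
    unfolding E_def E'_def D_def by measurable
  have E: "(\<integral>\<^sup>+ w. E b (Re w) (Im w) \<partial>lborel) \<le> ennreal (C\<^sub>1 * ?m powr - s)"
    if [measurable]: "b \<in> borel_measurable borel" for b
  proof -
    have "(\<integral>\<^sup>+ w. E b (Re w) (Im w) \<partial>lborel) = (\<integral>\<^sup>+ y. \<integral>\<^sup>+ x. E b x y \<partial>lborel \<partial>lborel)"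
      using nn_integral_complex'[of "\<lambda>w. E b (Re w) (Im w)"] mE(1)[OF that] by simp
    also have "\<dots> \<le> ennreal (C\<^sub>1 * ?m powr - s)"
      unfolding E_def D_def C\<^sub>1_def using assms m by (intro nn_integral_powr_mixed2)
    finally show ?thesis .
  qed
  have E': "(\<integral>\<^sup>+ w. E' b (Re w) (Im w) \<partial>lborel) \<le> ennreal (C\<^sub>1 * ?m powr - s)"
    if [measurable]: "b \<in> borel_measurable borel" for b
  proof -
    have "(\<integral>\<^sup>+ w. E' b (Re w) (Im w) \<partial>lborel) = (\<integral>\<^sup>+ x. \<integral>\<^sup>+ y. E' b x y \<partial>lborel \<partial>lborel)"
      using nn_integral_complex[of "\<lambda>w. E' b (Re w) (Im w)"] mE(2)[OF that] by simp
    also have "\<dots> = (\<integral>\<^sup>+ x. \<integral>\<^sup>+ y. ennreal (\<bar>y - b x\<bar> powr - s *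
        (?m + \<bar>y - Im z\<bar> + \<bar>x - Re z\<bar>) powr - 2) \<partial>lborel \<partial>lborel)"
      by (simp add: E'_def D_def add_ac)
    also have "\<dots> \<le> ennreal (C\<^sub>1 * ?m powr - s)"
      unfolding C\<^sub>1_def using assms m by (intro nn_integral_powr_mixed2)
    finally show ?thesis .
  qed
  note [measurable] = mE[of r] mE[of r']
  have "(\<integral>\<^sup>+ w. ennreal (norm (1 - z * cnj w) powr - 2 * (1 - (norm w)\<^sup>2) powr - s) \<partial>area)
    \<le> (\<integral>\<^sup>+ w. ennreal (norm (1 - z * cnj w) powr - 2 * (1 - (norm w)\<^sup>2) powr - s) * indicator unit_disk w \<partial>lborel)"
    by (rule nn_integral_area_le) measurable
  also have "\<dots> \<le> (\<integral>\<^sup>+ w. ennreal 18 * (E r (Re w) (Im w) + E r' (Re w) (Im w) + E' r (Re w) (Im w) + E' r' (Re w) (Im w)) \<partial>lborel)"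
    by (intro nn_integral_mono pt)
  also have "\<dots> = ennreal 18 * ((\<integral>\<^sup>+ w. E r (Re w) (Im w) \<partial>lborel) + (\<integral>\<^sup>+ w. E r' (Re w) (Im w) \<partial>lborel)
      + (\<integral>\<^sup>+ w. E' r (Re w) (Im w) \<partial>lborel) + (\<integral>\<^sup>+ w. E' r' (Re w) (Im w) \<partial>lborel))"
    by (simp add: nn_integral_cmult nn_integral_add)
  also have "\<dots> \<le> ennreal 18 * (ennreal (C\<^sub>1 * ?m powr - s) + ennreal (C\<^sub>1 * ?m powr - s)
      + ennreal (C\<^sub>1 * ?m powr - s) + ennreal (C\<^sub>1 * ?m powr - s))"
    by (intro mult_left_mono add_mono E E') auto
  also have "\<dots> = ennreal (72 * C\<^sub>1 * ?m powr - s)"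
    using C1 by (simp del: ennreal_numeral add: algebra_simps flip: ennreal_mult ennreal_plus)
  \<comment> \<open>The last factor 2 comes from 1 - |z|^2 \<le> 2 (1 - |z|) and 2^s \<le>
    2.\<close>
  also have "\<dots> \<le> ennreal (144 * C\<^sub>1 * (1 - (norm z)\<^sup>2) powr - s)"
  proof (intro ennreal_leI)
    have z1: "(norm z)\<^sup>2 < 1" using z by (simp add: power_less_one_iff)
    have "(1 - (norm z)\<^sup>2) = (1 - norm z) * (1 + norm z)" by (simp add: power2_eq_square algebra_simps)
    also have "\<dots> \<le> ?m * 2" using z by (intro mult_left_mono) auto
    finally have "(1 - (norm z)\<^sup>2) / 2 \<le> ?m" by simp
    then have "?m powr - s \<le> ((1 - (norm z)\<^sup>2) / 2) powr - s"
      using assms z1 by (intro powr_mono2') auto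
    also have "\<dots> = 2 powr s * (1 - (norm z)\<^sup>2) powr - s"
      using z1 by (simp add: powr_divide powr_minus field_simps)
    also have "\<dots> \<le> 2 powr 1 * (1 - (norm z)\<^sup>2) powr - s"
      using assms by (intro mult_right_mono powr_mono) auto
    finally have "?m powr - s \<le> 2 * (1 - (norm z)\<^sup>2) powr - s" by simp
    then have "72 * C\<^sub>1 * ?m powr - s \<le> 72 * C\<^sub>1 * (2 * (1 - (norm z)\<^sup>2) powr - s)"
      using C1 by (intro mult_left_mono) auto
    then show "72 * C\<^sub>1 * ?m powr - s \<le> 144 * C\<^sub>1 * (1 - (norm z)\<^sup>2) powr - s" by simp
  qed
  finally show "(\<integral>\<^sup>+ w. ennreal (norm (1 - z * cnj w) powr - 2 * (1 - (norm w)\<^sup>2) powr - s) \<partial>area)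
        \<le> ennreal (144 * C\<^sub>1 * (1 - (norm z)\<^sup>2) powr - s)" .
qed

lemma Forelli_Rudin_unweighted:
  fixes s :: real
  assumes "0 < s"
  obtains C where "C > 0"
    "\<And>z. z \<in> unit_disk \<Longrightarrow>
      (\<integral>\<^sup>+ w. ennreal (norm (1 - z * cnj w) powr (- 2 - s)) \<partial>area) \<le> ennreal (C * (1 - norm z) powr - s)"
proof
  define C where "C = 3 powr (2 + s) * (2 / (1 + s) * (2 / s))"
  show "C > 0" using assms by (simp add: C_def)
  fix z :: complex assume z: "z \<in> unit_disk"
  let ?m = "1 - norm z"
  have m: "0 < ?m" using z by simp
  define D where "D x y = (?m + \<bar>x - Re z\<bar> + \<bar>y - Im z\<bar>) powr (- 2 - s)" for x y
  have mD [measurable]: "(\<lambda>w. D (Re w) (Im w)) \<in> borel_measurable borel"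
    unfolding D_def by measurable
  have "(\<integral>\<^sup>+ w. ennreal (norm (1 - z * cnj w) powr (- 2 - s)) \<partial>area)
    \<le> (\<integral>\<^sup>+ w. ennreal (norm (1 - z * cnj w) powr (- 2 - s)) * indicator unit_disk w \<partial>lborel)"
    by (rule nn_integral_area_le) measurable
  also have "\<dots> \<le> (\<integral>\<^sup>+ w. ennreal (3 powr (2 + s)) * ennreal (D (Re w) (Im w)) \<partial>lborel)"
  proof (intro nn_integral_mono)
    fix w :: complex
    show "ennreal (norm (1 - z * cnj w) powr (- 2 - s)) * indicator unit_disk w
      \<le> ennreal (3 powr (2 + s)) * ennreal (D (Re w) (Im w))"
    proof (cases "w \<in> unit_disk")
      case True
      have "norm (1 - z * cnj w) powr - (2 + s) \<le> 3 powr (2 + s) * D (Re w) (Im w)"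
        using kernel_powr_le[OF z True, of "2 + s"] assms by (simp add: D_def)
      moreover have "0 \<le> D (Re w) (Im w)" by (simp add: D_def)
      ultimately show ?thesis using True by (simp add: ennreal_leI flip: ennreal_mult)
    qed simp
  qed
  also have "\<dots> = ennreal (3 powr (2 + s)) * (\<integral>\<^sup>+ y. \<integral>\<^sup>+ x. ennreal (D x y) \<partial>lborel \<partial>lborel)"
    by (simp add: nn_integral_cmult nn_integral_complex')
  also have "(\<integral>\<^sup>+ y. \<integral>\<^sup>+ x. ennreal (D x y) \<partial>lborel \<partial>lborel)
      \<le> (\<integral>\<^sup>+ y. ennreal (2 / (1 + s)) * ennreal ((?m + \<bar>y - Im z\<bar>) powr (- 1 - s)) \<partial>lborel)"
  proof (intro nn_integral_mono)
    fix y
    show "(\<integral>\<^sup>+ x. ennreal (D x y) \<partial>lborel) \<le> ennreal (2 / (1 + s)) * ennreal ((?m + \<bar>y - Im z\<bar>) powr (- 1 - s))"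
    proof -
      have e: "- 1 - (1 + s) = - 2 - s" "- (1 + s) = - 1 - s" by simp_all
      have "(\<integral>\<^sup>+ x. ennreal (D x y) \<partial>lborel)
        = (\<integral>\<^sup>+ x. ennreal ((?m + \<bar>y - Im z\<bar> + \<bar>x - Re z\<bar>) powr (- 2 - s)) \<partial>lborel)"
        by (simp add: D_def add_ac)
      also have "\<dots> \<le> ennreal (2 / (1 + s) * (?m + \<bar>y - Im z\<bar>) powr (- 1 - s))"
        using nn_integral_powr_tail[of "?m + \<bar>y - Im z\<bar>" "1 + s" "Re z", unfolded e] assms m by simp
      finally show ?thesis using assms by (subst ennreal_mult[symmetric]) auto
    qed
  qed
  also have "\<dots> = ennreal (2 / (1 + s)) * (\<integral>\<^sup>+ y. ennreal ((?m + \<bar>y - Im z\<bar>) powr (- 1 - s)) \<partial>lborel)"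
    by (simp add: nn_integral_cmult)
  also have "(\<integral>\<^sup>+ y. ennreal ((?m + \<bar>y - Im z\<bar>) powr (- 1 - s)) \<partial>lborel) \<le> ennreal (2 / s * ?m powr - s)"
    using assms m by (intro nn_integral_powr_tail) auto
  also have "ennreal (3 powr (2 + s)) * (ennreal (2 / (1 + s)) * ennreal (2 / s * ?m powr - s))
      = ennreal (C * ?m powr - s)"
    using assms unfolding C_def by (subst ennreal_mult[symmetric], simp, simp)+ (simp add: mult.assoc)
  finally show "(\<integral>\<^sup>+ w. ennreal (norm (1 - z * cnj w) powr (- 2 - s)) \<partial>area) \<le> ennreal (C * ?m powr - s)"
    by (simp add: mult_left_mono)
qed

section \<open>Strong type estimates for the Bergman potential\<close>

text \<open>A positive majorant of the operator, analogous to the Riesz potential of order 2 - 2/c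
  in the plane; for c = 1 it is the Bergman projection with the kernel replaced by its modulus.
  Values in [0,\<infinity>] make it meaningful without integrability.\<close>

definition bergman_potential :: "real \<Rightarrow> (complex \<Rightarrow> real) \<Rightarrow> complex \<Rightarrow> ennreal" where
  "bergman_potential c f z = (\<integral>\<^sup>+ w. ennreal (norm (1 - z * cnj w) powr - (2 / c) * f w) \<partial>area)"

lemma powr_weighted_mean_le_sum:
  fixes a b c \<alpha> \<beta> \<gamma> :: real
  assumes "0 \<le> a" "0 \<le> b" "0 \<le> c" "0 \<le> \<alpha>" "0 \<le> \<beta>" "0 \<le> \<gamma>" "\<alpha> + \<beta> + \<gamma> = 1"
  shows "a powr \<alpha> * b powr \<beta> * c powr \<gamma> \<le> a + b + c"
proof -
  let ?m = "a + b + c"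
  have "a powr \<alpha> * b powr \<beta> * c powr \<gamma> \<le> ?m powr \<alpha> * ?m powr \<beta> * ?m powr \<gamma>"
    using assms by (intro mult_mono powr_mono2) auto
  also have "\<dots> = ?m powr 1"
    using assms by (simp flip: powr_add)
  finally show ?thesis using assms by simp
qed

lemma AE_area_in_disk: "(\<And>z. z \<in> unit_disk \<Longrightarrow> P z) \<Longrightarrow> AE z in area. P z"
  by (rule AE_I2) simp

lemma measurable_kernel_pair:
  "(\<lambda>x. norm (1 - fst x * cnj (snd x)) powr t) \<in> borel_measurable (area \<Otimes>\<^sub>M area)"
  by (rule borel_measurable_pair_area[of "\<lambda>z w. norm (1 - z * cnj w) powr t"])
    (unfold borel_prod[symmetric], measurable)

lemma borel_measurable_weight [measurable]:
  "(\<lambda>w. (1 - (norm w)\<^sup>2) powr t) \<in> borel_measurable area"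
  by (rule borel_measurable_area) measurable

lemma borel_measurable_kernel [measurable]:
  "(\<lambda>w. norm (1 - z * cnj w) powr t) \<in> borel_measurable area"
  by (rule borel_measurable_area) measurable

text \<open>Schur test with a power of \<open>1 - |w|\<^sup>2\<close> as weight. Since \<open>1/q + (1 - 1/p) = 1/c\<close>, the kernel
  \<open>k powr (2/c)\<close>, \<open>k = 1/|1 - z cnj w|\<close>, is the product of \<open>k powr (2/q)\<close> and \<open>k powr (2 (1 - 1/p))\<close>,
  so that both Schur conditions involve only the exponent 2.\<close>

lemma bergman_potential_Lp_Lq:
  fixes c p q :: real
  assumes "1 \<le> c" "1 < p" "0 < q" and pq: "1 / q = 1 / p + 1 / c - 1"
  obtains C where "C > 0"
    "\<And>f u I. f \<in> borel_measurable area \<Longrightarrow> (\<And>w. 0 \<le> f w) \<Longrightarrow> (\<And>z. 0 \<le> u z) \<Longrightarrow> 0 < I \<Longrightarrow>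
      (\<integral>\<^sup>+ w. ennreal (f w powr p) \<partial>area) \<le> ennreal I \<Longrightarrow>
      (\<And>z. z \<in> unit_disk \<Longrightarrow> ennreal (u z) \<le> bergman_potential c f z) \<Longrightarrow>
      (\<integral>\<^sup>+ z. ennreal (u z powr q) \<partial>area) \<le> ennreal (C * I powr (q / p))"
proof -
  \<comment> \<open>Exponents of a three-factor Hoelder inequality: \<alpha> for a term in both z
    and w, \<beta> for f^p alone, \<gamma> for kernel and weight alone. The relation between p, q
    and c says exactly that they add up to 1.\<close>
  define \<alpha> where "\<alpha> = 1 / q"
  define \<beta> where "\<beta> = 1 - 1 / c"
  define \<gamma> where "\<gamma> = 1 - 1 / p"
  have \<alpha>: "\<alpha> > 0" using \<open>0 < q\<close> by (simp add: \<alpha>_def)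
  have \<beta>: "\<beta> \<ge> 0" using assms by (simp add: \<beta>_def field_simps)
  have \<gamma>: "\<gamma> > 0" using assms by (simp add: \<gamma>_def field_simps)
  have sum1: "\<alpha> + \<beta> + \<gamma> = 1" using pq by (simp add: \<alpha>_def \<beta>_def \<gamma>_def)
  have \<alpha>\<gamma>: "\<alpha> + \<gamma> = 1 / c" using pq by (simp add: \<alpha>_def \<gamma>_def)
  have ab_p: "\<alpha> + \<beta> = 1 / p" using pq by (simp add: \<alpha>_def \<beta>_def)
  then have \<alpha>\<beta>: "p * (\<alpha> + \<beta>) = 1" using assms by simp
  have q\<alpha>: "q * \<alpha> = 1" using \<open>0 < q\<close> by (simp add: \<alpha>_def)
  \<comment> \<open>The weights must cancel between the first and third factors, so s \<alpha> = t
    \<gamma> = a is wanted; s < 1 and t < 1 then require a below both \<alpha> and \<gamma>.\<close>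
  define a where "a = min \<alpha> \<gamma> / 2"
  have a: "0 < a" "a < \<alpha>" "a < \<gamma>" using \<alpha> \<gamma> by (auto simp: a_def)
  define s where "s = a / \<alpha>"
  define t where "t = a / \<gamma>"
  have s: "0 < s" "s < 1" using a \<alpha> by (auto simp: s_def)
  have t: "0 < t" "t < 1" using a \<gamma> by (auto simp: t_def)
  define W where "W w = 1 - (norm w)\<^sup>2" for w :: complex
  have W: "0 < W w" if "w \<in> unit_disk" for w using that by (simp add: W_def power_less_one_iff)
  obtain C\<^sub>1 where C1: "C\<^sub>1 > 0" "\<And>z. z \<in> unit_disk \<Longrightarrow>
      (\<integral>\<^sup>+ w. ennreal (norm (1 - z * cnj w) powr - 2 * W w powr - s) \<partial>area) \<le> ennreal (C\<^sub>1 * W z powr - s)"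
    using Forelli_Rudin_boundary_weight[OF s] unfolding W_def by blast
  obtain C\<^sub>2 where C2: "C\<^sub>2 > 0" "\<And>z. z \<in> unit_disk \<Longrightarrow>
      (\<integral>\<^sup>+ w. ennreal (norm (1 - z * cnj w) powr - 2 * W w powr - t) \<partial>area) \<le> ennreal (C\<^sub>2 * W z powr - t)"
    using Forelli_Rudin_boundary_weight[OF t] unfolding W_def by blast
  note [measurable] = borel_measurable_weight[folded W_def]
  \<comment> \<open>After integration the three terms of the sum contribute at most 1, 1 and
    \<open>C\<^sub>2\<close>.\<close>
  define K where "K = (2 + C\<^sub>2) powr q"
  have K: "K > 0" using C2 by (simp add: K_def)
  show ?thesis
  proof (rule that[of "K * C\<^sub>1"])
    show "K * C\<^sub>1 > 0" using K C1 by simp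
    fix f :: "complex \<Rightarrow> real" and u :: "complex \<Rightarrow> real" and I :: real
    assume f [measurable]: "f \<in> borel_measurable area" and f0: "\<And>w. 0 \<le> f w" and u0: "\<And>z. 0 \<le> u z"
      and I: "0 < I" and fI: "(\<integral>\<^sup>+ w. ennreal (f w powr p) \<partial>area) \<le> ennreal I"
      and uf: "\<And>z. z \<in> unit_disk \<Longrightarrow> ennreal (u z) \<le> bergman_potential c f z"
    \<comment> \<open>The factor (W w / W z)^s is the Schur weight: integrating the kernel against W
      z^(-s) over z reproduces W w^(-s), which cancels W w^s and leaves the mass of f^p.\<close>
    define A where "A z w = norm (1 - z * cnj w) powr - 2 * W z powr - s * (W w powr s * f w powr p)" for z w
    define S where "S z = (\<integral>\<^sup>+ w. ennreal (A z w) \<partial>area)" for z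
    have A0: "0 \<le> A z w" for z w by (simp add: A_def)
    have [measurable]: "(\<lambda>x. ennreal (A (fst x) (snd x))) \<in> borel_measurable (area \<Otimes>\<^sub>M area)"
      unfolding A_def using measurable_kernel_pair[measurable] by measurable
    have SI: "(\<integral>\<^sup>+ z. S z \<partial>area) \<le> ennreal (C\<^sub>1 * I)"
    proof -
      interpret pair_sigma_finite area area ..
      have "(\<integral>\<^sup>+ z. S z \<partial>area) = (\<integral>\<^sup>+ w. \<integral>\<^sup>+ z. ennreal (A z w) \<partial>area \<partial>area)"
        unfolding S_def by (intro Fubini'[symmetric]) (simp add: case_prod_beta')
      also have "\<dots> \<le> (\<integral>\<^sup>+ w. ennreal C\<^sub>1 * ennreal (f w powr p) \<partial>area)"
      proof (intro nn_integral_mono)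
        fix w assume "w \<in> space area"
        then have w: "w \<in> unit_disk" by simp
        have "(\<integral>\<^sup>+ z. ennreal (A z w) \<partial>area)
          = (\<integral>\<^sup>+ z. ennreal (W w powr s * f w powr p) * ennreal (norm (1 - w * cnj z) powr - 2 * W z powr - s) \<partial>area)"
          by (intro nn_integral_cong) (simp add: A_def norm_one_minus_commute[of w] mult_ac flip: ennreal_mult)
        also have "\<dots> = ennreal (W w powr s * f w powr p) * (\<integral>\<^sup>+ z. ennreal (norm (1 - w * cnj z) powr - 2 * W z powr - s) \<partial>area)"
          by (intro nn_integral_cmult) measurable
        also have "\<dots> \<le> ennreal (W w powr s * f w powr p) * ennreal (C\<^sub>1 * W w powr - s)"
          by (intro mult_left_mono C1 w) auto
        also have "\<dots> = ennreal (C\<^sub>1 * f w powr p * (W w powr s * W w powr - s))"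
          using C1 by (simp add: mult_ac flip: ennreal_mult)
        also have "W w powr s * W w powr - s = 1"
          using W[OF w] by (simp flip: powr_add)
        finally show "(\<integral>\<^sup>+ z. ennreal (A z w) \<partial>area) \<le> ennreal C\<^sub>1 * ennreal (f w powr p)"
          using C1 by (simp add: ennreal_mult)
      qed
      also have "\<dots> = ennreal C\<^sub>1 * (\<integral>\<^sup>+ w. ennreal (f w powr p) \<partial>area)"
        by (intro nn_integral_cmult) measurable
      also have "\<dots> \<le> ennreal C\<^sub>1 * ennreal I"
        by (intro mult_left_mono fI) auto
      finally show ?thesis using C1 I by (simp add: ennreal_mult)
    qed
    \<comment> \<open>The natural normalization divides \<open>A z w\<close> by \<open>S z\<close>,
      which may vanish. A positive majorant \<tau> takes its place and is then brought down to
      \<open>S z\<close>.\<close>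
    have u_le: "u z powr q \<le> K * I powr (\<beta> * q) * \<tau>"
      if z: "z \<in> unit_disk" and \<tau>: "0 < \<tau>" "S z \<le> ennreal \<tau>" for z \<tau>
    proof -
      let ?k = "\<lambda>w. norm (1 - z * cnj w)"
      have pt: "?k w powr - (2 / c) * f w \<le> (\<tau> powr \<alpha> * I powr \<beta>) *
          (A z w / \<tau> + f w powr p / I + W z powr t * (?k w powr - 2 * W w powr - t))"
        if w: "w \<in> unit_disk" for w
      proof (cases "f w = 0")
        case True
        then show ?thesis using I \<tau> by (simp add: A0)
      next
        case False
        then have fw: "f w > 0" using f0[of w] by simp
        note pos = W[OF z] W[OF w] fw I \<tau>(1) norm_one_minus_pos[OF z w]
        \<comment> \<open>An exact factorization: \<tau>, I and both weights cancel, the powers of f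
          add up to 1 and those of the kernel to -2/c. The inequality enters only
          afterwards.\<close>
        have "?k w powr - (2 / c) * f w = (\<tau> powr \<alpha> * I powr \<beta>) * ((A z w / \<tau>) powr \<alpha> * (f w powr p / I) powr \<beta> *
            (W z powr t * (?k w powr - 2 * W w powr - t)) powr \<gamma>)"
        proof -
          have 1: "(A z w / \<tau>) powr \<alpha> = ?k w powr (- 2 * \<alpha>) * W z powr (- a) * W w powr a * f w powr (p * \<alpha>) * \<tau> powr - \<alpha>"
          proof -
            define \<kappa> where "\<kappa> = ?k w powr - 2"
            have "\<kappa> powr \<alpha> = ?k w powr (- 2 * \<alpha>)" by (simp only: \<kappa>_def powr_powr)
            moreover have "0 \<le> \<kappa>" by (simp add: \<kappa>_def)
            moreover have "A z w = \<kappa> * W z powr - s * (W w powr s * f w powr p)" by (simp only: A_def \<kappa>_def)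
            ultimately show ?thesis
              using pos \<alpha> by (simp add: powr_mult powr_divide powr_powr s_def powr_minus_divide)
          qed
          have 2: "(f w powr p / I) powr \<beta> = f w powr (p * \<beta>) * I powr - \<beta>"
            using pos by (simp add: powr_divide powr_powr powr_minus_divide)
          have 3: "(W z powr t * (?k w powr - 2 * W w powr - t)) powr \<gamma>
              = W z powr a * ?k w powr (- 2 * \<gamma>) * W w powr - a"
            using pos \<gamma> by (simp add: powr_mult powr_powr t_def)
          have 4: "f w powr (p * \<alpha>) * f w powr (p * \<beta>) = f w"
            using \<alpha>\<beta> pos by (simp add: distrib_left flip: powr_add)
          have 5: "?k w powr (- 2 * \<alpha>) * ?k w powr (- 2 * \<gamma>) = ?k w powr - (2 / c)"
          proof -
            have "- 2 * \<alpha> + - 2 * \<gamma> = - (2 / c)" using \<alpha>\<gamma> by (simp add: algebra_simps)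
            then show ?thesis by (simp only: powr_add[symmetric])
          qed
          have 6: "x powr b * x powr - b = 1" if "x > 0" for x b :: real
            using that by (simp flip: powr_add)
          have "(\<tau> powr \<alpha> * I powr \<beta>) * ((A z w / \<tau>) powr \<alpha> * (f w powr p / I) powr \<beta> *
            (W z powr t * (?k w powr - 2 * W w powr - t)) powr \<gamma>)
            = (?k w powr (- 2 * \<alpha>) * ?k w powr (- 2 * \<gamma>)) * (f w powr (p * \<alpha>) * f w powr (p * \<beta>))
              * (W z powr a * W z powr - a) * (W w powr a * W w powr - a) * (\<tau> powr \<alpha> * \<tau> powr - \<alpha>) * (I powr \<beta> * I powr - \<beta>)"
            unfolding 1 2 3 by (simp only: mult_ac)
          also have "\<dots> = ?k w powr - (2 / c) * f w"
            unfolding 4 5 using pos by (simp only: 6)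
          finally show ?thesis by simp
        qed
        also have "\<dots> \<le> (\<tau> powr \<alpha> * I powr \<beta>) *
          (A z w / \<tau> + f w powr p / I + W z powr t * (?k w powr - 2 * W w powr - t))"
          using I \<tau> \<alpha> \<beta> \<gamma> sum1 A0
          by (intro mult_left_mono powr_weighted_mean_le_sum) auto
        finally show ?thesis .
      qed
      have "ennreal (u z) \<le> bergman_potential c f z" by (rule uf[OF z])
      also have "\<dots> \<le> (\<integral>\<^sup>+ w. ennreal (\<tau> powr \<alpha> * I powr \<beta>) * (ennreal (1 / \<tau>) * ennreal (A z w)
          + ennreal (1 / I) * ennreal (f w powr p) + ennreal (W z powr t) * ennreal (?k w powr - 2 * W w powr - t)) \<partial>area)"
        unfolding bergman_potential_def
      proof (intro nn_integral_mono)
        fix w assume "w \<in> space area"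
        then have w: "w \<in> unit_disk" by simp
        show "ennreal (?k w powr - (2 / c) * f w) \<le> ennreal (\<tau> powr \<alpha> * I powr \<beta>) * (ennreal (1 / \<tau>) * ennreal (A z w)
          + ennreal (1 / I) * ennreal (f w powr p) + ennreal (W z powr t) * ennreal (?k w powr - 2 * W w powr - t))"
          using ennreal_leI[OF pt[OF w]] I \<tau> A0 by (simp flip: ennreal_mult ennreal_plus)
      qed
      also have "\<dots> = ennreal (\<tau> powr \<alpha> * I powr \<beta>) * (ennreal (1 / \<tau>) * S z
          + ennreal (1 / I) * (\<integral>\<^sup>+ w. ennreal (f w powr p) \<partial>area)
          + ennreal (W z powr t) * (\<integral>\<^sup>+ w. ennreal (?k w powr - 2 * W w powr - t) \<partial>area))"
      proof -
        have [measurable]: "(\<lambda>w. ennreal (A z w)) \<in> borel_measurable area"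
          unfolding A_def by measurable
        show ?thesis unfolding S_def by (simp add: nn_integral_cmult nn_integral_add)
      qed
      also have "\<dots> \<le> ennreal (\<tau> powr \<alpha> * I powr \<beta>) * (ennreal (1 / \<tau>) * ennreal \<tau>
          + ennreal (1 / I) * ennreal I + ennreal (W z powr t) * ennreal (C\<^sub>2 * W z powr - t))"
        using that fI C2(2)[OF z] by (intro mult_left_mono add_mono) auto
      also have "\<dots> = ennreal (\<tau> powr \<alpha> * I powr \<beta>) * (ennreal 1 + ennreal 1 + ennreal (C\<^sub>2 * (W z powr t * W z powr - t)))"
        using \<tau> I C2(1) by (simp add: mult_ac flip: ennreal_mult)
      also have "\<dots> = ennreal (\<tau> powr \<alpha> * I powr \<beta> * (1 + 1 + C\<^sub>2 * (W z powr t * W z powr - t)))"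
        using C2(1) by (simp add: ennreal_mult)
      also have "W z powr t * W z powr - t = 1"
        using W[OF z] by (simp flip: powr_add)
      finally have "u z \<le> (2 + C\<^sub>2) * \<tau> powr \<alpha> * I powr \<beta>"
        using C2(1) by (simp add: mult_ac)
      then have "u z powr q \<le> ((2 + C\<^sub>2) * \<tau> powr \<alpha> * I powr \<beta>) powr q"
        using u0 assms by (intro powr_mono2) auto
      also have "\<dots> = K * \<tau> powr (q * \<alpha>) * I powr (\<beta> * q)"
        using C2(1) by (simp add: powr_mult powr_powr K_def mult_ac)
      finally show ?thesis using q\<alpha> \<tau> by (simp add: mult_ac)
    qed
    have u_le_S: "ennreal (u z powr q) \<le> ennreal (K * I powr (\<beta> * q)) * S z" if z: "z \<in> unit_disk" for z
    proof (cases "S z = \<infinity>")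
      case True
      then show ?thesis using K I by (simp add: ennreal_mult_top)
    next
      case False
      then obtain \<sigma> where \<sigma>: "S z = ennreal \<sigma>" "\<sigma> \<ge> 0" by (cases "S z") auto
      let ?K = "K * I powr (\<beta> * q)"
      have K': "?K > 0" using K I by simp
      have "u z powr q \<le> ?K * \<sigma> + e" if "e > 0" for e
      proof -
        have "u z powr q \<le> ?K * (\<sigma> + e / ?K)"
          using \<sigma> that K' by (intro u_le z) (auto intro!: add_nonneg_pos ennreal_leI)
        then show ?thesis using K I by (simp add: distrib_left)
      qed
      then have "u z powr q \<le> ?K * \<sigma>" by (rule field_le_epsilon)
      then show ?thesis using \<sigma> K' by (simp add: ennreal_leI flip: ennreal_mult)
    qed
    have [measurable]: "S \<in> borel_measurable area"
      unfolding S_def by measurable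
    have "(\<integral>\<^sup>+ z. ennreal (u z powr q) \<partial>area) \<le> (\<integral>\<^sup>+ z. ennreal (K * I powr (\<beta> * q)) * S z \<partial>area)"
      by (intro nn_integral_mono u_le_S) simp
    also have "\<dots> = ennreal (K * I powr (\<beta> * q)) * (\<integral>\<^sup>+ z. S z \<partial>area)"
      by (intro nn_integral_cmult) measurable
    also have "\<dots> \<le> ennreal (K * I powr (\<beta> * q)) * ennreal (C\<^sub>1 * I)"
      by (intro mult_left_mono SI) auto
    also have "\<dots> = ennreal (K * C\<^sub>1 * (I powr (\<beta> * q) * I powr 1))"
      using K I C1 by (simp add: mult_ac flip: ennreal_mult)
    also have "I powr (\<beta> * q) * I powr 1 = I powr (q / p)"
    proof -
      have "\<beta> * q + 1 = q * (\<alpha> + \<beta>)" using q\<alpha> by (simp add: algebra_simps)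
      also have "\<dots> = q / p" by (simp add: ab_p)
      finally show ?thesis by (simp only: powr_add[symmetric])
    qed
    finally show "(\<integral>\<^sup>+ z. ennreal (u z powr q) \<partial>area) \<le> ennreal (K * C\<^sub>1 * I powr (q / p))" .
  qed
qed

section \<open>Weak type estimate for the Bergman potential\<close>

text \<open>The Hardy-Littlewood argument. A ball carrying too much mass has radius at most sqrt (I
  / t), so the Vitali covering lemma yields a countable disjoint subfamily whose five-fold
  enlargements cover all such balls; 25 = 5^2. The union of the enlargements serves as U because it
  is open, hence measurable.\<close>

lemma maximal_function_weak_type:
  fixes f :: "complex \<Rightarrow> ennreal"
  assumes [measurable]: "f \<in> borel_measurable area" and t: "0 < t" and I: "0 < I"
    and fI: "(\<integral>\<^sup>+ w. f w \<partial>area) \<le> ennreal I"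
  obtains U where "open U" "emeasure area (U \<inter> unit_disk) \<le> ennreal (25 * I / t)"
    "\<And>z r. z \<in> unit_disk - U \<Longrightarrow> 0 < r \<Longrightarrow> (\<integral>\<^sup>+ w. f w * indicator (ball z r) w \<partial>area) \<le> ennreal (t * r\<^sup>2)"
proof -
  have mball: "(\<lambda>w. indicator (ball z r) w :: ennreal) \<in> borel_measurable area" for z r
    by (intro borel_measurable_area borel_measurable_indicator) simp
  note [measurable] = mball
  define K where "K = {(z, r). 0 < r \<and> ennreal (t * r\<^sup>2) < (\<integral>\<^sup>+ w. f w * indicator (ball z r) w \<partial>area)}"
  have r: "0 < snd i \<and> snd i \<le> sqrt (I / t)" if "i \<in> K" for i
  proof -
    obtain z r where i: "i = (z, r)" by force
    have "ennreal (t * r\<^sup>2) < (\<integral>\<^sup>+ w. f w * indicator (ball z r) w \<partial>area)" "0 < r"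
      using that by (auto simp: K_def i)
    moreover have "(\<integral>\<^sup>+ w. f w * indicator (ball z r) w \<partial>area) \<le> ennreal I"
      by (rule order_trans[OF nn_integral_mono fI]) (auto simp: indicator_def)
    ultimately have "t * r\<^sup>2 < I" using I by (meson ennreal_less_iff less_le_trans less_eq_real_def ennreal_leI not_le)
    then have "r \<le> sqrt (I / t)" using t by (intro real_le_rsqrt) (simp add: field_simps)
    with \<open>0 < r\<close> show ?thesis by (simp add: i)
  qed
  obtain C where C: "countable C" "C \<subseteq> K" "pairwise (\<lambda>i j. disjnt (ball (fst i) (snd i)) (ball (fst j) (snd j))) C"
    "(\<Union>i\<in>K. ball (fst i) (snd i)) \<subseteq> (\<Union>i\<in>C. ball (fst i) (5 * snd i))"
    by (rule Vitali_covering_lemma_balls[OF subset_refl r])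
  define U where "U = (\<Union>i\<in>C. ball (fst i) (5 * snd i))"
  have "open U" by (auto simp: U_def)
  have "emeasure area (U \<inter> unit_disk) = (\<integral>\<^sup>+ x. indicator (U \<inter> unit_disk) x \<partial>area)"
    using \<open>open U\<close> by (simp add: borel_subset_area borel_open)
  \<comment> \<open>The sum over the countable family is written as an integral over
    \<open>count_space C\<close>, so that sums and area integrals can be interchanged here and again
    below.\<close>
  also have "\<dots> \<le> (\<integral>\<^sup>+ x. \<integral>\<^sup>+ i. indicator (ball (fst i) (5 * snd i) \<inter> unit_disk) x \<partial>count_space C \<partial>area)"
  proof (intro nn_integral_mono)
    fix x
    show "(indicator (U \<inter> unit_disk) x :: ennreal)
      \<le> (\<integral>\<^sup>+ i. indicator (ball (fst i) (5 * snd i) \<inter> unit_disk) x \<partial>count_space C)"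
    proof (cases "x \<in> U \<inter> unit_disk")
      case True
      then obtain j where j: "j \<in> C" "x \<in> ball (fst j) (5 * snd j) \<inter> unit_disk" by (auto simp: U_def)
      have "(1::ennreal) = indicator (ball (fst j) (5 * snd j) \<inter> unit_disk) x" using j by simp
      also have "\<dots> \<le> (\<integral>\<^sup>+ i. indicator (ball (fst i) (5 * snd i) \<inter> unit_disk) x \<partial>count_space C)"
        by (rule nn_integral_ge_point[OF j(1)])
      finally show ?thesis using True by simp
    qed simp
  qed
  also have "\<dots> = (\<integral>\<^sup>+ i. \<integral>\<^sup>+ x. indicator (ball (fst i) (5 * snd i) \<inter> unit_disk) x \<partial>area \<partial>count_space C)"
    by (intro nn_integral_count_space_nn_integral C(1))
      (auto intro!: borel_measurable_indicator borel_subset_area)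
  also have "\<dots> \<le> (\<integral>\<^sup>+ i. ennreal (25 / t) * (\<integral>\<^sup>+ w. f w * indicator (ball (fst i) (snd i)) w \<partial>area) \<partial>count_space C)"
  proof (intro nn_integral_mono)
    fix i assume "i \<in> space (count_space C)"
    then have i: "i \<in> K" using C(2) by auto
    have "(\<integral>\<^sup>+ x. indicator (ball (fst i) (5 * snd i) \<inter> unit_disk) x \<partial>area)
      = emeasure area (ball (fst i) (5 * snd i) \<inter> unit_disk)"
      by (simp add: borel_subset_area)
    also have "\<dots> \<le> ennreal ((5 * snd i)\<^sup>2)"
      using r[OF i] by (intro emeasure_area_ball_le) simp
    also have "\<dots> = ennreal (25 / t) * ennreal (t * (snd i)\<^sup>2)"
      using t by (simp add: power_mult_distrib flip: ennreal_mult)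
    also have "\<dots> \<le> ennreal (25 / t) * (\<integral>\<^sup>+ w. f w * indicator (ball (fst i) (snd i)) w \<partial>area)"
      using i by (intro mult_left_mono) (auto simp: K_def)
    finally show "(\<integral>\<^sup>+ x. indicator (ball (fst i) (5 * snd i) \<inter> unit_disk) x \<partial>area)
      \<le> ennreal (25 / t) * (\<integral>\<^sup>+ w. f w * indicator (ball (fst i) (snd i)) w \<partial>area)" .
  qed
  also have "\<dots> = ennreal (25 / t) * (\<integral>\<^sup>+ i. (\<integral>\<^sup>+ w. f w * indicator (ball (fst i) (snd i)) w \<partial>area) \<partial>count_space C)"
    by (intro nn_integral_cmult) simp
  also have "(\<integral>\<^sup>+ i. (\<integral>\<^sup>+ w. f w * indicator (ball (fst i) (snd i)) w \<partial>area) \<partial>count_space C)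
      = (\<integral>\<^sup>+ w. \<integral>\<^sup>+ i. f w * indicator (ball (fst i) (snd i)) w \<partial>count_space C \<partial>area)"
    by (intro nn_integral_count_space_nn_integral[symmetric] C(1)) measurable
  also have "\<dots> \<le> (\<integral>\<^sup>+ w. f w \<partial>area)"
  proof (intro nn_integral_mono)
    fix w
    have "(\<integral>\<^sup>+ i. indicator (ball (fst i) (snd i)) w \<partial>count_space C) \<le> (1::ennreal)"
    proof (cases "\<exists>j\<in>C. w \<in> ball (fst j) (snd j)")
      case True
      then obtain j where j: "j \<in> C" "w \<in> ball (fst j) (snd j)" by blast
      have "(\<integral>\<^sup>+ i. indicator (ball (fst i) (snd i)) w \<partial>count_space C)
        \<le> (\<integral>\<^sup>+ i. indicator {j} i \<partial>count_space C)"
      proof (intro nn_integral_mono)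
        fix i assume "i \<in> space (count_space C)"
        then have i: "i \<in> C" by simp
        show "(indicator (ball (fst i) (snd i)) w :: ennreal) \<le> indicator {j} i"
        proof (cases "i = j")
          case False
          then have "disjnt (ball (fst i) (snd i)) (ball (fst j) (snd j))"
            using C(3) i j by (auto simp: pairwise_def)
          then have "w \<notin> ball (fst i) (snd i)" using j by (auto simp: disjnt_iff)
          then show ?thesis by simp
        qed (auto simp: indicator_def)
      qed
      also have "\<dots> = 1" using j by simp
      finally show ?thesis .
    next
      case False
      then have "(\<integral>\<^sup>+ i. indicator (ball (fst i) (snd i)) w \<partial>count_space C) = (\<integral>\<^sup>+ i. 0 \<partial>count_space C)"
        by (intro nn_integral_cong) auto
      then show ?thesis by simp
    qed
    then have "f w * (\<integral>\<^sup>+ i. indicator (ball (fst i) (snd i)) w \<partial>count_space C) \<le> f w * 1"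
      by (intro mult_left_mono) auto
    then show "(\<integral>\<^sup>+ i. f w * indicator (ball (fst i) (snd i)) w \<partial>count_space C) \<le> f w"
      by (simp add: nn_integral_cmult)
  qed
  also note fI
  also have "ennreal (25 / t) * ennreal I = ennreal (25 * I / t)"
    using t I by (simp flip: ennreal_mult)
  finally have 1: "emeasure area (U \<inter> unit_disk) \<le> ennreal (25 * I / t)"
    by (simp add: mult_left_mono)
  have 2: "(\<integral>\<^sup>+ w. f w * indicator (ball z r) w \<partial>area) \<le> ennreal (t * r\<^sup>2)"
    if "z \<in> unit_disk - U" "0 < r" for z r
  proof (rule ccontr)
    assume "\<not> ?thesis"
    then have "(z, r) \<in> K" using that by (auto simp: K_def)
    then have "z \<in> (\<Union>i\<in>K. ball (fst i) (snd i))" using \<open>0 < r\<close> by force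
    then show False using C(4) that unfolding U_def by blast
  qed
  show ?thesis by (rule that[OF \<open>open U\<close> 1 2])
qed

text \<open>Distance to F is measured by |1 - z cnj w| instead of |z - w|: it is at least 1 - |w|,
  so it stays positive even on F and always provides a usable radius. It is 1-Lipschitz because |z|
  \<le> 1.\<close>

lemma kernel_distance_to_set:
  fixes F :: "complex set" and \<rho> :: "complex \<Rightarrow> real"
  assumes F: "F \<noteq> {}" "F \<subseteq> unit_disk"
    and \<rho>_def: "\<And>w. \<rho> w = (INF z\<in>F. norm (1 - z * cnj w))"
  shows "\<And>w. w \<in> unit_disk \<Longrightarrow> 0 < \<rho> w" "\<And>w. w \<in> unit_disk \<Longrightarrow> \<rho> w \<le> 2"
    "\<And>z w. z \<in> F \<Longrightarrow> \<rho> w \<le> norm (1 - z * cnj w)"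
    "\<And>w v. \<rho> w \<le> \<rho> v + dist w v"
    "\<And>w. w \<in> unit_disk \<Longrightarrow> \<exists>z\<in>F. norm (1 - z * cnj w) < 2 * \<rho> w"
    "\<rho> \<in> borel_measurable borel"
proof -
  have bdd: "bdd_below ((\<lambda>z. norm (1 - z * cnj w)) ` F)" for w
    by (rule bdd_belowI[of _ 0]) auto
  show 1: "0 < \<rho> w" if "w \<in> unit_disk" for w
  proof -
    have "1 - norm w \<le> \<rho> w"
      unfolding \<rho>_def using F norm_one_minus_ge[of _ w]
      by (intro cINF_greatest) (auto simp: norm_one_minus_commute[of _ w])
    then show ?thesis using that by simp
  qed
  show 3: "\<rho> w \<le> norm (1 - z * cnj w)" if "z \<in> F" for z w
    unfolding \<rho>_def by (intro cINF_lower bdd that)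
  show "\<rho> w \<le> 2" if "w \<in> unit_disk" for w
    using F 3[of _ w] norm_one_minus_le[of _ w] that by (meson ex_in_conv order_trans subsetD)
  show 4: "\<rho> w \<le> \<rho> v + dist w v" for w v
  proof -
    have "\<rho> w - dist w v \<le> (INF z\<in>F. norm (1 - z * cnj v))"
    proof (intro cINF_greatest F(1))
      fix z assume z: "z \<in> F"
      have "norm z \<le> 1" using z F by auto
      have "norm (1 - z * cnj w) \<le> norm (1 - z * cnj v) + norm (z * cnj (v - w))"
        using norm_triangle_ineq[of "1 - z * cnj v" "z * cnj (v - w)"] by (simp add: algebra_simps)
      also have "norm (z * cnj (v - w)) = norm z * dist w v"
        by (simp add: norm_mult dist_norm norm_minus_commute del: complex_cnj_diff)
      also have "\<dots> \<le> dist w v" using \<open>norm z \<le> 1\<close> by (simp add: mult_left_le_one_le)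
      finally show "\<rho> w - dist w v \<le> norm (1 - z * cnj v)" using 3[OF z, of w] by simp
    qed
    then show ?thesis by (simp add: \<rho>_def)
  qed
  show "\<exists>z\<in>F. norm (1 - z * cnj w) < 2 * \<rho> w" if "w \<in> unit_disk" for w
  proof (rule ccontr)
    assume "\<not> ?thesis"
    then have "2 * \<rho> w \<le> (INF z\<in>F. norm (1 - z * cnj w))"
      by (intro cINF_greatest F(1)) (auto simp: not_less)
    then show False using 1[OF that] by (simp add: \<rho>_def)
  qed
  have "1-lipschitz_on UNIV \<rho>"
  proof (intro lipschitz_onI)
    show "dist (\<rho> v) (\<rho> w) \<le> 1 * dist v w" for v w
      using 4[of v w] 4[of w v] by (simp add: dist_real_def abs_le_iff dist_commute)
  qed simp
  then show "\<rho> \<in> borel_measurable borel"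
    by (intro borel_measurable_continuous_onI lipschitz_on_continuous_on)
qed

text \<open>Off the exceptional set \<open>U\<close> of the maximal function the mass \<open>f(w) dA(w)\<close> may be spread
  uniformly over a disk around \<open>w\<close> of radius half the distance \<open>\<rho>(w)\<close> to \<open>F\<close>: this changes the
  potential on \<open>F\<close> only by a factor, but turns \<open>f\<close> into a bounded function \<open>g\<close>, to which a strong
  type estimate applies. No cancellation is needed.\<close>

lemma bergman_potential_spread:
  fixes f :: "complex \<Rightarrow> real"
  assumes f [measurable]: "f \<in> borel_measurable area" and f0: "\<And>w. 0 \<le> f w" and "1 \<le> c" "0 < t"
    and F: "F \<noteq> {}" "F \<subseteq> unit_disk"
    and max: "\<And>z r. z \<in> F \<Longrightarrow> 0 < r \<Longrightarrow>
      (\<integral>\<^sup>+ w. ennreal (f w) * indicator (ball z r) w \<partial>area) \<le> ennreal (t * r\<^sup>2)"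
  obtains g where "g \<in> borel_measurable area" "\<And>w. 0 \<le> g w" "\<And>w. w \<in> unit_disk \<Longrightarrow> g w \<le> 21 * t"
    "(\<integral>\<^sup>+ w. ennreal (g w) \<partial>area) \<le> (\<integral>\<^sup>+ w. ennreal (f w) \<partial>area)"
    "\<And>z. z \<in> F \<Longrightarrow> bergman_potential c f z \<le> ennreal 36 * bergman_potential c g z"
proof -
  define \<rho> where "\<rho> w = (INF z\<in>F. norm (1 - z * cnj w))" for w
  note \<rho> = kernel_distance_to_set[OF F \<rho>_def]
  note [measurable] = \<rho>(6)
  \<comment> \<open>The spreading kernel: the mass at w goes to the disk of radius \<rho>(w)/2 with
    density 1/\<rho>(w)^2. By the upper and lower bounds for the area of a ball cut by the unit
    disk, its total mass lies between 1/16 and 1/4, also near the boundary.\<close>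
  define H where "H v w = (if dist w v < \<rho> w / 2 then 1 / (\<rho> w)\<^sup>2 else 0)" for v w
  have H0: "0 \<le> H v w" for v w by (simp add: H_def)
  have [measurable]: "(\<lambda>x. H (fst x) (snd x)) \<in> borel_measurable (area \<Otimes>\<^sub>M area)"
    by (rule borel_measurable_pair_area, unfold H_def borel_prod[symmetric], measurable)
  have [measurable]: "(\<lambda>x. H (snd x) (fst x)) \<in> borel_measurable (area \<Otimes>\<^sub>M area)"
    by (rule borel_measurable_pair_area[of "\<lambda>v w. H w v"], unfold H_def borel_prod[symmetric], measurable)
  have [measurable]: "(\<lambda>v. H v w) \<in> borel_measurable area" "(\<lambda>v. H w v) \<in> borel_measurable area" for w
    unfolding H_def by (rule borel_measurable_area; measurable)+
  define g where "g v = (\<integral>\<^sup>+ w. ennreal (H v w * f w) \<partial>area)" for v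
  have [measurable]: "g \<in> borel_measurable area"
    unfolding g_def by measurable
  have g_le: "g v \<le> ennreal (21 * t)" if v: "v \<in> unit_disk" for v
  proof -
    \<comment> \<open>The maximal bound is available only at points of F, so a point that nearly
      realizes \<rho>(v) is chosen. Mass that reaches v starts within 3 \<rho>(v) of it, with
      density at most 9 / (4 \<rho>(v)^2); the product (9/4) * 9 = 81/4 is rounded up to 21.\<close>
    obtain z where z: "z \<in> F" "norm (1 - z * cnj v) < 2 * \<rho> v" using \<rho>(5)[OF v] by blast
    have "dist z v < 2 * \<rho> v"
      using norm_one_minus_ge_diff[of z v] z v F by (auto simp: dist_norm)
    have H_le: "H v w \<le> 9 / (4 * (\<rho> v)\<^sup>2) * indicator (ball z (3 * \<rho> v)) w" if w: "w \<in> unit_disk" for w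
    proof (cases "dist w v < \<rho> w / 2")
      case True
      have a: "\<rho> w \<le> 2 * \<rho> v" "2 * \<rho> v \<le> 3 * \<rho> w"
        using \<rho>(4)[of w v] \<rho>(4)[of v w] True by (simp_all add: dist_commute)
      then have "dist z w < 3 * \<rho> v"
        using \<open>dist z v < 2 * \<rho> v\<close> dist_triangle2[of z w v] True by simp
      moreover have "(2 * \<rho> v)\<^sup>2 \<le> (3 * \<rho> w)\<^sup>2" using a \<rho>(1)[OF v] by (intro power_mono) auto
      then have "1 / (\<rho> w)\<^sup>2 \<le> 9 / (4 * (\<rho> v)\<^sup>2)"
        using \<rho>(1)[OF v] \<rho>(1)[OF w] by (simp add: power_mult_distrib field_simps)
      ultimately show ?thesis using True by (simp add: H_def)
    qed (simp add: H_def indicator_def)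
    have [measurable]: "(\<lambda>w. indicator (ball z (3 * \<rho> v)) w :: ennreal) \<in> borel_measurable area"
      by (intro borel_measurable_area borel_measurable_indicator) simp
    have "g v \<le> (\<integral>\<^sup>+ w. ennreal (9 / (4 * (\<rho> v)\<^sup>2)) * (ennreal (f w) * indicator (ball z (3 * \<rho> v)) w) \<partial>area)"
      unfolding g_def
    proof (intro nn_integral_mono)
      fix w assume "w \<in> space area"
      then have "H v w * f w \<le> 9 / (4 * (\<rho> v)\<^sup>2) * indicator (ball z (3 * \<rho> v)) w * f w"
        by (intro mult_right_mono H_le f0) simp
      then have "ennreal (H v w * f w) \<le> ennreal (9 / (4 * (\<rho> v)\<^sup>2) * indicator (ball z (3 * \<rho> v)) w * f w)"
        by (rule ennreal_leI)
      also have "\<dots> = ennreal (9 / (4 * (\<rho> v)\<^sup>2)) * (ennreal (f w) * indicator (ball z (3 * \<rho> v)) w)"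
        using f0[of w] by (auto simp: indicator_def simp flip: ennreal_mult)
      finally show "ennreal (H v w * f w)
        \<le> ennreal (9 / (4 * (\<rho> v)\<^sup>2)) * (ennreal (f w) * indicator (ball z (3 * \<rho> v)) w)" .
    qed
    also have "\<dots> = ennreal (9 / (4 * (\<rho> v)\<^sup>2)) * (\<integral>\<^sup>+ w. ennreal (f w) * indicator (ball z (3 * \<rho> v)) w \<partial>area)"
      by (intro nn_integral_cmult) measurable
    also have "\<dots> \<le> ennreal (9 / (4 * (\<rho> v)\<^sup>2)) * ennreal (t * (3 * \<rho> v)\<^sup>2)"
      using \<rho>(1)[OF v] by (intro mult_left_mono max z) auto
    also have "\<dots> = ennreal (81 / 4 * t)"
      using \<rho>(1)[OF v] \<open>0 < t\<close> by (simp add: power_mult_distrib flip: ennreal_mult)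
    also have "\<dots> \<le> ennreal (21 * t)"
      using \<open>0 < t\<close> by (intro ennreal_leI) simp
    finally show ?thesis .
  qed
  define G where "G v = enn2real (g v)" for v
  have [measurable]: "G \<in> borel_measurable area" unfolding G_def by measurable
  have G: "ennreal (G v) = g v" if "v \<in> unit_disk" for v
    using g_le[OF that] by (simp add: G_def ennreal_enn2real top.not_eq_extremum le_less_trans[OF _ ennreal_less_top])
  interpret pair_sigma_finite area area ..
  show ?thesis
  proof (rule that[of G])
    show "G \<in> borel_measurable area" by measurable
    show "0 \<le> G w" for w by (simp add: G_def)
    show "G w \<le> 21 * t" if "w \<in> unit_disk" for w
      using g_le[OF that, folded G[OF that]] \<open>0 < t\<close> by simp
    have "(\<integral>\<^sup>+ w. ennreal (G w) \<partial>area) = (\<integral>\<^sup>+ v. g v \<partial>area)"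
      by (intro nn_integral_cong) (simp add: G)
    also have "\<dots> = (\<integral>\<^sup>+ w. \<integral>\<^sup>+ v. ennreal (H v w * f w) \<partial>area \<partial>area)"
      unfolding g_def by (intro Fubini'[symmetric]) (simp add: case_prod_beta')
    also have "\<dots> \<le> (\<integral>\<^sup>+ w. ennreal (f w) \<partial>area)"
    proof (intro nn_integral_mono)
      fix w assume "w \<in> space area"
      then have w: "w \<in> unit_disk" by simp
      note \<rho>w = \<rho>(1)[OF w]
      have "(\<integral>\<^sup>+ v. ennreal (H v w * f w) \<partial>area)
        = (\<integral>\<^sup>+ v. ennreal (f w / (\<rho> w)\<^sup>2) * indicator (ball w (\<rho> w / 2) \<inter> unit_disk) v \<partial>area)"
        using f0 by (intro nn_integral_cong) (auto simp: H_def indicator_def)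
      also have "\<dots> = ennreal (f w / (\<rho> w)\<^sup>2) * emeasure area (ball w (\<rho> w / 2) \<inter> unit_disk)"
        by (intro nn_integral_cmult_indicator borel_subset_area) simp
      also have "\<dots> \<le> ennreal (f w / (\<rho> w)\<^sup>2) * ennreal ((\<rho> w / 2)\<^sup>2)"
        using \<rho>w by (intro mult_left_mono emeasure_area_ball_le) auto
      also have "\<dots> = ennreal (f w / 4)"
        using \<rho>w f0[of w] by (simp add: power_divide flip: ennreal_mult)
      also have "\<dots> \<le> ennreal (f w)"
        using f0[of w] by (intro ennreal_leI) simp
      finally show "(\<integral>\<^sup>+ v. ennreal (H v w * f w) \<partial>area) \<le> ennreal (f w)" .
    qed
    finally show "(\<integral>\<^sup>+ w. ennreal (G w) \<partial>area) \<le> (\<integral>\<^sup>+ w. ennreal (f w) \<partial>area)" .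
    show "bergman_potential c f z \<le> ennreal 36 * bergman_potential c G z" if zF: "z \<in> F" for z
    proof -
      have z: "z \<in> unit_disk" using zF F by auto
      let ?k = "\<lambda>w. norm (1 - z * cnj w) powr - (2 / c)"
      have [measurable]: "(\<lambda>x. ?k (fst x)) \<in> borel_measurable (area \<Otimes>\<^sub>M area)"
        "(\<lambda>x. ?k (snd x)) \<in> borel_measurable (area \<Otimes>\<^sub>M area)"
        by (rule measurable_compose[OF measurable_fst borel_measurable_kernel]
            measurable_compose[OF measurable_snd borel_measurable_kernel])+
      \<comment> \<open>36 = 16 * 9/4. Spreading keeps at least 1/16 of the mass, and since |w - v|
        < \<rho>(w)/2 \<le> |1 - z cnj w|/2, moving from w to v enlarges |1 - z cnj w| by at most
        3/2; with c \<ge> 1 the kernel then shrinks at most by the factor 4/9.\<close>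
      have k_le: "ennreal (?k w) \<le> ennreal 36 * (\<integral>\<^sup>+ v. ennreal (?k v * H v w) \<partial>area)" if w: "w \<in> unit_disk" for w
      proof -
        note \<rho>w = \<rho>(1)[OF w]
        have *: "?k w * (4 / 9) \<le> ?k v" if v: "v \<in> unit_disk" "dist w v < \<rho> w / 2" for v
        proof -
          have "norm (1 - z * cnj v) \<le> norm (1 - z * cnj w) + norm (z * cnj (w - v))"
            using norm_triangle_ineq[of "1 - z * cnj w" "z * cnj (w - v)"] by (simp add: algebra_simps)
          also have "norm (z * cnj (w - v)) = norm z * dist w v"
            by (simp add: norm_mult dist_norm del: complex_cnj_diff)
          also have "\<dots> \<le> dist w v" using z by (simp add: mult_left_le_one_le)
          finally have "norm (1 - z * cnj v) \<le> 3 / 2 * norm (1 - z * cnj w)"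
            using v \<rho>(3)[OF zF, of w] by simp
          then have "(3 / 2 * norm (1 - z * cnj w)) powr - (2 / c) \<le> ?k v"
            using norm_one_minus_pos[OF z v(1)] \<open>1 \<le> c\<close> by (intro powr_mono2') auto
          moreover have "(3 / 2 * norm (1 - z * cnj w)) powr - (2 / c) = (3 / 2) powr - (2 / c) * ?k w"
            by (subst powr_mult) auto
          moreover have "4 / 9 \<le> (3 / 2 :: real) powr - (2 / c)"
          proof -
            have "(3 / 2 :: real) powr - 2 \<le> (3 / 2) powr - (2 / c)"
              using \<open>1 \<le> c\<close> by (intro powr_mono) (auto simp: field_simps)
            moreover have "(3 / 2 :: real) powr - 2 = 4 / 9"
              by (simp add: powr_minus power2_eq_square)
            ultimately show ?thesis by simp
          qed
          ultimately show ?thesis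
            using mult_left_mono[of "4 / 9" "(3 / 2 :: real) powr - (2 / c)" "?k w"] by (simp add: mult.commute)
        qed
        have "ennreal (?k w) = ennreal 36 * (ennreal (?k w * (4 / 9) / (\<rho> w)\<^sup>2) * ennreal ((\<rho> w / 2)\<^sup>2 / 4))"
          using \<rho>w by (simp add: power_divide del: ennreal_numeral flip: ennreal_mult)
        also have "\<dots> \<le> ennreal 36 * (ennreal (?k w * (4 / 9) / (\<rho> w)\<^sup>2) * emeasure area (ball w (\<rho> w / 2) \<inter> unit_disk))"
          using \<rho>w \<rho>(2)[OF w] w by (intro mult_left_mono emeasure_area_ball_ge) auto
        also have "ennreal (?k w * (4 / 9) / (\<rho> w)\<^sup>2) * emeasure area (ball w (\<rho> w / 2) \<inter> unit_disk)
          = (\<integral>\<^sup>+ v. ennreal (?k w * (4 / 9) / (\<rho> w)\<^sup>2) * indicator (ball w (\<rho> w / 2) \<inter> unit_disk) v \<partial>area)"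
          by (intro nn_integral_cmult_indicator[symmetric] borel_subset_area) simp
        also have "\<dots> \<le> (\<integral>\<^sup>+ v. ennreal (?k v * H v w) \<partial>area)"
        proof (intro nn_integral_mono)
          fix v assume "v \<in> space area"
          then have "v \<in> unit_disk" by simp
          show "ennreal (?k w * (4 / 9) / (\<rho> w)\<^sup>2) * indicator (ball w (\<rho> w / 2) \<inter> unit_disk) v \<le> ennreal (?k v * H v w)"
          proof (cases "dist w v < \<rho> w / 2")
            case True
            then show ?thesis
              using divide_right_mono[OF *[OF \<open>v \<in> unit_disk\<close> True] zero_le_power2[of "\<rho> w"]]
              by (simp add: H_def indicator_def ennreal_leI)
          qed (simp add: indicator_def)
        qed
        finally show ?thesis by (simp add: mult_left_mono)
      qed
      have "bergman_potential c f z \<le> (\<integral>\<^sup>+ w. ennreal 36 * (\<integral>\<^sup>+ v. ennreal (?k v * (H v w * f w)) \<partial>area) \<partial>area)"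
        unfolding bergman_potential_def
      proof (intro nn_integral_mono)
        fix w assume "w \<in> space area"
        then have w: "w \<in> unit_disk" by simp
        have "ennreal (?k w * f w) = ennreal (?k w) * ennreal (f w)"
          using f0 by (simp add: ennreal_mult)
        also have "\<dots> \<le> ennreal 36 * (\<integral>\<^sup>+ v. ennreal (?k v * H v w) \<partial>area) * ennreal (f w)"
          by (intro mult_right_mono k_le w) simp
        also have "\<dots> = ennreal 36 * (\<integral>\<^sup>+ v. ennreal (?k v * H v w) * ennreal (f w) \<partial>area)"
          by (simp add: nn_integral_multc mult.assoc)
        also have "(\<integral>\<^sup>+ v. ennreal (?k v * H v w) * ennreal (f w) \<partial>area) = (\<integral>\<^sup>+ v. ennreal (?k v * (H v w * f w)) \<partial>area)"
          using f0 H0 by (intro nn_integral_cong) (simp add: mult.assoc flip: ennreal_mult)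
        finally show "ennreal (?k w * f w) \<le> ennreal 36 * (\<integral>\<^sup>+ v. ennreal (?k v * (H v w * f w)) \<partial>area)" .
      qed
      also have "\<dots> = ennreal 36 * (\<integral>\<^sup>+ w. (\<integral>\<^sup>+ v. ennreal (?k v * (H v w * f w)) \<partial>area) \<partial>area)"
        by (intro nn_integral_cmult) measurable
      also have "(\<integral>\<^sup>+ w. (\<integral>\<^sup>+ v. ennreal (?k v * (H v w * f w)) \<partial>area) \<partial>area)
        = (\<integral>\<^sup>+ v. (\<integral>\<^sup>+ w. ennreal (?k v * (H v w * f w)) \<partial>area) \<partial>area)"
        by (intro Fubini') (simp add: case_prod_beta')
      also have "\<dots> = bergman_potential c G z"
        unfolding bergman_potential_def
      proof (intro nn_integral_cong)
        fix v assume "v \<in> space area"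
        then have v: "v \<in> unit_disk" by simp
        have "(\<integral>\<^sup>+ w. ennreal (?k v * (H v w * f w)) \<partial>area) = (\<integral>\<^sup>+ w. ennreal (?k v) * ennreal (H v w * f w) \<partial>area)"
          using f0 H0 by (intro nn_integral_cong) (simp flip: ennreal_mult)
        also have "\<dots> = ennreal (?k v) * g v" unfolding g_def
          by (intro nn_integral_cmult) measurable
        also have "\<dots> = ennreal (?k v * G v)"
          unfolding G[OF v, symmetric] using enn2real_nonneg[of "g v"] by (simp add: G_def ennreal_mult)
        finally show "(\<integral>\<^sup>+ w. ennreal (?k v * (H v w * f w)) \<partial>area) = ennreal (?k v * G v)" .
      qed
      finally show ?thesis .
    qed
  qed
qed

text \<open>The exceptional set of the maximal function is small by itself. On its complement F the
  potential is controlled by that of a bounded g, whose p-norm follows from its sup bound and its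
  mass, so the strong estimate and Chebyshev's inequality finish.\<close>

lemma bergman_potential_weak_type:
  fixes c :: real
  assumes c: "1 \<le> c"
  obtains C where "C > 0"
    "\<And>f u I \<sigma>. f \<in> borel_measurable area \<Longrightarrow> (\<And>w. 0 \<le> f w) \<Longrightarrow> u \<in> borel_measurable area \<Longrightarrow>
      (\<And>z. 0 \<le> u z) \<Longrightarrow> 0 < I \<Longrightarrow> 0 < \<sigma> \<Longrightarrow> (\<integral>\<^sup>+ w. ennreal (f w) \<partial>area) \<le> ennreal I \<Longrightarrow>
      (\<And>z. z \<in> unit_disk \<Longrightarrow> ennreal (u z) \<le> bergman_potential c f z) \<Longrightarrow>
      emeasure area {z \<in> unit_disk. u z > \<sigma>} \<le> ennreal (C * (I / \<sigma>) powr c)"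
proof -
  \<comment> \<open>This admissible pair is chosen with 1/p + 1/q = 1, which gives q/p = q - 1 and
    (p - 1)(q - 1) = 1 and makes the powers of t collapse to the first power.\<close>
  define p where "p = 2 * c / (2 * c - 1)"
  define q where "q = 2 * c"
  have p: "1 < p" and q: "0 < q" and pq: "1 / q = 1 / p + 1 / c - 1"
    using c by (auto simp: p_def q_def field_simps)
  have pq1: "q / p = q - 1" "(p - 1) * (q - 1) = 1"
    using c by (auto simp: p_def q_def field_simps)
  obtain C where C: "C > 0"
    "\<And>f u I. f \<in> borel_measurable area \<Longrightarrow> (\<And>w. 0 \<le> f w) \<Longrightarrow> (\<And>z. 0 \<le> u z) \<Longrightarrow> 0 < I \<Longrightarrow>
      (\<integral>\<^sup>+ w. ennreal (f w powr p) \<partial>area) \<le> ennreal I \<Longrightarrow>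
      (\<And>z. z \<in> unit_disk \<Longrightarrow> ennreal (u z) \<le> bergman_potential c f z) \<Longrightarrow>
      (\<integral>\<^sup>+ z. ennreal (u z powr q) \<partial>area) \<le> ennreal (C * I powr (q / p))"
    using bergman_potential_Lp_Lq[OF c p q pq] by blast
  show ?thesis
  proof (rule that[of "25 + C * 21 * 36 powr q"])
    show "25 + C * 21 * 36 powr q > 0" using C(1) by (intro add_pos_nonneg) auto
    fix f u :: "complex \<Rightarrow> real" and I \<sigma> :: real
    assume f [measurable]: "f \<in> borel_measurable area" and f0: "\<And>w. 0 \<le> f w"
      and u [measurable]: "u \<in> borel_measurable area" and u0: "\<And>z. 0 \<le> u z"
      and I: "0 < I" and \<sigma>: "0 < \<sigma>" and fI: "(\<integral>\<^sup>+ w. ennreal (f w) \<partial>area) \<le> ennreal I"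
      and uf: "\<And>z. z \<in> unit_disk \<Longrightarrow> ennreal (u z) \<le> bergman_potential c f z"
    \<comment> \<open>The maximal function level is fixed by I / t = (I / \<sigma>)^c, the measure
      permitted for the exceptional set.\<close>
    define t where "t = \<sigma> powr c * I powr (1 - c)"
    have t: "0 < t" using I \<sigma> by (simp add: t_def)
    obtain U where U: "open U" "emeasure area (U \<inter> unit_disk) \<le> ennreal (25 * I / t)"
      "\<And>z r. z \<in> unit_disk - U \<Longrightarrow> 0 < r \<Longrightarrow> (\<integral>\<^sup>+ w. ennreal (f w) * indicator (ball z r) w \<partial>area) \<le> ennreal (t * r\<^sup>2)"
      using maximal_function_weak_type[of "\<lambda>w. ennreal (f w)" t I] t I fI by (auto simp del: mem_ball)
    define F where "F = unit_disk - U"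
    have "unit_disk - U = (- U) \<inter> unit_disk" by auto
    then have [measurable]: "F \<in> sets area" using borel_subset_area[of "- U"] U(1) by (simp add: F_def)
    have Imod: "I / t = (I / \<sigma>) powr c"
      using I \<sigma> by (simp add: t_def powr_divide powr_diff field_simps)
    have F_le: "emeasure area {z \<in> F. u z > \<sigma>} \<le> ennreal (C * 21 * 36 powr q * (I / \<sigma>) powr c)"
    proof (cases "F = {}")
      case False
      have Fsub: "F \<subseteq> unit_disk" by (auto simp: F_def)
      obtain g where g [measurable]: "g \<in> borel_measurable area" and g0: "\<And>w. 0 \<le> g w"
        and g_le: "\<And>w. w \<in> unit_disk \<Longrightarrow> g w \<le> 21 * t"
        and gI: "(\<integral>\<^sup>+ w. ennreal (g w) \<partial>area) \<le> (\<integral>\<^sup>+ w. ennreal (f w) \<partial>area)"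
        and gf: "\<And>z. z \<in> F \<Longrightarrow> bergman_potential c f z \<le> ennreal 36 * bergman_potential c g z"
        by (rule bergman_potential_spread[OF f f0 c t False Fsub])
          (use U(3) in \<open>auto simp: F_def\<close>)
      have "(\<integral>\<^sup>+ w. ennreal (g w powr p) \<partial>area) \<le> (\<integral>\<^sup>+ w. ennreal ((21 * t) powr (p - 1)) * ennreal (g w) \<partial>area)"
      proof (intro nn_integral_mono)
        fix w assume "w \<in> space area"
        then have "g w powr (p - 1) \<le> (21 * t) powr (p - 1)"
          using g_le[of w] g0 p by (intro powr_mono2) auto
        then have "g w powr (p - 1) * g w powr 1 \<le> (21 * t) powr (p - 1) * g w powr 1"
          by (intro mult_right_mono) auto
        then have "g w powr p \<le> (21 * t) powr (p - 1) * g w"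
          using powr_mult_base[OF g0[of w], of "p - 1"] g0[of w] by (simp add: mult.commute)
        then show "ennreal (g w powr p) \<le> ennreal ((21 * t) powr (p - 1)) * ennreal (g w)"
          using g0 by (simp add: ennreal_leI flip: ennreal_mult)
      qed
      also have "\<dots> = ennreal ((21 * t) powr (p - 1)) * (\<integral>\<^sup>+ w. ennreal (g w) \<partial>area)"
        by (intro nn_integral_cmult) measurable
      also have "\<dots> \<le> ennreal ((21 * t) powr (p - 1)) * ennreal I"
        using gI fI by (intro mult_left_mono) auto
      also have "\<dots> = ennreal ((21 * t) powr (p - 1) * I)"
        using I by (simp add: ennreal_mult)
      finally have gp: "(\<integral>\<^sup>+ w. ennreal (g w powr p) \<partial>area) \<le> ennreal ((21 * t) powr (p - 1) * I)" .
      \<comment> \<open>Cut off outside F, where the potentials of f and g cannot be compared, and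
        divided by the constant of that comparison.\<close>
      define v where "v z = (if z \<in> F then u z / 36 else 0)" for z
      have "(\<integral>\<^sup>+ z. ennreal (v z powr q) \<partial>area) \<le> ennreal (C * ((21 * t) powr (p - 1) * I) powr (q / p))"
      proof (rule C(2)[OF g g0 _ _ gp])
        show "0 \<le> v z" for z using u0 by (simp add: v_def)
        show "0 < (21 * t) powr (p - 1) * I" using t I by simp
        fix z :: complex assume z: "z \<in> unit_disk"
        show "ennreal (v z) \<le> bergman_potential c g z"
        proof (cases "z \<in> F")
          case True
          have "ennreal (v z) = ennreal (1 / 36) * ennreal (u z)"
            using True by (simp add: v_def flip: ennreal_mult')
          also have "\<dots> \<le> ennreal (1 / 36) * (ennreal 36 * bergman_potential c g z)"
            using uf[OF z] gf[OF True] by (intro mult_left_mono) auto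
          also have "\<dots> = bergman_potential c g z"
            by (simp add: mult.assoc[symmetric] del: ennreal_numeral flip: ennreal_mult)
          finally show ?thesis .
        qed (simp add: v_def)
      qed
      also have "((21 * t) powr (p - 1) * I) powr (q / p) = 21 * t * I powr (q - 1)"
        using t I by (simp only: powr_mult powr_powr pq1) (simp add: powr_mult)
      finally have v_le: "(\<integral>\<^sup>+ z. ennreal (v z powr q) \<partial>area) \<le> ennreal (C * (21 * t * I powr (q - 1)))" .
      have "ennreal ((\<sigma> / 36) powr q) * emeasure area {z \<in> F. u z > \<sigma>}
        = (\<integral>\<^sup>+ z. ennreal ((\<sigma> / 36) powr q) * indicator {z \<in> F. u z > \<sigma>} z \<partial>area)"
        by (intro nn_integral_cmult_indicator[symmetric]) measurable
      also have "\<dots> \<le> (\<integral>\<^sup>+ z. ennreal (v z powr q) \<partial>area)"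
        using \<sigma> q by (intro nn_integral_mono) (auto simp: v_def indicator_def intro!: ennreal_leI powr_mono2)
      also note v_le
      finally have *: "ennreal ((\<sigma> / 36) powr q) * emeasure area {z \<in> F. u z > \<sigma>} \<le> ennreal (C * (21 * t * I powr (q - 1)))" .
      have "emeasure area {z \<in> F. u z > \<sigma>} = ennreal (1 / (\<sigma> / 36) powr q) * (ennreal ((\<sigma> / 36) powr q) * emeasure area {z \<in> F. u z > \<sigma>})"
        using \<sigma> by (simp add: mult.assoc[symmetric] flip: ennreal_mult)
      also have "\<dots> \<le> ennreal (1 / (\<sigma> / 36) powr q) * ennreal (C * (21 * t * I powr (q - 1)))"
        by (intro mult_left_mono *) simp
      also have "\<dots> = ennreal (1 / (\<sigma> / 36) powr q * (C * (21 * t * I powr (q - 1))))"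
        using t C(1) by (subst ennreal_mult[symmetric]) auto
      also have "1 / (\<sigma> / 36) powr q * (C * (21 * t * I powr (q - 1))) = C * 21 * 36 powr q * (I / \<sigma>) powr c"
      proof -
        have "t * I powr (q - 1) / \<sigma> powr q = (I / \<sigma>) powr c"
        proof -
          have "t * I powr (q - 1) / \<sigma> powr q = (\<sigma> powr c * \<sigma> powr - q) * (I powr (1 - c) * I powr (q - 1))"
            by (simp add: t_def powr_minus_divide)
          also have "\<dots> = \<sigma> powr - c * I powr c"
            by (simp add: q_def flip: powr_add)
          also have "\<dots> = (I / \<sigma>) powr c"
            using I \<sigma> by (simp add: powr_divide powr_minus_divide)
          finally show ?thesis .
        qed
        moreover have "1 / (\<sigma> / 36) powr q * (C * (21 * t * I powr (q - 1)))
          = C * 21 * 36 powr q * (t * I powr (q - 1) / \<sigma> powr q)"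
          using \<sigma> by (simp add: powr_divide)
        ultimately show ?thesis by simp
      qed
      finally show ?thesis .
    qed simp
    have m: "{z \<in> F. u z > \<sigma>} \<in> sets area" by measurable
    have "emeasure area {z \<in> unit_disk. u z > \<sigma>} \<le> emeasure area ((U \<inter> unit_disk) \<union> {z \<in> F. u z > \<sigma>})"
      using U(1) by (intro emeasure_mono sets.Un m borel_subset_area) (auto simp: F_def)
    also have "\<dots> \<le> emeasure area (U \<inter> unit_disk) + emeasure area {z \<in> F. u z > \<sigma>}"
      using U(1) by (intro emeasure_subadditive m borel_subset_area) auto
    also have "\<dots> \<le> ennreal (25 * (I / \<sigma>) powr c) + ennreal (C * 21 * 36 powr q * (I / \<sigma>) powr c)"
      using U(2) F_le by (intro add_mono) (simp_all flip: Imod)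
    also have "\<dots> = ennreal ((25 + C * 21 * 36 powr q) * (I / \<sigma>) powr c)"
      using C(1) by (simp add: distrib_right)
    finally show "emeasure area {z \<in> unit_disk. u z > \<sigma>} \<le> ennreal ((25 + C * 21 * 36 powr q) * (I / \<sigma>) powr c)" .
  qed
qed

section \<open>Mean oscillation of Bloch functions over squares\<close>

text \<open>The factor 2 makes the closed unit ball the square of side 1 centred at 0, so that after
  multiplication by w the side is |w|.\<close>

definition sup_norm :: "complex \<Rightarrow> real" where
  "sup_norm u = 2 * max \<bar>Re u\<bar> \<bar>Im u\<bar>"

lemma sup_norm_scaleR: "sup_norm (k *\<^sub>R u) = \<bar>k\<bar> * sup_norm u"
  by (simp add: sup_norm_def abs_mult max_mult_distrib_left mult_ac)

lemma sup_norm_add: "sup_norm (u + v) \<le> sup_norm u + sup_norm v"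
proof -
  have "\<bar>Re (u + v)\<bar> \<le> max \<bar>Re u\<bar> \<bar>Im u\<bar> + max \<bar>Re v\<bar> \<bar>Im v\<bar>"
    using order_trans[OF abs_triangle_ineq add_mono[OF max.cobounded1 max.cobounded1]] by simp
  moreover have "\<bar>Im (u + v)\<bar> \<le> max \<bar>Re u\<bar> \<bar>Im u\<bar> + max \<bar>Re v\<bar> \<bar>Im v\<bar>"
    using order_trans[OF abs_triangle_ineq add_mono[OF max.cobounded2 max.cobounded2]] by simp
  ultimately show ?thesis
    unfolding sup_norm_def distrib_left[symmetric] by (intro mult_left_mono max.boundedI) auto
qed

lemma sup_norm_le: "sup_norm u \<le> 2 * norm u"
  using abs_Re_le_cmod[of u] abs_Im_le_cmod[of u] by (simp add: sup_norm_def)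

lemma norm_le_sup_norm: "norm u \<le> sup_norm u"
  using cmod_le[of u] by (simp add: sup_norm_def max_def)

section \<open>Concentric shrinkings of a square and their distance to the unit circle\<close>

definition centered_square :: "complex \<Rightarrow> complex \<Rightarrow> real \<Rightarrow> complex set" where
  "centered_square z\<^sub>0 w \<theta> = {z\<^sub>0 + w * u | u. sup_norm u \<le> \<theta>}"

lemma square_eq_centered: "square a w = centered_square (a + w * Complex (1/2) (1/2)) w 1"
proof (intro set_eqI iffI)
  fix z assume "z \<in> square a w"
  then obtain x y where xy: "z = a + w * Complex x y" "x \<in> {0..1}" "y \<in> {0..1}"
    by (auto simp: square_def)
  have "Complex x y = Complex (1/2) (1/2) + Complex (x - 1/2) (y - 1/2)" by (simp add: complex_eq_iff)
  then have "z = a + w * Complex (1/2) (1/2) + w * Complex (x - 1/2) (y - 1/2)"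
    by (simp only: xy(1) distrib_left add.assoc)
  moreover have "max \<bar>x - 1/2\<bar> \<bar>y - 1/2\<bar> \<le> 1/2"
    using xy by (intro max.boundedI abs_leI) auto
  then have "sup_norm (Complex (x - 1/2) (y - 1/2)) \<le> 1"
    by (simp add: sup_norm_def)
  ultimately show "z \<in> centered_square (a + w * Complex (1/2) (1/2)) w 1"
    by (auto simp: centered_square_def)
next
  fix z assume "z \<in> centered_square (a + w * Complex (1/2) (1/2)) w 1"
  then obtain u where u: "z = a + w * Complex (1/2) (1/2) + w * u" "sup_norm u \<le> 1"
    by (auto simp: centered_square_def)
  have "z = a + w * (Complex (1/2) (1/2) + u)" using u(1) by (simp add: distrib_left)
  moreover have "Complex (1/2) (1/2) + u = Complex (1/2 + Re u) (1/2 + Im u)"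
    by (simp add: complex_eq_iff)
  ultimately have "z = a + w * Complex (1/2 + Re u) (1/2 + Im u)" by simp
  moreover have "1/2 + Re u \<in> {0..1}" "1/2 + Im u \<in> {0..1}" using u(2) by (auto simp: sup_norm_def abs_le_iff)
  ultimately show "z \<in> square a w" unfolding square_def by blast
qed

lemma centered_square_mono: "\<theta> \<le> \<theta>' \<Longrightarrow> centered_square z\<^sub>0 w \<theta> \<subseteq> centered_square z\<^sub>0 w \<theta>'"
  by (force simp: centered_square_def)

text \<open>Written as a homothety, so that the area scales with \<theta>^2. The degenerate ratio 0
  has to be included since the dyadic family of shrinkings used later starts there.\<close>

lemma centered_square_scale:
  assumes "0 \<le> \<theta>"
  shows "centered_square z\<^sub>0 w \<theta> = (\<lambda>z. \<theta> *\<^sub>R z + (1 - \<theta>) *\<^sub>R z\<^sub>0) ` centered_square z\<^sub>0 w 1"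
proof (intro set_eqI iffI)
  fix z assume "z \<in> centered_square z\<^sub>0 w \<theta>"
  then obtain u where u: "z = z\<^sub>0 + w * u" "sup_norm u \<le> \<theta>" by (auto simp: centered_square_def)
  show "z \<in> (\<lambda>z. \<theta> *\<^sub>R z + (1 - \<theta>) *\<^sub>R z\<^sub>0) ` centered_square z\<^sub>0 w 1"
  proof (cases "\<theta> = 0")
    case True
    then have "norm u \<le> 0" using u(2) norm_le_sup_norm[of u] by linarith
    then have "u = 0" by simp
    moreover have "z\<^sub>0 \<in> centered_square z\<^sub>0 w 1"
      unfolding centered_square_def by (rule CollectI, rule exI[of _ 0]) (simp add: sup_norm_def)
    ultimately show ?thesis using u True by auto
  next
    case False
    have "z = \<theta> *\<^sub>R (z\<^sub>0 + w * ((1 / \<theta>) *\<^sub>R u)) + (1 - \<theta>) *\<^sub>R z\<^sub>0"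
      using False by (simp add: u algebra_simps)
    moreover have "z\<^sub>0 + w * ((1 / \<theta>) *\<^sub>R u) \<in> centered_square z\<^sub>0 w 1"
      unfolding centered_square_def using u(2) False assms
      by (intro CollectI exI[of _ "(1 / \<theta>) *\<^sub>R u"]) (simp add: sup_norm_scaleR)
    ultimately show ?thesis by blast
  qed
next
  fix z assume "z \<in> (\<lambda>z. \<theta> *\<^sub>R z + (1 - \<theta>) *\<^sub>R z\<^sub>0) ` centered_square z\<^sub>0 w 1"
  then obtain u where u: "z = \<theta> *\<^sub>R (z\<^sub>0 + w * u) + (1 - \<theta>) *\<^sub>R z\<^sub>0" "sup_norm u \<le> 1"
    by (auto simp: centered_square_def)
  have "z = z\<^sub>0 + w * (\<theta> *\<^sub>R u)" by (simp add: u(1) algebra_simps)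
  moreover have "sup_norm (\<theta> *\<^sub>R u) \<le> \<theta>" using u(2) assms by (simp add: sup_norm_scaleR mult_left_le)
  ultimately show "z \<in> centered_square z\<^sub>0 w \<theta>" unfolding centered_square_def by blast
qed

lemma compact_centered_square: "compact (centered_square z\<^sub>0 w \<theta>)"
proof -
  have "{u. sup_norm u \<le> \<theta>} = {u. \<bar>Re u\<bar> \<le> \<theta> / 2} \<inter> {u. \<bar>Im u\<bar> \<le> \<theta> / 2}"
    by (auto simp: sup_norm_def)
  then have "closed {u. sup_norm u \<le> \<theta>}"
    by (auto intro!: closed_Int closed_Collect_le continuous_intros)
  moreover have "bounded {u. sup_norm u \<le> \<theta>}"
    unfolding bounded_iff using norm_le_sup_norm order_trans by blast
  ultimately have "compact ((\<lambda>u. z\<^sub>0 + w * u) ` {u. sup_norm u \<le> \<theta>})"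
    by (intro compact_continuous_image continuous_intros) (simp add: compact_eq_bounded_closed)
  moreover have "(\<lambda>u. z\<^sub>0 + w * u) ` {u. sup_norm u \<le> \<theta>} = centered_square z\<^sub>0 w \<theta>"
    by (auto simp: centered_square_def)
  ultimately show ?thesis by simp
qed

lemma ball_subset_centered_square:
  assumes w: "w \<noteq> 0" and u: "sup_norm u \<le> \<theta>" and d: "dist (z\<^sub>0 + w * u) z \<le> (\<theta>' - \<theta>) * norm w / 2"
  shows "z \<in> centered_square z\<^sub>0 w \<theta>'"
proof -
  define v where "v = (z - (z\<^sub>0 + w * u)) / w"
  have z: "z = z\<^sub>0 + w * (u + v)" using w by (simp add: v_def field_simps)
  have "norm v = dist (z\<^sub>0 + w * u) z / norm w" by (simp add: v_def norm_divide dist_norm norm_minus_commute)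
  also have "\<dots> \<le> (\<theta>' - \<theta>) / 2" using d w by (simp add: field_simps)
  finally have "sup_norm v \<le> \<theta>' - \<theta>" using sup_norm_le[of v] by simp
  then have "sup_norm (u + v) \<le> \<theta>'" using sup_norm_add[of u v] u by simp
  then show ?thesis using z unfolding centered_square_def by blast
qed

text \<open>A point of the shrunken square can be pushed radially outwards by (1 - \<theta>)|w|/2
  without leaving the full square. As that square lies in the disk, the modulus stays below 1 after
  the push.\<close>

lemma centered_square_depth:
  assumes w: "w \<noteq> 0" and Q: "centered_square z\<^sub>0 w 1 \<subseteq> unit_disk" and u: "sup_norm u \<le> \<theta>" and "\<theta> \<le> 1"
  shows "(1 - \<theta>) * norm w / 2 \<le> 1 - norm (z\<^sub>0 + w * u)"
proof -
  define z where "z = z\<^sub>0 + w * u"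
  define r where "r = (1 - \<theta>) * norm w / 2"
  define e where "e = (if z = 0 then 1 else sgn z)"
  have e: "norm e = 1" by (simp add: e_def norm_sgn)
  have r: "0 \<le> r" using assms by (simp add: r_def)
  have "z + r *\<^sub>R e \<in> centered_square z\<^sub>0 w 1"
    using e r by (intro ball_subset_centered_square[OF w u]) (simp add: z_def dist_norm flip: r_def)
  then have "norm (z + r *\<^sub>R e) < 1" using Q by auto
  moreover have "norm (z + r *\<^sub>R e) = norm z + r"
  proof (cases "z = 0")
    case True
    then show ?thesis using e r by simp
  next
    case False
    then have "norm z *\<^sub>R e = z" by (simp add: e_def sgn_div_norm)
    then have "z + r *\<^sub>R e = (norm z + r) *\<^sub>R e" by (simp only: scaleR_left_distrib)
    then have "norm (z + r *\<^sub>R e) = \<bar>norm z + r\<bar>" using e by simp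
    then show ?thesis using r by simp
  qed
  ultimately show ?thesis by (simp add: z_def r_def)
qed

text \<open>Walk from the point towards the centre through dyadic shrinkings. A step from ratio 1 -
  h/2 to 1 - h has length at most h|w|, while its ends are at distance at least h|w|/4 and h|w|/2
  from the circle; each step therefore costs at most (4 + 2) A.\<close>

lemma Bloch_growth_in_square:
  assumes w: "w \<noteq> 0" and Q: "centered_square z\<^sub>0 w 1 \<subseteq> unit_disk" and A: "0 \<le> A"
    and g: "\<And>z z'. z \<in> unit_disk \<Longrightarrow> z' \<in> unit_disk \<Longrightarrow>
      norm (g z - g z' :: complex) \<le> A * norm (z - z') * (1 / (1 - norm z) + 1 / (1 - norm z'))"
  shows "sup_norm u \<le> 1 - (1/2) ^ n \<Longrightarrow> norm (g (z\<^sub>0 + w * u) - g z\<^sub>0) \<le> 6 * A * real n"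
proof (induction n arbitrary: u)
  case 0
  then have "norm u \<le> 0" using norm_le_sup_norm[of u] by (simp del: norm_le_zero_iff)
  then show ?case by simp
next
  case (Suc n)
  define h where "h = (1/2 :: real) ^ n"
  have h: "0 < h" "h \<le> 1" by (auto simp: h_def power_le_one)
  have u: "sup_norm u \<le> 1 - h / 2" using Suc.prems by (simp add: h_def)
  \<comment> \<open>The ratio that scales the square of size 1 - h/2 onto that of size 1 - h; h
    \<le> 1 gives 1 - k \<le> h.\<close>
  define k where "k = (1 - h) / (1 - h / 2)"
  have k: "0 \<le> k" "k \<le> 1" "1 - k \<le> h" "k * (1 - h / 2) = 1 - h"
    using h by (auto simp: k_def field_simps)
  define v where "v = k *\<^sub>R u"
  have "sup_norm v \<le> k * (1 - h / 2)"
    unfolding v_def sup_norm_scaleR abs_of_nonneg[OF k(1)] by (intro mult_left_mono u k)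
  then have v: "sup_norm v \<le> 1 - h" using k by simp
  let ?z = "z\<^sub>0 + w * u" and ?z' = "z\<^sub>0 + w * v"
  have nw: "norm w > 0" using w by simp
  have pos: "0 < h * norm w / 4" using h nw by simp
  then have d: "h * norm w / 4 \<le> 1 - norm ?z" "h * norm w / 4 \<le> 1 - norm ?z'"
    using centered_square_depth[OF w Q u] centered_square_depth[OF w Q v] h by auto
  then have lt: "norm ?z < 1" "norm ?z' < 1" using pos by linarith+
  have "1 / (1 - norm ?z) \<le> 1 / (h * norm w / 4)"
    using d pos by (intro frac_le) auto
  moreover have "1 / (1 - norm ?z') \<le> 1 / (h * norm w / 2)"
    using centered_square_depth[OF w Q v] h nw by (intro frac_le) auto
  ultimately have r: "1 / (1 - norm ?z) + 1 / (1 - norm ?z') \<le> 6 / (h * norm w)"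
    using h nw by (simp add: field_simps)
  have "?z - ?z' = w * ((1 - k) *\<^sub>R u)" by (simp add: v_def algebra_simps)
  then have "norm (?z - ?z') = norm w * ((1 - k) * norm u)" using k by (simp add: norm_mult)
  also have "\<dots> \<le> norm w * (h * 1)"
    using k h nw norm_le_sup_norm[of u] u by (intro mult_left_mono mult_mono) auto
  finally have d2: "norm (?z - ?z') \<le> norm w * h" by simp
  have "norm (g ?z - g ?z') \<le> A * norm (?z - ?z') * (1 / (1 - norm ?z) + 1 / (1 - norm ?z'))"
    using lt by (intro g) auto
  also have "\<dots> \<le> A * (norm w * h) * (6 / (h * norm w))"
    using A d2 r h nw lt by (intro mult_mono mult_left_mono) (auto intro!: add_nonneg_nonneg)
  also have "\<dots> = 6 * A" using h nw by simp
  finally have "norm (g ?z - g ?z') \<le> 6 * A" .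
  moreover have "norm (g ?z' - g z\<^sub>0) \<le> 6 * A * real n"
    using v by (intro Suc.IH) (simp add: h_def)
  moreover have "norm (g ?z - g z\<^sub>0) \<le> norm (g ?z - g ?z') + norm (g ?z' - g z\<^sub>0)"
    using norm_triangle_ineq[of "g ?z - g ?z'" "g ?z' - g z\<^sub>0"] by simp
  ultimately show ?case by (simp add: algebra_simps)
qed

text \<open>The growth bound is 6 A times the number of dyadic shrinkings that miss the point, which
  is a sum of indicators. The n-th complement has area at most 2 * 2^(-n) times that of the square,
  so the sum converges to 4 and the constant is 6 * 4 = 24.\<close>

lemma Bloch_mean_oscillation_center:
  assumes w: "w \<noteq> 0" and Q: "centered_square z\<^sub>0 w 1 \<subseteq> unit_disk" and A: "0 < A"
    and g: "\<And>z z'. z \<in> unit_disk \<Longrightarrow> z' \<in> unit_disk \<Longrightarrow>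
      norm (g z - g z' :: complex) \<le> A * norm (z - z') * (1 / (1 - norm z) + 1 / (1 - norm z'))"
  shows "(\<integral>\<^sup>+ z\<in>centered_square z\<^sub>0 w 1. ennreal (norm (g z - g z\<^sub>0)) \<partial>area)
    \<le> ennreal (24 * A) * emeasure area (centered_square z\<^sub>0 w 1)"
proof -
  let ?Q = "centered_square z\<^sub>0 w"
  define \<theta> where "\<theta> n = 1 - (1/2 :: real) ^ n" for n :: nat
  have \<theta>: "0 \<le> \<theta> n" "\<theta> n \<le> 1" for n by (auto simp: \<theta>_def power_le_one)
  have sub: "?Q (\<theta> n) \<subseteq> ?Q 1" for n by (intro centered_square_mono \<theta>)
  have sets: "?Q r \<in> sets area" if "r \<le> 1" for r
  proof -
    have "?Q r \<inter> unit_disk \<in> sets area"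
      by (intro borel_subset_area borel_compact compact_centered_square)
    moreover have "?Q r \<subseteq> unit_disk" using Q centered_square_mono[OF that, of z\<^sub>0 w] by simp
    ultimately show ?thesis by (simp add: Int_absorb2)
  qed
  have pt: "ennreal (norm (g z - g z\<^sub>0)) * indicator (?Q 1) z \<le> ennreal (6 * A) * (\<Sum>n. indicator (?Q 1 - ?Q (\<theta> n)) z)" for z
  proof (cases "z \<in> ?Q 1")
    case True
    have many: "ennreal (real n) \<le> (\<Sum>n. indicator (?Q 1 - ?Q (\<theta> n)) z)" if "\<And>m. m < n \<Longrightarrow> z \<notin> ?Q (\<theta> m)" for n
    proof -
      have "ennreal (real n) = (\<Sum>m<n. (1::ennreal))" by (simp add: ennreal_of_nat_eq_real_of_nat)
      also have "\<dots> = (\<Sum>m<n. indicator (?Q 1 - ?Q (\<theta> m)) z)"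
        using that True by (intro sum.cong) auto
      also have "\<dots> \<le> (\<Sum>n. indicator (?Q 1 - ?Q (\<theta> n)) z)"
        by (intro sum_le_suminf) auto
      finally show ?thesis .
    qed
    show ?thesis
    proof (cases "\<exists>n. z \<in> ?Q (\<theta> n)")
      \<comment> \<open>On the boundary of the square no shrinking contains the point, so the series
        is infinite and dominates any finite value.\<close>
      case False
      obtain n :: nat where n: "norm (g z - g z\<^sub>0) / (6 * A) \<le> real n" using real_arch_simple by blast
      have "ennreal (norm (g z - g z\<^sub>0)) \<le> ennreal (6 * A * real n)"
        using n A by (intro ennreal_leI) (simp add: field_simps)
      also have "\<dots> = ennreal (6 * A) * ennreal (real n)" using A by (simp add: ennreal_mult)
      also have "\<dots> \<le> ennreal (6 * A) * (\<Sum>n. indicator (?Q 1 - ?Q (\<theta> n)) z)"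
        using False by (intro mult_left_mono many) auto
      finally show ?thesis using True by simp
    next
      case True': True
      define n where "n = (LEAST n. z \<in> ?Q (\<theta> n))"
      have n: "z \<in> ?Q (\<theta> n)" using LeastI_ex[OF True'] by (simp add: n_def)
      have n': "z \<notin> ?Q (\<theta> m)" if "m < n" for m using not_less_Least that by (simp add: n_def)
      obtain u where u: "z = z\<^sub>0 + w * u" "sup_norm u \<le> 1 - (1/2) ^ n"
        using n by (auto simp: centered_square_def \<theta>_def)
      have "norm (g z - g z\<^sub>0) \<le> 6 * A * real n"
        unfolding u(1) by (rule Bloch_growth_in_square[OF w Q _ g u(2)]) (use A in auto)
      then have "ennreal (norm (g z - g z\<^sub>0)) \<le> ennreal (6 * A * real n)" by (rule ennreal_leI)
      also have "\<dots> = ennreal (6 * A) * ennreal (real n)" using A by (simp add: ennreal_mult)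
      also have "\<dots> \<le> ennreal (6 * A) * (\<Sum>n. indicator (?Q 1 - ?Q (\<theta> n)) z)"
        by (intro mult_left_mono many n') auto
      finally show ?thesis using True by simp
    qed
  qed simp
  \<comment> \<open>With h = 2^(-n), the relative area of the complement is 1 - (1 - h)^2 = h (2 -
    h) \<le> 2 h.\<close>
  have shell: "emeasure area (?Q 1 - ?Q (\<theta> n)) \<le> ennreal (2 * (1/2) ^ n) * emeasure area (?Q 1)" for n
  proof -
    have fin: "emeasure area (?Q (\<theta> n)) \<noteq> \<infinity>" by simp
    have "emeasure area (?Q (\<theta> n)) = ennreal (1 / pi) * emeasure lebesgue (?Q (\<theta> n))"
      using Q sub[of n] by (intro emeasure_area) auto
    also have "emeasure lebesgue (?Q (\<theta> n)) = ennreal (\<bar>\<theta> n\<bar> ^ DIM(complex)) * emeasure lebesgue (?Q 1)"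
      unfolding centered_square_scale[OF \<theta>(1)]
      using emeasure_lebesgue_affine[of "\<theta> n" "(1 - \<theta> n) *\<^sub>R z\<^sub>0" "?Q 1"] by (simp add: ennreal_power)
    also have "ennreal (1 / pi) * (ennreal (\<bar>\<theta> n\<bar> ^ DIM(complex)) * emeasure lebesgue (?Q 1))
      = ennreal ((\<theta> n)\<^sup>2) * (ennreal (1 / pi) * emeasure lebesgue (?Q 1))"
      by (simp add: mult_ac)
    also have "ennreal (1 / pi) * emeasure lebesgue (?Q 1) = emeasure area (?Q 1)"
      using Q by (intro emeasure_area[symmetric])
    finally have eq: "emeasure area (?Q (\<theta> n)) = ennreal ((\<theta> n)\<^sup>2) * emeasure area (?Q 1)" .
    have "emeasure area (?Q 1 - ?Q (\<theta> n)) = emeasure area (?Q 1) - emeasure area (?Q (\<theta> n))"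
      using \<theta> by (intro emeasure_Diff fin sets sub) auto
    also have "\<dots> = ennreal (1 - (\<theta> n)\<^sup>2) * emeasure area (?Q 1)"
    proof -
      have "measure area (?Q (\<theta> n)) = (\<theta> n)\<^sup>2 * measure area (?Q 1)"
        using eq by (simp add: area.emeasure_eq_measure flip: ennreal_mult)
      moreover have "(\<theta> n)\<^sup>2 \<le> 1" using \<theta>[of n] by (simp add: power_le_one)
      ultimately show ?thesis
        by (simp add: area.emeasure_eq_measure ennreal_minus left_diff_distrib flip: ennreal_mult)
    qed
    also have "\<dots> \<le> ennreal (2 * (1/2) ^ n) * emeasure area (?Q 1)"
      by (intro mult_right_mono ennreal_leI) (auto simp: \<theta>_def power2_eq_square algebra_simps)
    finally show ?thesis .
  qed
  have [measurable]: "?Q 1 - ?Q (\<theta> n) \<in> sets area" for n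
    by (intro sets.Diff sets \<theta>) auto
  have "(\<integral>\<^sup>+ z\<in>?Q 1. ennreal (norm (g z - g z\<^sub>0)) \<partial>area)
    \<le> (\<integral>\<^sup>+ z. ennreal (6 * A) * (\<Sum>n. indicator (?Q 1 - ?Q (\<theta> n)) z) \<partial>area)"
    by (intro nn_integral_mono pt)
  also have "\<dots> = ennreal (6 * A) * (\<Sum>n. emeasure area (?Q 1 - ?Q (\<theta> n)))"
    by (simp add: nn_integral_cmult nn_integral_suminf)
  also have "\<dots> \<le> ennreal (6 * A) * (\<Sum>n. ennreal (2 * (1/2) ^ n) * emeasure area (?Q 1))"
    by (intro mult_left_mono suminf_le shell) auto
  also have "(\<Sum>n. ennreal (2 * (1/2) ^ n) * emeasure area (?Q 1)) = ennreal 4 * emeasure area (?Q 1)"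
  proof -
    have "(\<lambda>n. 2 * (1/2 :: real) ^ n) sums 4"
      using sums_mult[OF geometric_sums[of "1/2 :: real"], of 2] by simp
    then have "(\<Sum>n. ennreal (2 * (1/2) ^ n)) = ennreal 4"
      by (intro suminf_ennreal_eq) auto
    then show ?thesis by (simp only: ennreal_suminf_multc)
  qed
  also have "ennreal (6 * A) * (ennreal 4 * emeasure area (?Q 1)) = ennreal (24 * A) * emeasure area (?Q 1)"
    using A by (simp add: mult.assoc[symmetric] del: ennreal_numeral flip: ennreal_mult)
  finally show ?thesis .
qed

text \<open>Passing from the value at the centre to the average doubles the constant, 48 = 2 * 24.
  The oscillation around the centre also yields integrability over the square, which makes
  \<open>average\<close> a genuine mean.\<close>

lemma BMO_norm_Bloch:
  assumes [measurable]: "g \<in> borel_measurable area" and A: "0 < A"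
    and g: "\<And>z z'. z \<in> unit_disk \<Longrightarrow> z' \<in> unit_disk \<Longrightarrow>
      norm (g z - g z') \<le> A * norm (z - z') * (1 / (1 - norm z) + 1 / (1 - norm z'))"
  shows "BMO_norm g \<le> ennreal (48 * A)"
  unfolding BMO_norm_def
proof (rule SUP_least)
  fix S assume "S \<in> squares_in_disk"
  then obtain a w where S: "S = square a w" "w \<noteq> 0" "S \<subseteq> unit_disk" by (auto simp: squares_in_disk_def)
  define z\<^sub>0 where "z\<^sub>0 = a + w * Complex (1/2) (1/2)"
  have SQ: "S = centered_square z\<^sub>0 w 1" using S by (simp add: square_eq_centered z\<^sub>0_def)
  have "S \<inter> unit_disk \<in> sets area"
    unfolding SQ by (intro borel_subset_area borel_compact compact_centered_square)
  then have [measurable]: "S \<in> sets area" using S(3) by (simp add: Int_absorb2)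
  have ball: "ball z\<^sub>0 (norm w / 2) \<subseteq> S"
    unfolding SQ using ball_subset_centered_square[of w 0 0 z\<^sub>0 _ 1] S(2) by (auto simp: sup_norm_def)
  define \<mu> where "\<mu> = measure area S"
  have \<mu>: "emeasure area S = ennreal \<mu>" by (simp add: \<mu>_def area.emeasure_eq_measure)
  have "0 < emeasure area (ball z\<^sub>0 (norm w / 2))"
    using S ball by (subst emeasure_area_ball) auto
  also have "\<dots> \<le> emeasure area S" using ball by (intro emeasure_mono) auto
  finally have \<mu>0: "0 < \<mu>" using \<mu> by simp
  let ?b = "g z\<^sub>0"
  have osc: "(\<integral>\<^sup>+ z\<in>S. ennreal (norm (g z - ?b)) \<partial>area) \<le> ennreal (24 * A) * ennreal \<mu>"
    using Bloch_mean_oscillation_center[OF S(2) _ A g, of z\<^sub>0] S(3) \<mu> unfolding SQ by simp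
  have osc': "(\<integral>\<^sup>+ z. ennreal (norm (indicator S z *\<^sub>R (g z - ?b))) \<partial>area) \<le> ennreal (24 * A * \<mu>)"
  proof -
    have "(\<integral>\<^sup>+ z. ennreal (norm (indicator S z *\<^sub>R (g z - ?b))) \<partial>area) = (\<integral>\<^sup>+ z\<in>S. ennreal (norm (g z - ?b)) \<partial>area)"
      by (intro nn_integral_cong) (auto simp: indicator_def)
    with osc show ?thesis using A \<mu>0 by (simp add: ennreal_mult)
  qed
  have int1: "integrable area (\<lambda>z. indicator S z *\<^sub>R (g z - ?b))"
    using osc' by (intro integrableI_bounded) (auto intro: le_less_trans)
  have int2: "integrable area (\<lambda>z. indicator S z *\<^sub>R ?b)"
    by (intro integrable_real_indicator[THEN integrable_scaleR_left]) (auto simp: \<mu>)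
  have "(LINT z:S|area. g z) = (\<integral>z. indicator S z *\<^sub>R (g z - ?b) + indicator S z *\<^sub>R ?b \<partial>area)"
    unfolding set_lebesgue_integral_def by (simp add: algebra_simps)
  also have "\<dots> = (\<integral>z. indicator S z *\<^sub>R (g z - ?b) \<partial>area) + (\<integral>z. indicator S z *\<^sub>R ?b \<partial>area)"
    by (intro Bochner_Integration.integral_add int1 int2)
  also have "(\<integral>z. indicator S z *\<^sub>R ?b \<partial>area) = \<mu> *\<^sub>R ?b"
    by (subst integral_scaleR_left) (auto simp: \<mu>_def \<mu> Int_absorb2 S(3))
  finally have avg: "average S g - ?b = (1 / \<mu>) *\<^sub>R (\<integral>z. indicator S z *\<^sub>R (g z - ?b) \<partial>area)"
    using \<mu>0 by (simp add: average_def \<mu>_def[symmetric] scaleR_add_right)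
  have "ennreal (norm (\<integral>z. indicator S z *\<^sub>R (g z - ?b) \<partial>area)) \<le> ennreal (24 * A * \<mu>)"
    using integral_norm_bound_ennreal[OF int1] osc' by (rule order_trans)
  then have "norm (\<integral>z. indicator S z *\<^sub>R (g z - ?b) \<partial>area) \<le> 24 * A * \<mu>"
    using A \<mu>0 by (subst (asm) ennreal_le_iff) auto
  then have avg_le: "norm (average S g - ?b) \<le> 24 * A"
    using \<mu>0 unfolding avg by (simp add: field_simps)
  have "(\<integral>\<^sup>+ z\<in>S. ennreal (norm (g z - average S g)) \<partial>area)
    \<le> (\<integral>\<^sup>+ z. ennreal (norm (g z - ?b)) * indicator S z + ennreal (24 * A) * indicator S z \<partial>area)"
  proof (intro nn_integral_mono)
    fix z
    have "norm (g z - average S g) \<le> norm (g z - ?b) + norm (average S g - ?b)"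
      using norm_triangle_ineq4[of "g z - ?b" "average S g - ?b"] by simp
    then have "norm (g z - average S g) \<le> norm (g z - ?b) + 24 * A"
      using avg_le by simp
    then have "ennreal (norm (g z - average S g)) \<le> ennreal (norm (g z - ?b)) + ennreal (24 * A)"
      using A by (simp add: ennreal_leI flip: ennreal_plus)
    then show "ennreal (norm (g z - average S g)) * indicator S z
      \<le> ennreal (norm (g z - ?b)) * indicator S z + ennreal (24 * A) * indicator S z"
      by (simp add: indicator_def)
  qed
  also have "\<dots> = (\<integral>\<^sup>+ z\<in>S. ennreal (norm (g z - ?b)) \<partial>area) + ennreal (24 * A) * ennreal \<mu>"
    by (subst nn_integral_add) (auto simp: nn_integral_cmult_indicator \<mu>)
  also have "\<dots> \<le> ennreal (24 * A) * ennreal \<mu> + ennreal (24 * A) * ennreal \<mu>"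
    by (intro add_mono osc) auto
  also have "\<dots> = ennreal (48 * A * \<mu>)"
    using A \<mu>0 by (simp flip: ennreal_mult ennreal_plus)
  finally have "(\<integral>\<^sup>+ z\<in>S. ennreal (norm (g z - average S g)) \<partial>area) / emeasure area S \<le> ennreal (48 * A * \<mu>) / ennreal \<mu>"
    unfolding \<mu> by (rule divide_right_mono_ennreal)
  also have "\<dots> = ennreal (48 * A)" using A \<mu>0 by (simp add: divide_ennreal)
  finally show "(\<integral>\<^sup>+ z\<in>S. ennreal (norm (g z - average S g)) \<partial>area) / emeasure area S \<le> ennreal (48 * A)" .
qed

section \<open>The Shimorin kernel\<close>

definition shimorin_kernel :: "real measure \<Rightarrow> complex \<Rightarrow> complex \<Rightarrow> complex" where
  "shimorin_kernel \<nu> z w = 1 / (1 - z * cnj w) * (\<integral>r. 1 / (1 - of_real r * z * cnj w) \<partial>\<nu>)"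

lemma shimorin_op_eq: "shimorin_op \<nu> f z = (\<integral>w. shimorin_kernel \<nu> z w * f w \<partial>area)"
  by (simp add: shimorin_op_def shimorin_kernel_def)

locale unit_interval_measure = finite_measure \<nu> for \<nu> :: "real measure" +
  assumes sets_\<nu>: "sets \<nu> = sets (restrict_space borel {0..1})"
begin

lemma space_\<nu>: "space \<nu> = {0..1}"
  using sets_eq_imp_space_eq[OF sets_\<nu>] by (simp only: space_restrict_space space_borel Int_UNIV_right)

lemma borel_measurable_\<nu>: "f \<in> borel \<rightarrow>\<^sub>M N \<Longrightarrow> f \<in> \<nu> \<rightarrow>\<^sub>M N"
  unfolding measurable_cong_sets[OF sets_\<nu> refl] by (rule measurable_restrict_space1)

end

text \<open>Both bounds combine 1 - r \<le> |1 - r \<zeta>| with |1 - \<zeta>| \<le> |1 - r \<zeta>|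
  + (1 - r). The first reduces integrals over \<nu> with complex \<zeta> to the single real
  parameter |1 - \<zeta>|.\<close>

lemma norm_one_minus_scaled_ge:
  fixes \<zeta> :: complex
  assumes "norm \<zeta> < 1" "0 \<le> r" "r \<le> 1"
  shows "(1 - r) + norm (1 - \<zeta>) \<le> 3 * norm (1 - of_real r * \<zeta>)" "norm (1 - \<zeta>) \<le> 2 * norm (1 - of_real r * \<zeta>)"
    "0 < norm (1 - of_real r * \<zeta>)"
proof -
  have r\<zeta>: "norm (of_real r * \<zeta>) = r * norm \<zeta>" using assms by (simp add: norm_mult)
  have "r * norm \<zeta> \<le> r" using assms by (simp add: mult_left_le)
  then have 1: "1 - r \<le> norm (1 - of_real r * \<zeta>)"
    using norm_triangle_ineq2[of 1 "of_real r * \<zeta>"] r\<zeta> by simp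
  have eq: "1 - \<zeta> = (1 - of_real r * \<zeta>) - of_real (1 - r) * \<zeta>" by (simp add: algebra_simps)
  have "norm (1 - \<zeta>) \<le> norm (1 - of_real r * \<zeta>) + norm (of_real (1 - r) * \<zeta>)"
    unfolding eq by (rule norm_triangle_ineq4)
  also have "norm (of_real (1 - r) * \<zeta>) = (1 - r) * norm \<zeta>" using assms by (simp only: norm_mult norm_of_real)
  also have "\<dots> \<le> 1 - r" using assms by (simp add: mult_left_le)
  finally have 2: "norm (1 - \<zeta>) \<le> norm (1 - of_real r * \<zeta>) + (1 - r)" by simp
  show "(1 - r) + norm (1 - \<zeta>) \<le> 3 * norm (1 - of_real r * \<zeta>)" "norm (1 - \<zeta>) \<le> 2 * norm (1 - of_real r * \<zeta>)"
    using 1 2 by simp_all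
  have "r * norm \<zeta> < 1" using assms \<open>r * norm \<zeta> \<le> r\<close> by (cases "r = 1") auto
  then show "0 < norm (1 - of_real r * \<zeta>)"
    using norm_triangle_ineq2[of 1 "of_real r * \<zeta>"] r\<zeta> by (simp del: zero_less_norm_iff)
qed

lemma mult_cnj_in_disk:
  fixes z w :: complex
  assumes "z \<in> unit_disk" "w \<in> unit_disk"
  shows "norm (z * cnj w) < 1"
  using assms mult_strict_mono[of "norm z" 1 "norm w" 1] by (simp add: norm_mult)

text \<open>The assumption bounds the \<nu>-integral of the modulus and not just the modulus of the
  integral: it then also gives integrability and controls differences of the kernel. Together with
  the outer factor 1/|1 - \<zeta>|, the exponent 1 - 2/c becomes -2/c.\<close>

locale bounded_shimorin_kernel = unit_interval_measure +
  fixes c M :: real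
  assumes c: "1 \<le> c" "c \<le> 2" and M: "0 < M"
    and cauchy_bound: "\<And>\<zeta>::complex. norm \<zeta> < 1 \<Longrightarrow>
      (\<integral>\<^sup>+ r. ennreal (1 / norm (1 - of_real r * \<zeta>)) \<partial>\<nu>) \<le> ennreal (M * norm (1 - \<zeta>) powr (1 - 2 / c))"
begin

lemma integrable_cauchy:
  fixes \<zeta> :: complex
  assumes "norm \<zeta> < 1"
  shows "integrable \<nu> (\<lambda>r. 1 / (1 - of_real r * \<zeta>))"
proof (rule integrableI_bounded)
  show "(\<lambda>r. 1 / (1 - of_real r * \<zeta>)) \<in> borel_measurable \<nu>"
    by (rule borel_measurable_\<nu>) measurable
  show "(\<integral>\<^sup>+ r. ennreal (norm (1 / (1 - of_real r * \<zeta>))) \<partial>\<nu>) < \<infinity>"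
    using cauchy_bound[OF assms] by (auto simp: norm_divide intro: le_less_trans)
qed

lemma norm_cauchy_integral_le:
  fixes \<zeta> :: complex
  assumes "norm \<zeta> < 1"
  shows "norm (\<integral>r. 1 / (1 - of_real r * \<zeta>) \<partial>\<nu>) \<le> M * norm (1 - \<zeta>) powr (1 - 2 / c)"
proof -
  have "ennreal (norm (\<integral>r. 1 / (1 - of_real r * \<zeta>) \<partial>\<nu>)) \<le> (\<integral>\<^sup>+ r. ennreal (norm (1 / (1 - of_real r * \<zeta>))) \<partial>\<nu>)"
    by (rule integral_norm_bound_ennreal[OF integrable_cauchy[OF assms]])
  also have "\<dots> = (\<integral>\<^sup>+ r. ennreal (1 / norm (1 - of_real r * \<zeta>)) \<partial>\<nu>)" by (simp add: norm_divide)
  also note cauchy_bound[OF assms]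
  finally show ?thesis using M by (subst (asm) ennreal_le_iff) auto
qed

lemma norm_kernel_le:
  assumes "z \<in> unit_disk" "w \<in> unit_disk"
  shows "norm (shimorin_kernel \<nu> z w) \<le> M * norm (1 - z * cnj w) powr - (2 / c)"
proof -
  let ?a = "norm (1 - z * cnj w)"
  have a: "0 < ?a" by (rule norm_one_minus_pos[OF assms])
  have "norm (shimorin_kernel \<nu> z w) = 1 / ?a * norm (\<integral>r. 1 / (1 - of_real r * (z * cnj w)) \<partial>\<nu>)"
    by (simp add: shimorin_kernel_def norm_mult norm_divide mult.assoc)
  also have "\<dots> \<le> 1 / ?a * (M * ?a powr (1 - 2 / c))"
    by (intro mult_left_mono norm_cauchy_integral_le mult_cnj_in_disk assms) simp
  also have "\<dots> = M * (?a powr (1 - 2 / c) * ?a powr - 1)"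
    using a by (simp add: powr_minus_divide)
  also have "?a powr (1 - 2 / c) * ?a powr - 1 = ?a powr - (2 / c)"
    by (simp only: powr_add[symmetric]) simp
  finally show ?thesis .
qed

text \<open>A discrete product rule: each of the two factors of the kernel is differenced
  separately, at the price of |z - z'| divided by the smaller of the two values |1 - z cnj w|. The
  estimate uses the end points only, so no path from z to z' has to be followed. The constant is 3 =
  1 + 2, where the 2 comes from |1 - \<zeta>'| \<le> 2 |1 - r \<zeta>'|.\<close>

lemma norm_kernel_diff_le:
  assumes z: "z \<in> unit_disk" and z': "z' \<in> unit_disk" and w: "w \<in> unit_disk"
  shows "norm (shimorin_kernel \<nu> z w - shimorin_kernel \<nu> z' w) \<le>
    3 * M * norm (z - z') * (norm (1 - z * cnj w) powr (- 1 - 2 / c) + norm (1 - z' * cnj w) powr (- 1 - 2 / c))"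
proof -
  define \<zeta> where "\<zeta> = z * cnj w"
  define \<zeta>' where "\<zeta>' = z' * cnj w"
  have \<zeta>: "norm \<zeta> < 1" "norm \<zeta>' < 1" unfolding \<zeta>_def \<zeta>'_def by (intro mult_cnj_in_disk z z' w)+
  define a where "a = 1 - \<zeta>"
  define a' where "a' = 1 - \<zeta>'"
  have a: "0 < norm a" "0 < norm a'"
    unfolding a_def a'_def \<zeta>_def \<zeta>'_def by (intro norm_one_minus_pos z z' w)+
  define d where "d = norm (z - z')"
  have "norm (\<zeta> - \<zeta>') = d * norm w" by (simp add: \<zeta>_def \<zeta>'_def d_def norm_mult flip: left_diff_distrib)
  also have "\<dots> \<le> d" using w by (simp add: d_def mult_left_le)
  finally have d: "norm (\<zeta> - \<zeta>') \<le> d" .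
  have d0: "0 \<le> d" by (simp add: d_def)
  define G where "G \<xi> = (\<integral>r. 1 / (1 - of_real r * \<xi>) \<partial>\<nu>)" for \<xi> :: complex
  \<comment> \<open>All exponents involved are nonpositive, so the minimum gives a common upper
    bound; at the end its power is one of the two powers in the claim.\<close>
  define m where "m = min (norm a) (norm a')"
  have m: "0 < m" "m \<le> norm a" "m \<le> norm a'" using a by (auto simp: m_def)
  define e where "e = - 1 - 2 / c"
  have ce: "1 - 2 / c \<le> 0" using c by (simp add: field_simps)
  have Ga: "norm (G \<zeta>) \<le> M * m powr (1 - 2 / c)"
  proof -
    have "norm (G \<zeta>) \<le> M * norm a powr (1 - 2 / c)"
      unfolding G_def a_def by (rule norm_cauchy_integral_le[OF \<zeta>(1)])
    also have "\<dots> \<le> M * m powr (1 - 2 / c)"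
      using M m ce by (intro mult_left_mono powr_mono2') auto
    finally show ?thesis .
  qed
  have Gd: "norm (G \<zeta> - G \<zeta>') \<le> 2 * d / m * (M * m powr (1 - 2 / c))"
  proof -
    have "G \<zeta> - G \<zeta>' = (\<integral>r. 1 / (1 - of_real r * \<zeta>) - 1 / (1 - of_real r * \<zeta>') \<partial>\<nu>)"
      unfolding G_def by (intro Bochner_Integration.integral_diff[symmetric] integrable_cauchy \<zeta>)
    then have "ennreal (norm (G \<zeta> - G \<zeta>')) \<le> (\<integral>\<^sup>+ r. ennreal (norm (1 / (1 - of_real r * \<zeta>) - 1 / (1 - of_real r * \<zeta>'))) \<partial>\<nu>)"
      using integral_norm_bound_ennreal[OF Bochner_Integration.integrable_diff[OF integrable_cauchy[OF \<zeta>(1)] integrable_cauchy[OF \<zeta>(2)]]] by simp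
    also have "\<dots> \<le> (\<integral>\<^sup>+ r. ennreal (2 * d / m) * ennreal (1 / norm (1 - of_real r * \<zeta>)) \<partial>\<nu>)"
    proof (intro nn_integral_mono)
      fix r assume "r \<in> space \<nu>"
      then have r: "0 \<le> r" "r \<le> 1" by (auto simp: space_\<nu>)
      let ?b = "1 - of_real r * \<zeta>" and ?b' = "1 - of_real r * \<zeta>'"
      have b: "0 < norm ?b" "0 < norm ?b'" "norm a' \<le> 2 * norm ?b'"
        unfolding a'_def by (intro norm_one_minus_scaled_ge \<zeta> r)+
      have "1 / ?b - 1 / ?b' = (?b' - ?b) / (?b * ?b')"
        using b by (intro diff_frac_eq[THEN trans]) auto
      also have "?b' - ?b = of_real r * (\<zeta> - \<zeta>')" by (simp only: right_diff_distrib) simp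
      finally have "1 / ?b - 1 / ?b' = of_real r * (\<zeta> - \<zeta>') / (?b * ?b')" .
      then have "norm (1 / ?b - 1 / ?b') = r * norm (\<zeta> - \<zeta>') / (norm ?b * norm ?b')"
        using r by (simp only: norm_mult norm_divide norm_of_real abs_of_nonneg)
      also have "\<dots> \<le> d / (norm ?b * (m / 2))"
        using b m d d0 r mult_mono[of r 1 "norm (\<zeta> - \<zeta>')" d] by (intro frac_le mult_pos_pos mult_left_mono) auto
      also have "\<dots> = 2 * d / m * (1 / norm ?b)" by (simp add: mult_ac)
      finally show "ennreal (norm (1 / ?b - 1 / ?b')) \<le> ennreal (2 * d / m) * ennreal (1 / norm ?b)"
        using d0 m by (simp add: ennreal_leI flip: ennreal_mult)
    qed
    also have "\<dots> = ennreal (2 * d / m) * (\<integral>\<^sup>+ r. ennreal (1 / norm (1 - of_real r * \<zeta>)) \<partial>\<nu>)"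
      by (intro nn_integral_cmult borel_measurable_\<nu>) measurable
    also have "\<dots> \<le> ennreal (2 * d / m) * ennreal (M * norm a powr (1 - 2 / c))"
      unfolding a_def by (intro mult_left_mono cauchy_bound \<zeta>) auto
    also have "\<dots> = ennreal (2 * d / m * (M * norm a powr (1 - 2 / c)))"
      using d0 m M by (intro ennreal_mult[symmetric]) auto
    also have "\<dots> \<le> ennreal (2 * d / m * (M * m powr (1 - 2 / c)))"
      using M m ce d0 by (intro ennreal_leI mult_left_mono powr_mono2') auto
    finally show ?thesis using d0 m M by (subst (asm) ennreal_le_iff) auto
  qed
  have eq: "shimorin_kernel \<nu> z w - shimorin_kernel \<nu> z' w = (1 / a - 1 / a') * G \<zeta> + 1 / a' * (G \<zeta> - G \<zeta>')"
  proof -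
    have "shimorin_kernel \<nu> z w = 1 / a * G \<zeta>" "shimorin_kernel \<nu> z' w = 1 / a' * G \<zeta>'"
      by (simp_all only: shimorin_kernel_def G_def a_def a'_def \<zeta>_def \<zeta>'_def mult.assoc)
    then show ?thesis by (simp only: left_diff_distrib right_diff_distrib) simp
  qed
  have "norm (shimorin_kernel \<nu> z w - shimorin_kernel \<nu> z' w)
      \<le> norm (1 / a - 1 / a') * norm (G \<zeta>) + norm (1 / a') * norm (G \<zeta> - G \<zeta>')"
    unfolding eq norm_mult[symmetric] by (rule norm_triangle_ineq)
  also have "\<dots> \<le> d / (m * m) * (M * m powr (1 - 2 / c)) + 1 / m * (2 * d / m * (M * m powr (1 - 2 / c)))"
  proof (intro add_mono mult_mono Ga Gd)
    have "1 / a - 1 / a' = (a' - a) / (a * a')"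
      using a by (intro diff_frac_eq[THEN trans]) auto
    also have "a' - a = \<zeta> - \<zeta>'" by (simp add: a_def a'_def)
    finally have "1 / a - 1 / a' = (\<zeta> - \<zeta>') / (a * a')" .
    then have "norm (1 / a - 1 / a') = norm (\<zeta> - \<zeta>') / (norm a * norm a')"
      by (simp only: norm_mult norm_divide)
    also have "\<dots> \<le> d / (m * m)" using d d0 m a by (intro frac_le mult_mono mult_pos_pos) auto
    finally show "norm (1 / a - 1 / a') \<le> d / (m * m)" .
    show "norm (1 / a') \<le> 1 / m" using m a by (simp add: norm_divide frac_le)
  qed (use d0 m M in auto)
  also have "\<dots> = 3 * M * d * (m powr - 2 * m powr (1 - 2 / c))"
    using m by (simp add: powr_minus_divide power2_eq_square)
  also have "m powr - 2 * m powr (1 - 2 / c) = m powr e"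
    by (simp only: e_def powr_add[symmetric]) simp
  also have "m powr e \<le> norm a powr e + norm a' powr e"
    by (auto simp: m_def min_def)
  finally show ?thesis
    using M d0 by (simp add: mult_left_mono e_def a_def a'_def \<zeta>_def \<zeta>'_def d_def)
qed

lemma borel_measurable_kernel_pair:
  "(\<lambda>x. shimorin_kernel \<nu> (fst x) (snd x)) \<in> borel_measurable (area \<Otimes>\<^sub>M area)"
proof (rule borel_measurable_pair_area, unfold borel_prod[symmetric])
  have id: "(\<lambda>x. x) \<in> \<nu> \<rightarrow>\<^sub>M borel" by (rule borel_measurable_\<nu>) simp
  have "(\<lambda>x. 1 / (1 - of_real (snd x) * fst (fst x) * cnj (snd (fst x))) :: complex)
    \<in> borel_measurable ((borel \<Otimes>\<^sub>M borel) \<Otimes>\<^sub>M \<nu>)"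
  proof -
    have 1: "(\<lambda>x. (fst x, snd x)) \<in> (borel \<Otimes>\<^sub>M borel) \<Otimes>\<^sub>M \<nu> \<rightarrow>\<^sub>M (borel \<Otimes>\<^sub>M borel) \<Otimes>\<^sub>M (borel :: real measure)"
      by (intro measurable_Pair measurable_fst measurable_compose[OF measurable_snd id])
    have 2: "(\<lambda>x. 1 / (1 - of_real (snd x) * fst (fst x) * cnj (snd (fst x))) :: complex)
      \<in> borel_measurable ((borel \<Otimes>\<^sub>M borel) \<Otimes>\<^sub>M (borel :: real measure))"
      by measurable
    show ?thesis using measurable_compose[OF 1 2] by (simp only: fst_conv snd_conv)
  qed
  then have [measurable]: "(\<lambda>x. \<integral>r. 1 / (1 - of_real r * fst x * cnj (snd x) :: complex) \<partial>\<nu>)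
    \<in> borel_measurable (borel \<Otimes>\<^sub>M borel)"
    by (intro borel_measurable_lebesgue_integral) (simp add: case_prod_beta')
  show "(\<lambda>x. shimorin_kernel \<nu> (fst x) (snd x)) \<in> borel_measurable (borel \<Otimes>\<^sub>M borel)"
    unfolding shimorin_kernel_def by measurable
qed

lemma borel_measurable_kernel_snd [measurable]:
  assumes "z \<in> unit_disk"
  shows "shimorin_kernel \<nu> z \<in> borel_measurable area"
  using measurable_compose[OF measurable_Pair1'[of z area area] borel_measurable_kernel_pair] assms by simp

lemma borel_measurable_shimorin_op:
  assumes [measurable]: "f \<in> borel_measurable area"
  shows "shimorin_op \<nu> f \<in> borel_measurable area"
proof -
  note [measurable] = borel_measurable_kernel_pair
  show ?thesis
    unfolding shimorin_op_eq[abs_def] by (intro area.borel_measurable_lebesgue_integral) (simp add: case_prod_beta')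
qed

lemma shimorin_op_le_potential:
  assumes [measurable]: "f \<in> borel_measurable area" and z: "z \<in> unit_disk"
  shows "ennreal (norm (shimorin_op \<nu> f z) / M) \<le> bergman_potential c (\<lambda>w. norm (f w)) z"
proof -
  have "ennreal (norm (shimorin_op \<nu> f z)) \<le> (\<integral>\<^sup>+ w. ennreal (norm (shimorin_kernel \<nu> z w * f w)) \<partial>area)"
  \<comment> \<open>Without integrability the Bochner integral has the value 0 and the bound is
    trivial.\<close>
  proof (cases "integrable area (\<lambda>w. shimorin_kernel \<nu> z w * f w)")
    case True
    then show ?thesis unfolding shimorin_op_eq by (rule integral_norm_bound_ennreal)
  qed (simp add: shimorin_op_eq not_integrable_integral_eq)
  also have "\<dots> \<le> (\<integral>\<^sup>+ w. ennreal M * ennreal (norm (1 - z * cnj w) powr - (2 / c) * norm (f w)) \<partial>area)"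
  proof (intro nn_integral_mono)
    fix w assume "w \<in> space area"
    then have "norm (shimorin_kernel \<nu> z w * f w) \<le> M * norm (1 - z * cnj w) powr - (2 / c) * norm (f w)"
      unfolding norm_mult by (intro mult_right_mono norm_kernel_le z) auto
    then show "ennreal (norm (shimorin_kernel \<nu> z w * f w)) \<le> ennreal M * ennreal (norm (1 - z * cnj w) powr - (2 / c) * norm (f w))"
      using M by (simp add: ennreal_leI mult.assoc flip: ennreal_mult)
  qed
  also have "\<dots> = ennreal M * bergman_potential c (\<lambda>w. norm (f w)) z"
    unfolding bergman_potential_def by (intro nn_integral_cmult) measurable
  finally have "ennreal (1 / M) * ennreal (norm (shimorin_op \<nu> f z))
      \<le> ennreal (1 / M) * (ennreal M * bergman_potential c (\<lambda>w. norm (f w)) z)"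
    by (rule mult_left_mono) simp
  then show ?thesis using M by (simp add: mult.assoc[symmetric] flip: ennreal_mult)
qed

lemma shimorin_op_AE_zero:
  assumes "AE w in area. f w = 0"
  shows "shimorin_op \<nu> f z = 0"
  unfolding shimorin_op_eq using assms by (intro integral_eq_zero_AE) auto

end

section \<open>Boundedness of the Shimorin operator\<close>

lemma Lp_norm_finiteD:
  assumes "0 < p" "Lp_norm (ennreal p) f < \<infinity>"
  obtains J where "0 \<le> J" "(\<integral>\<^sup>+ z. ennreal (norm (f z) powr p) \<partial>area) = ennreal J"
    "Lp_norm (ennreal p) f = ennreal (J powr (1 / p))"
proof -
  let ?I = "\<integral>\<^sup>+ z. ennreal (norm (f z) powr p) \<partial>area"
  have p: "enn2real (ennreal p) = p" using assms by simp
  have "?I \<noteq> \<infinity>" using assms(2) unfolding Lp_norm_def Let_def p by (auto split: if_splits)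
  then have "?I = ennreal (enn2real ?I)" by (simp add: less_top)
  moreover have "Lp_norm (ennreal p) f = ennreal (enn2real ?I powr (1 / p))"
    using \<open>?I \<noteq> \<infinity>\<close> unfolding Lp_norm_def Let_def p by simp
  ultimately show ?thesis using that[of "enn2real ?I"] by simp
qed

lemma Lp_norm_le:
  assumes "0 < p" "0 \<le> J" "(\<integral>\<^sup>+ z. ennreal (norm (f z) powr p) \<partial>area) \<le> ennreal J"
  shows "Lp_norm (ennreal p) f \<le> ennreal (J powr (1 / p))"
proof -
  let ?I = "\<integral>\<^sup>+ z. ennreal (norm (f z) powr p) \<partial>area"
  have p: "enn2real (ennreal p) = p" using assms by simp
  have "?I \<noteq> \<infinity>" using assms(3) by (auto simp: top_unique)
  then have "Lp_norm (ennreal p) f = ennreal (enn2real ?I powr (1 / p))"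
    unfolding Lp_norm_def Let_def p by simp
  also have "enn2real ?I \<le> J" using enn2real_mono[OF assms(3)] assms(2) by simp
  then have "ennreal (enn2real ?I powr (1 / p)) \<le> ennreal (J powr (1 / p))"
    using assms(1) by (intro ennreal_leI powr_mono2) auto
  finally show ?thesis .
qed

context bounded_shimorin_kernel
begin

lemma weak_type_bound:
  "bounded_operator (Lp_norm 1) (weak_Lp_norm c) (shimorin_op \<nu>)"
proof -
  obtain C where C: "C > 0"
    "\<And>f u I \<sigma>. f \<in> borel_measurable area \<Longrightarrow> (\<And>w. 0 \<le> f w) \<Longrightarrow> u \<in> borel_measurable area \<Longrightarrow>
      (\<And>z. 0 \<le> u z) \<Longrightarrow> 0 < I \<Longrightarrow> 0 < \<sigma> \<Longrightarrow> (\<integral>\<^sup>+ w. ennreal (f w) \<partial>area) \<le> ennreal I \<Longrightarrow>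
      (\<And>z. z \<in> unit_disk \<Longrightarrow> ennreal (u z) \<le> bergman_potential c f z) \<Longrightarrow>
      emeasure area {z \<in> unit_disk. u z > \<sigma>} \<le> ennreal (C * (I / \<sigma>) powr c)"
    using bergman_potential_weak_type[OF c(1)] by blast
  define B where "B = C powr (1 / c) * M"
  have B: "0 < B" using C(1) M by (simp add: B_def)
  show ?thesis
    unfolding bounded_operator_def
  proof (intro exI[of _ B] conjI ballI)
    show "0 \<le> B" using B by simp
    fix f assume "f \<in> fun_space (Lp_norm 1)"
    then have f [measurable]: "f \<in> borel_measurable area" and fin: "Lp_norm (ennreal 1) f < \<infinity>"
      by (auto simp: fun_space_def)
    obtain J where J: "0 \<le> J" "(\<integral>\<^sup>+ z. ennreal (norm (f z) powr 1) \<partial>area) = ennreal J"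
      "Lp_norm (ennreal 1) f = ennreal (J powr (1 / 1))"
      by (rule Lp_norm_finiteD[OF _ fin]) auto
    note [measurable] = borel_measurable_shimorin_op[OF f]
    have J': "(\<integral>\<^sup>+ z. ennreal (norm (f z)) \<partial>area) = ennreal J" using J(2) by simp
    \<comment> \<open>The potential estimate requires positive mass, but J may be 0; the bound is
      therefore shown for every positive I \<ge> J and then passed to the limit.\<close>
    have *: "weak_Lp_norm c (shimorin_op \<nu> f) \<le> ennreal (B * I)" if I: "J \<le> I" "0 < I" for I
      unfolding weak_Lp_norm_def
    proof (intro Inf_lower CollectI exI[of _ "B * I"] conjI allI impI)
      show "0 < B * I" using B I by simp
      fix t :: real assume t: "0 < t"
      have "{z \<in> unit_disk. norm (shimorin_op \<nu> f z) > t} = {z \<in> unit_disk. norm (shimorin_op \<nu> f z) / M > t / M}"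
        using M by (simp add: divide_less_cancel)
      also have "emeasure area \<dots> \<le> ennreal (C * (I / (t / M)) powr c)"
      proof (rule C(2)[of "\<lambda>w. norm (f w)"])
        show "(\<integral>\<^sup>+ z. ennreal (norm (f z)) \<partial>area) \<le> ennreal I" using J' I by (simp add: ennreal_leI)
        show "ennreal (norm (shimorin_op \<nu> f z) / M) \<le> bergman_potential c (\<lambda>w. norm (f w)) z" if "z \<in> unit_disk" for z
          by (rule shimorin_op_le_potential[OF f that])
      qed (use M I t in auto)
      also have "C * (I / (t / M)) powr c = (B * I) powr c / t powr c"
        using C(1) M I t c by (simp add: B_def powr_mult powr_divide powr_powr)
      finally show "emeasure area {z \<in> unit_disk. norm (shimorin_op \<nu> f z) > t} \<le> ennreal ((B * I) powr c / t powr c)" .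
    qed simp
    have "weak_Lp_norm c (shimorin_op \<nu> f) \<le> ennreal (B * J)"
    proof (rule ennreal_le_epsilon)
      fix e :: real assume e: "0 < e"
      have "weak_Lp_norm c (shimorin_op \<nu> f) \<le> ennreal (B * (J + e / B))"
        using e B J(1) by (intro *) (auto intro: add_nonneg_pos)
      also have "B * (J + e / B) = B * J + e" using B by (simp add: distrib_left)
      finally show "weak_Lp_norm c (shimorin_op \<nu> f) \<le> ennreal (B * J) + ennreal e"
        using B J(1) e by simp
    qed
    also have "ennreal (B * J) = ennreal B * Lp_norm 1 f"
      using J B by (simp add: ennreal_mult)
    finally show le: "weak_Lp_norm c (shimorin_op \<nu> f) \<le> ennreal B * Lp_norm 1 f" .
    then show "shimorin_op \<nu> f \<in> fun_space (weak_Lp_norm c)"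
      using fin by (auto simp: fun_space_def ennreal_mult_less_top intro: le_less_trans)
  qed
qed

lemma strong_type_bound:
  assumes p: "1 < p" and q: "0 < q" and pq: "1 / q = 1 / p + 1 / c - 1"
  shows "bounded_operator (Lp_norm (ennreal p)) (Lp_norm (ennreal q)) (shimorin_op \<nu>)"
proof -
  obtain C where C: "C > 0"
    "\<And>f u I. f \<in> borel_measurable area \<Longrightarrow> (\<And>w. 0 \<le> f w) \<Longrightarrow> (\<And>z. 0 \<le> u z) \<Longrightarrow> 0 < I \<Longrightarrow>
      (\<integral>\<^sup>+ w. ennreal (f w powr p) \<partial>area) \<le> ennreal I \<Longrightarrow>
      (\<And>z. z \<in> unit_disk \<Longrightarrow> ennreal (u z) \<le> bergman_potential c f z) \<Longrightarrow>
      (\<integral>\<^sup>+ z. ennreal (u z powr q) \<partial>area) \<le> ennreal (C * I powr (q / p))"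
    using bergman_potential_Lp_Lq[OF c(1) p q pq] by blast
  define B where "B = C powr (1 / q) * M"
  have B: "0 < B" using C(1) M by (simp add: B_def)
  show ?thesis
    unfolding bounded_operator_def
  proof (intro exI[of _ B] conjI ballI)
    show "0 \<le> B" using B by simp
    fix f assume "f \<in> fun_space (Lp_norm (ennreal p))"
    then have f [measurable]: "f \<in> borel_measurable area" and fin: "Lp_norm (ennreal p) f < \<infinity>"
      by (auto simp: fun_space_def)
    obtain J where J: "0 \<le> J" "(\<integral>\<^sup>+ z. ennreal (norm (f z) powr p) \<partial>area) = ennreal J"
      "Lp_norm (ennreal p) f = ennreal (J powr (1 / p))"
      by (rule Lp_norm_finiteD[OF _ fin]) (use p in auto)
    note [measurable] = borel_measurable_shimorin_op[OF f]
    show le: "Lp_norm (ennreal q) (shimorin_op \<nu> f) \<le> ennreal B * Lp_norm (ennreal p) f"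
    \<comment> \<open>For J = 0 the function vanishes almost everywhere, and the operator sends it
      to 0 at every point.\<close>
    proof (cases "J = 0")
      case True
      then have "(\<integral>\<^sup>+ z. ennreal (norm (f z) powr p) \<partial>area) = 0" using J(2) by simp
      then have "AE z in area. ennreal (norm (f z) powr p) = 0"
        by (subst (asm) nn_integral_0_iff_AE) auto
      then have "AE z in area. f z = 0" by eventually_elim (auto simp: ennreal_eq_0_iff)
      then have "shimorin_op \<nu> f z = 0" for z by (rule shimorin_op_AE_zero)
      then have "Lp_norm (ennreal q) (shimorin_op \<nu> f) \<le> ennreal (0 powr (1 / q))"
        using q by (intro Lp_norm_le) auto
      then show ?thesis by simp
    next
      case False
      then have J0: "0 < J" using J(1) by simp
      have "(\<integral>\<^sup>+ z. ennreal ((norm (shimorin_op \<nu> f z) / M) powr q) \<partial>area) \<le> ennreal (C * J powr (q / p))"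
        using M J J0 shimorin_op_le_potential[OF f] by (intro C(2)[of "\<lambda>w. norm (f w)"]) auto
      then have "ennreal (M powr q) * (\<integral>\<^sup>+ z. ennreal ((norm (shimorin_op \<nu> f z) / M) powr q) \<partial>area)
          \<le> ennreal (M powr q) * ennreal (C * J powr (q / p))"
        by (rule mult_left_mono) simp
      also have "ennreal (M powr q) * (\<integral>\<^sup>+ z. ennreal ((norm (shimorin_op \<nu> f z) / M) powr q) \<partial>area)
        = (\<integral>\<^sup>+ z. ennreal (M powr q) * ennreal ((norm (shimorin_op \<nu> f z) / M) powr q) \<partial>area)"
        by (intro nn_integral_cmult[symmetric]) measurable
      also have "\<dots> = (\<integral>\<^sup>+ z. ennreal (norm (shimorin_op \<nu> f z) powr q) \<partial>area)"
        using M by (intro nn_integral_cong) (simp add: powr_divide flip: ennreal_mult)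
      also have "ennreal (M powr q) * ennreal (C * J powr (q / p)) = ennreal (M powr q * (C * J powr (q / p)))"
        using C(1) by (intro ennreal_mult[symmetric]) auto
      finally have "Lp_norm (ennreal q) (shimorin_op \<nu> f) \<le> ennreal ((M powr q * (C * J powr (q / p))) powr (1 / q))"
        using C(1) q by (intro Lp_norm_le) auto
      also have "(M powr q * (C * J powr (q / p))) powr (1 / q) = B * J powr (1 / p)"
        using \<open>0 < q\<close> C(1) M J0 by (simp add: B_def powr_mult powr_powr)
      finally show ?thesis using J(3) B by (simp add: ennreal_mult)
    qed
    then show "shimorin_op \<nu> f \<in> fun_space (Lp_norm (ennreal q))"
      using fin by (auto simp: fun_space_def ennreal_mult_less_top intro: le_less_trans)
  qed
qed

text \<open>Hoelder's inequality with exponents c and c': the c-th power of the kernel power has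
  exponent -(2 + c), whose integral is at most a multiple of (1 - |z|)^(-c), and the c-th root of
  this is the claimed 1/(1 - |z|).\<close>

lemma endpoint_integral_bound:
  obtains C where "C > 0"
    "\<And>f N z. f \<in> borel_measurable area \<Longrightarrow> 0 < N \<Longrightarrow> Lp_norm (dual_exponent c) f \<le> ennreal N \<Longrightarrow> z \<in> unit_disk \<Longrightarrow>
      (\<integral>\<^sup>+ w. ennreal (norm (1 - z * cnj w) powr (- 1 - 2 / c) * norm (f w)) \<partial>area) \<le> ennreal (C * N / (1 - norm z))"
proof -
  obtain C where C: "C > 0"
    "\<And>z. z \<in> unit_disk \<Longrightarrow>
      (\<integral>\<^sup>+ w. ennreal (norm (1 - z * cnj w) powr (- 2 - c)) \<partial>area) \<le> ennreal (C * (1 - norm z) powr - c)"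
    using Forelli_Rudin_unweighted[of c] c by auto
  show ?thesis
  proof (rule that[of "1 + C"])
    show "1 + C > 0" using C(1) by simp
    fix f :: "complex \<Rightarrow> complex" and N :: real and z :: complex
    assume f [measurable]: "f \<in> borel_measurable area" and N: "0 < N"
      and fN: "Lp_norm (dual_exponent c) f \<le> ennreal N" and z: "z \<in> unit_disk"
    let ?d = "1 - norm z"
    let ?k = "\<lambda>w. norm (1 - z * cnj w)"
    have d: "0 < ?d" using z by simp
    show "(\<integral>\<^sup>+ w. ennreal (?k w powr (- 1 - 2 / c) * norm (f w)) \<partial>area) \<le> ennreal ((1 + C) * N / ?d)"
    proof (cases "c = 1")
      \<comment> \<open>Here the dual exponent is \<infinity> and \<open>Lp_norm\<close> is an
        essential supremum, so f is simply replaced by N.\<close>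
      case True
      then have "esssup area (\<lambda>z. ennreal (norm (f z))) \<le> ennreal N"
        using fN by (simp add: dual_exponent_def Lp_norm_def)
      then have "AE w in area. ennreal (norm (f w)) \<le> ennreal N"
        using esssup_AE[of "\<lambda>z. ennreal (norm (f z))" area] by (auto elim!: eventually_mono intro: order_trans)
      then have "AE w in area. norm (f w) \<le> N" using N by simp
      then have "(\<integral>\<^sup>+ w. ennreal (?k w powr (- 1 - 2 / c) * norm (f w)) \<partial>area)
        \<le> (\<integral>\<^sup>+ w. ennreal N * ennreal (?k w powr (- 2 - c)) \<partial>area)"
        using True N by (intro nn_integral_mono_AE)
          (auto elim!: eventually_mono intro!: ennreal_leI mult_left_mono simp: mult.commute[of N] simp flip: ennreal_mult)
      also have "\<dots> = ennreal N * (\<integral>\<^sup>+ w. ennreal (?k w powr (- 2 - c)) \<partial>area)"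
        by (intro nn_integral_cmult) measurable
      also have "\<dots> \<le> ennreal N * ennreal (C * ?d powr - c)"
        by (intro mult_left_mono C z) simp
      also have "\<dots> = ennreal (C * N / ?d)"
        using N C(1) d True by (simp add: powr_minus_divide mult_ac flip: ennreal_mult)
      also have "\<dots> \<le> ennreal ((1 + C) * N / ?d)"
        using N d by (intro ennreal_leI divide_right_mono mult_right_mono) auto
      finally show ?thesis .
    next
      case False
      then have c1: "1 < c" using c by simp
      define p where "p = c / (c - 1)"
      have p: "1 < p" "1 / p + 1 / c = 1" using c1 by (auto simp: p_def field_simps)
      have fin: "Lp_norm (ennreal p) f \<le> ennreal N" using fN False by (simp add: dual_exponent_def p_def)
      then have lt: "Lp_norm (ennreal p) f < \<infinity>" by (auto intro: le_less_trans)
      obtain J where J: "0 \<le> J" "(\<integral>\<^sup>+ z. ennreal (norm (f z) powr p) \<partial>area) = ennreal J"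
        "Lp_norm (ennreal p) f = ennreal (J powr (1 / p))"
        by (rule Lp_norm_finiteD[OF _ lt]) (use p in auto)
      have "J powr (1 / p) \<le> N" using fin J N by simp
      then have "(J powr (1 / p)) powr p \<le> N powr p" using p by (intro powr_mono2) auto
      then have JN: "J \<le> N powr p" using p J(1) by (simp add: powr_powr)
      have pt: "?k w powr (- 1 - 2 / c) * norm (f w)
        \<le> N / ?d * (norm (f w) powr p / N powr p + ?k w powr (- 2 - c) * ?d powr c)" for w
      proof -
        \<comment> \<open>Hoelder via Young: dividing f by N and multiplying the kernel by 1 - |z|
          normalizes both factors so that their integrated powers are bounded by 1 and C.\<close>
        have "(norm (f w) / N) * (?k w powr (- 1 - 2 / c) * ?d)
          \<le> (norm (f w) / N) powr p / p + (?k w powr (- 1 - 2 / c) * ?d) powr c / c"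
          using p c1 N d by (intro Youngs_inequality) auto
        also have "\<dots> \<le> (norm (f w) / N) powr p + (?k w powr (- 1 - 2 / c) * ?d) powr c"
        proof -
          have "x / y \<le> x" if "0 \<le> x" "1 \<le> y" for x y :: real
            using divide_left_mono[of 1 y x] that by simp
          then show ?thesis using p c1 by (intro add_mono) auto
        qed
        also have "(norm (f w) / N) powr p = norm (f w) powr p / N powr p"
          by (intro powr_divide)
        also have "(?k w powr (- 1 - 2 / c) * ?d) powr c = ?k w powr (- 2 - c) * ?d powr c"
        proof -
          have "(- 1 - 2 / c) * c = - 2 - c" using c1 by (simp add: field_simps)
          then show ?thesis using d by (simp add: powr_mult powr_powr)
        qed
        finally have "N / ?d * ((norm (f w) / N) * (?k w powr (- 1 - 2 / c) * ?d))
          \<le> N / ?d * (norm (f w) powr p / N powr p + ?k w powr (- 2 - c) * ?d powr c)"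
          using N d by (intro mult_left_mono) auto
        then show ?thesis using N d by (simp add: mult.commute)
      qed
      have "(\<integral>\<^sup>+ w. ennreal (?k w powr (- 1 - 2 / c) * norm (f w)) \<partial>area)
        \<le> (\<integral>\<^sup>+ w. ennreal (N / ?d) * (ennreal (1 / N powr p) * ennreal (norm (f w) powr p)
            + ennreal (?d powr c) * ennreal (?k w powr (- 2 - c))) \<partial>area)"
      proof (intro nn_integral_mono)
        fix w
        show "ennreal (?k w powr (- 1 - 2 / c) * norm (f w)) \<le> ennreal (N / ?d) * (ennreal (1 / N powr p) * ennreal (norm (f w) powr p)
            + ennreal (?d powr c) * ennreal (?k w powr (- 2 - c)))"
          using ennreal_leI[OF pt[of w]] N d by (simp add: mult.commute[of "?d powr c"] flip: ennreal_mult ennreal_plus)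
      qed
      also have "\<dots> = ennreal (N / ?d) * (ennreal (1 / N powr p) * (\<integral>\<^sup>+ w. ennreal (norm (f w) powr p) \<partial>area)
            + ennreal (?d powr c) * (\<integral>\<^sup>+ w. ennreal (?k w powr (- 2 - c)) \<partial>area))"
        by (simp add: nn_integral_cmult nn_integral_add)
      also have "\<dots> \<le> ennreal (N / ?d) * (ennreal (1 / N powr p) * ennreal (N powr p) + ennreal (?d powr c) * ennreal (C * ?d powr - c))"
        using J(2) JN by (intro mult_left_mono add_mono C(2) z) (auto intro: ennreal_leI)
      also have "ennreal (1 / N powr p) * ennreal (N powr p) = ennreal 1"
        using N by (simp flip: ennreal_mult)
      also have "ennreal (?d powr c) * ennreal (C * ?d powr - c) = ennreal C"
        using d C(1) by (simp add: powr_minus_divide flip: ennreal_mult)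
      also have "ennreal (N / ?d) * (ennreal 1 + ennreal C) = ennreal (N / ?d * (1 + C))"
        using N d C(1) by (subst ennreal_mult) auto
      also have "N / ?d * (1 + C) = (1 + C) * N / ?d" by simp
      finally show ?thesis .
    qed
  qed
qed

text \<open>The size bound alone leaves a logarithmic divergence at this exponent. Integrating
  kernel differences instead gains the factor |z - z'|, and the endpoint integral turns the extra
  power of the kernel into 1/(1 - |z|), which is the Bloch-type hypothesis.\<close>

lemma BMO_bound:
  "bounded_operator (Lp_norm (dual_exponent c)) BMO_norm (shimorin_op \<nu>)"
proof -
  obtain C where C: "C > 0"
    "\<And>f N z. f \<in> borel_measurable area \<Longrightarrow> 0 < N \<Longrightarrow> Lp_norm (dual_exponent c) f \<le> ennreal N \<Longrightarrow> z \<in> unit_disk \<Longrightarrow>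
      (\<integral>\<^sup>+ w. ennreal (norm (1 - z * cnj w) powr (- 1 - 2 / c) * norm (f w)) \<partial>area) \<le> ennreal (C * N / (1 - norm z))"
    using endpoint_integral_bound by blast
  define A where "A = 3 * M * C"
  have A: "0 < A" using M C by (simp add: A_def)
  show ?thesis
    unfolding bounded_operator_def
  proof (intro exI[of _ "48 * A"] conjI ballI)
    show "0 \<le> 48 * A" using A by simp
    fix f assume "f \<in> fun_space (Lp_norm (dual_exponent c))"
    then have f [measurable]: "f \<in> borel_measurable area" and fin: "Lp_norm (dual_exponent c) f < \<infinity>"
      by (auto simp: fun_space_def)
    define J where "J = enn2real (Lp_norm (dual_exponent c) f)"
    have J: "0 \<le> J" "Lp_norm (dual_exponent c) f = ennreal J" using fin by (auto simp: J_def less_top)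
    have [measurable]: "shimorin_op \<nu> f \<in> borel_measurable area" by (rule borel_measurable_shimorin_op[OF f])
    have *: "BMO_norm (shimorin_op \<nu> f) \<le> ennreal (48 * (A * N))" if N: "J \<le> N" "0 < N" for N
    proof (rule BMO_norm_Bloch)
      have fN: "Lp_norm (dual_exponent c) f \<le> ennreal N" using J N by (simp add: ennreal_leI)
      note bd = C(2)[OF f N(2) fN]
      show "0 < A * N" using A N by simp
      \<comment> \<open>Since |1 - z cnj w| \<le> 2, the exponent -2/c may be lowered to -1 - 2/c at
        the cost of a factor 2, so the endpoint integral also gives convergence.\<close>
      have int: "integrable area (\<lambda>w. shimorin_kernel \<nu> z w * f w)" if z: "z \<in> unit_disk" for z
      proof (rule integrableI_bounded)
        show "(\<lambda>w. shimorin_kernel \<nu> z w * f w) \<in> borel_measurable area"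
          using z by measurable
        have "(\<integral>\<^sup>+ w. ennreal (norm (shimorin_kernel \<nu> z w * f w)) \<partial>area)
          \<le> (\<integral>\<^sup>+ w. ennreal (2 * M) * ennreal (norm (1 - z * cnj w) powr (- 1 - 2 / c) * norm (f w)) \<partial>area)"
        proof (intro nn_integral_mono)
          fix w assume "w \<in> space area"
          then have w: "w \<in> unit_disk" by simp
          let ?k = "norm (1 - z * cnj w)"
          have k: "0 < ?k" "?k \<le> 2" using norm_one_minus_pos[OF z w] norm_one_minus_le[OF z w] by auto
          have "?k powr - (2 / c) = ?k powr 1 * ?k powr (- 1 - 2 / c)"
            by (simp only: powr_add[symmetric]) simp
          also have "\<dots> \<le> 2 * ?k powr (- 1 - 2 / c)" using k by (intro mult_right_mono) auto
          finally have "M * ?k powr - (2 / c) \<le> M * (2 * ?k powr (- 1 - 2 / c))"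
            using M by (intro mult_left_mono) auto
          then have "norm (shimorin_kernel \<nu> z w) \<le> 2 * M * ?k powr (- 1 - 2 / c)"
            using norm_kernel_le[OF z w] by simp
          then have "norm (shimorin_kernel \<nu> z w * f w) \<le> 2 * M * ?k powr (- 1 - 2 / c) * norm (f w)"
            unfolding norm_mult by (rule mult_right_mono) simp
          then have "ennreal (norm (shimorin_kernel \<nu> z w * f w)) \<le> ennreal (2 * M * (?k powr (- 1 - 2 / c) * norm (f w)))"
            by (intro ennreal_leI) (simp only: mult.assoc)
          then show "ennreal (norm (shimorin_kernel \<nu> z w * f w)) \<le> ennreal (2 * M) * ennreal (?k powr (- 1 - 2 / c) * norm (f w))"
            using M by (subst ennreal_mult[symmetric]) auto
        qed
        also have "\<dots> = ennreal (2 * M) * (\<integral>\<^sup>+ w. ennreal (norm (1 - z * cnj w) powr (- 1 - 2 / c) * norm (f w)) \<partial>area)"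
          by (intro nn_integral_cmult) measurable
        also have "\<dots> \<le> ennreal (2 * M) * ennreal (C * N / (1 - norm z))"
          by (intro mult_left_mono bd z) simp
        also have "\<dots> < \<infinity>" by (simp add: ennreal_mult_less_top)
        finally show "(\<integral>\<^sup>+ w. ennreal (norm (shimorin_kernel \<nu> z w * f w)) \<partial>area) < \<infinity>" .
      qed
      fix z z' assume z: "z \<in> unit_disk" and z': "z' \<in> unit_disk"
      let ?E = "\<lambda>z w. ennreal (norm (1 - z * cnj w) powr (- 1 - 2 / c) * norm (f w))"
      let ?D = "3 * M * norm (z - z')"
      have "shimorin_op \<nu> f z - shimorin_op \<nu> f z' = (\<integral>w. shimorin_kernel \<nu> z w * f w - shimorin_kernel \<nu> z' w * f w \<partial>area)"
        unfolding shimorin_op_eq by (intro Bochner_Integration.integral_diff[symmetric] int z z')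
      then have "ennreal (norm (shimorin_op \<nu> f z - shimorin_op \<nu> f z'))
          \<le> (\<integral>\<^sup>+ w. ennreal (norm (shimorin_kernel \<nu> z w * f w - shimorin_kernel \<nu> z' w * f w)) \<partial>area)"
        using integral_norm_bound_ennreal[OF Bochner_Integration.integrable_diff[OF int[OF z] int[OF z']]] by simp
      also have "\<dots> \<le> (\<integral>\<^sup>+ w. ennreal ?D * (?E z w + ?E z' w) \<partial>area)"
      proof (intro nn_integral_mono)
        fix w assume "w \<in> space area"
        then have w: "w \<in> unit_disk" by simp
        have "norm (shimorin_kernel \<nu> z w * f w - shimorin_kernel \<nu> z' w * f w)
          = norm (shimorin_kernel \<nu> z w - shimorin_kernel \<nu> z' w) * norm (f w)"
          by (simp only: norm_mult left_diff_distrib[symmetric])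
        also have "\<dots> \<le> ?D * (norm (1 - z * cnj w) powr (- 1 - 2 / c) + norm (1 - z' * cnj w) powr (- 1 - 2 / c)) * norm (f w)"
          by (intro mult_right_mono norm_kernel_diff_le z z' w) simp
        also have "\<dots> = ?D * (norm (1 - z * cnj w) powr (- 1 - 2 / c) * norm (f w) + norm (1 - z' * cnj w) powr (- 1 - 2 / c) * norm (f w))"
          by (simp only: mult.assoc distrib_right)
        finally show "ennreal (norm (shimorin_kernel \<nu> z w * f w - shimorin_kernel \<nu> z' w * f w)) \<le> ennreal ?D * (?E z w + ?E z' w)"
          using M by (simp add: ennreal_leI flip: ennreal_mult ennreal_plus)
      qed
      also have "\<dots> = ennreal ?D * ((\<integral>\<^sup>+ w. ?E z w \<partial>area) + (\<integral>\<^sup>+ w. ?E z' w \<partial>area))"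
        by (simp add: nn_integral_cmult nn_integral_add)
      also have "\<dots> \<le> ennreal ?D * (ennreal (C * N / (1 - norm z)) + ennreal (C * N / (1 - norm z')))"
        by (intro mult_left_mono add_mono bd z z') simp
      also have "\<dots> = ennreal (?D * (C * N / (1 - norm z) + C * N / (1 - norm z')))"
        using M C(1) N z z' by (subst ennreal_plus[symmetric], simp, simp) (intro ennreal_mult[symmetric], auto)
      also have "?D * (C * N / (1 - norm z) + C * N / (1 - norm z')) = A * N * norm (z - z') * (1 / (1 - norm z) + 1 / (1 - norm z'))"
        by (simp add: A_def algebra_simps)
      finally show "norm (shimorin_op \<nu> f z - shimorin_op \<nu> f z') \<le> A * N * norm (z - z') * (1 / (1 - norm z) + 1 / (1 - norm z'))"
        using A N z z' by (subst (asm) ennreal_le_iff) auto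
    qed measurable
    have "BMO_norm (shimorin_op \<nu> f) \<le> ennreal (48 * (A * J))"
    proof (rule ennreal_le_epsilon)
      fix e :: real assume e: "0 < e"
      have "BMO_norm (shimorin_op \<nu> f) \<le> ennreal (48 * (A * (J + e / (48 * A))))"
        using e A J(1) by (intro *) (auto intro: add_nonneg_pos)
      also have "48 * (A * (J + e / (48 * A))) = 48 * (A * J) + e" using A by (simp add: distrib_left)
      finally show "BMO_norm (shimorin_op \<nu> f) \<le> ennreal (48 * (A * J)) + ennreal e"
        using A J(1) e by simp
    qed
    also have "ennreal (48 * (A * J)) = ennreal (48 * A) * Lp_norm (dual_exponent c) f"
      unfolding J(2) using A J(1) by (subst ennreal_mult[symmetric]) auto
    finally show le: "BMO_norm (shimorin_op \<nu> f) \<le> ennreal (48 * A) * Lp_norm (dual_exponent c) f" .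
    then show "shimorin_op \<nu> f \<in> fun_space BMO_norm"
      using fin by (auto simp: fun_space_def ennreal_mult_less_top intro: le_less_trans)
  qed
qed

end

section \<open>Kernel bounds and the measure\<close>

lemma two_div_dual_exponent:
  assumes "1 < c"
  shows "enn2real (2 / dual_exponent c) = 2 - 2 / c"
proof -
  have "2 / dual_exponent c = ennreal 2 / ennreal (c / (c - 1))"
    using assms by (simp add: dual_exponent_def)
  also have "\<dots> = ennreal (2 / (c / (c - 1)))"
    using assms by (intro divide_ennreal) auto
  also have "2 / (c / (c - 1)) = 2 - 2 / c"
    using assms by (simp add: field_simps)
  finally show ?thesis using assms by (simp add: field_simps)
qed

text \<open>A layer-cake formula: after interchanging integrals, the \<nu>-integral of 1/((1-r) + s)
  becomes an integral over u of \<nu>-masses of the sets 1 - r \<le> u - s. The second part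
  evaluates the integral that remains.\<close>

lemma inverse_eq_nn_integral_tail:
  assumes "0 < (x::real)"
  shows "ennreal (1 / x) = (\<integral>\<^sup>+ u. ennreal (if x \<le> u then u powr - 2 else 0) \<partial>lborel)"
    and "0 < \<sigma> \<Longrightarrow> (\<integral>\<^sup>+ u. ennreal (if x \<le> u then u powr (- 1 - \<sigma>) else 0) \<partial>lborel) = ennreal (x powr - \<sigma> / \<sigma>)"
proof -
  show tail: "(\<integral>\<^sup>+ u. ennreal (if x \<le> u then u powr (- 1 - \<sigma>) else 0) \<partial>lborel) = ennreal (x powr - \<sigma> / \<sigma>)"
    if "0 < \<sigma>" for \<sigma>
  proof -
    have "((\<lambda>u. u powr - \<sigma>) \<longlongrightarrow> 0) at_top"
      using that by (intro tendsto_neg_powr filterlim_ident) auto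
    then have "((\<lambda>u. - (u powr - \<sigma>) / \<sigma>) \<longlongrightarrow> 0) at_top"
      using tendsto_divide[OF tendsto_minus tendsto_const[of \<sigma>]] that by force
    then have "(\<integral>\<^sup>+ u. ennreal (u powr (- 1 - \<sigma>)) * indicator {x..} u \<partial>lborel) = ennreal (0 - (- (x powr - \<sigma>) / \<sigma>))"
      by (intro nn_integral_FTC_atLeast)
        (use assms that in \<open>auto intro!: derivative_eq_intros simp: field_simps minus_diff_commute\<close>)
    moreover have "ennreal (u powr (- 1 - \<sigma>)) * indicator {x..} u = ennreal (if x \<le> u then u powr (- 1 - \<sigma>) else 0)" for u
      by (simp add: indicator_def)
    ultimately show ?thesis by simp
  qed
  show "ennreal (1 / x) = (\<integral>\<^sup>+ u. ennreal (if x \<le> u then u powr - 2 else 0) \<partial>lborel)"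
  proof -
    have e: "- 1 - 1 = (- 2 :: real)" by simp
    show ?thesis using tail[of 1, unfolded e] assms by (simp add: powr_minus_divide)
  qed
qed

context unit_interval_measure
begin

text \<open>The convention that \<open>ennpow x 0\<close> is 1 makes the integrand constantly 1,
  also at r = 1. The set in the critical index is thus nonempty, as its supremum requires.\<close>

lemma finite_at_one:
  "1 \<in> {c. 1 \<le> c \<and> c < 2 \<and> (\<integral>\<^sup>+ r. 1 / ennpow (1 - r\<^sup>2) (enn2real (2 / dual_exponent c)) \<partial>\<nu>) < \<infinity>}"
  by (simp add: dual_exponent_def ennpow_def emeasure_eq_measure)

lemma critical_index_bounds: "1 \<le> critical_index \<nu>" "critical_index \<nu> \<le> 2"
proof -
  have bdd: "bdd_above {c. 1 \<le> c \<and> c < 2 \<and> (\<integral>\<^sup>+ r. 1 / ennpow (1 - r\<^sup>2) (enn2real (2 / dual_exponent c)) \<partial>\<nu>) < \<infinity>}"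
    by (rule bdd_aboveI[of _ 2]) auto
  show "1 \<le> critical_index \<nu>"
    unfolding critical_index_def by (intro cSup_upper finite_at_one bdd)
  show "critical_index \<nu> \<le> 2"
    unfolding critical_index_def by (rule cSup_least) (use finite_at_one in blast, auto)
qed

text \<open>Some exponent above 1 has a finite defining integral, and for it the integrand at r = 1
  is 1 / 0 = \<infinity>.\<close>

lemma no_atom_at_one:
  assumes "1 < critical_index \<nu>"
  shows "emeasure \<nu> {1} = 0"
proof -
  obtain c where c: "1 < c" "(\<integral>\<^sup>+ r. 1 / ennpow (1 - r\<^sup>2) (enn2real (2 / dual_exponent c)) \<partial>\<nu>) < \<infinity>"
    using less_cSupE[OF assms[unfolded critical_index_def]] finite_at_one by blast
  have a: "enn2real (2 / dual_exponent c) \<noteq> 0"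
    unfolding two_div_dual_exponent[OF c(1)] using c(1) by (simp add: field_simps)
  have s: "{1} \<in> sets \<nu>" unfolding sets_\<nu> by (subst sets_restrict_space_iff) auto
  have "top * emeasure \<nu> {1} = (\<integral>\<^sup>+ r. top * indicator {1} r \<partial>\<nu>)"
    by (intro nn_integral_cmult_indicator[symmetric] s)
  also have "\<dots> \<le> (\<integral>\<^sup>+ r. 1 / ennpow (1 - r\<^sup>2) (enn2real (2 / dual_exponent c)) \<partial>\<nu>)"
    using a by (intro nn_integral_mono) (auto simp: indicator_def ennpow_def)
  finally have "top * emeasure \<nu> {1} < \<infinity>" using c(2) by (rule le_less_trans)
  then show ?thesis by (auto simp: ennreal_mult_less_top)
qed

text \<open>Up to the factor 3, |1 - r \<zeta>| is at least (1 - r) + |1 - \<zeta>|, so only s = |1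
  - \<zeta>|, a number in (0,2], has to be considered.\<close>

lemma bounded_shimorin_kernelI:
  assumes "1 \<le> c" "c \<le> 2" "0 < M"
    and I: "\<And>s. 0 < s \<Longrightarrow> s \<le> 2 \<Longrightarrow> (\<integral>\<^sup>+ r. ennreal (1 / ((1 - r) + s)) \<partial>\<nu>) \<le> ennreal (M * s powr (1 - 2 / c))"
  shows "bounded_shimorin_kernel \<nu> c (3 * M)"
proof
  show "1 \<le> c" "c \<le> 2" "0 < 3 * M" using assms by auto
  fix \<zeta> :: complex assume \<zeta>: "norm \<zeta> < 1"
  let ?s = "norm (1 - \<zeta>)"
  have s: "0 < ?s" "?s \<le> 2"
    using \<zeta> norm_triangle_ineq2[of 1 \<zeta>] norm_triangle_ineq4[of 1 \<zeta>] by (simp_all del: zero_less_norm_iff)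
  have "(\<integral>\<^sup>+ r. ennreal (1 / norm (1 - of_real r * \<zeta>)) \<partial>\<nu>) \<le> (\<integral>\<^sup>+ r. ennreal 3 * ennreal (1 / ((1 - r) + ?s)) \<partial>\<nu>)"
  proof (intro nn_integral_mono)
    fix r assume "r \<in> space \<nu>"
    then have r: "0 \<le> r" "r \<le> 1" by (auto simp: space_\<nu>)
    note b = norm_one_minus_scaled_ge[OF \<zeta> r]
    have pos: "0 < (1 - r) + ?s" using r(2) s(1) by linarith
    have "1 / norm (1 - of_real r * \<zeta>) \<le> 1 / (((1 - r) + ?s) / 3)"
      using b(1) pos by (intro frac_le) auto
    then have "1 / norm (1 - of_real r * \<zeta>) \<le> 3 * (1 / ((1 - r) + ?s))" by simp
    then show "ennreal (1 / norm (1 - of_real r * \<zeta>)) \<le> ennreal 3 * ennreal (1 / ((1 - r) + ?s))"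
      using pos by (subst ennreal_mult[symmetric]) (auto intro: ennreal_leI)
  qed
  also have "\<dots> = ennreal 3 * (\<integral>\<^sup>+ r. ennreal (1 / ((1 - r) + ?s)) \<partial>\<nu>)"
    by (intro nn_integral_cmult borel_measurable_\<nu>) measurable
  also have "\<dots> \<le> ennreal 3 * ennreal (M * ?s powr (1 - 2 / c))"
    by (intro mult_left_mono I s) simp
  also have "\<dots> = ennreal (3 * M * ?s powr (1 - 2 / c))"
    using assms by (subst ennreal_mult[symmetric]) auto
  finally show "(\<integral>\<^sup>+ r. ennreal (1 / norm (1 - of_real r * \<zeta>)) \<partial>\<nu>) \<le> ennreal (3 * M * ?s powr (1 - 2 / c))" .
qed

text \<open>For c = 1 the exponent 1 - 2/c is -1, and dropping 1 - r from the denominator suffices.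
  The added 1 keeps the constant positive for the zero measure.\<close>

lemma bounded_kernel_one: "bounded_shimorin_kernel \<nu> 1 (3 * (measure \<nu> (space \<nu>) + 1))"
proof (rule bounded_shimorin_kernelI)
  show "0 < measure \<nu> (space \<nu>) + 1" using measure_nonneg[of \<nu> "space \<nu>"] by linarith
  fix s :: real assume s: "0 < s"
  have "(\<integral>\<^sup>+ r. ennreal (1 / ((1 - r) + s)) \<partial>\<nu>) \<le> (\<integral>\<^sup>+ r. ennreal (1 / s) \<partial>\<nu>)"
    using s by (intro nn_integral_mono ennreal_leI frac_le) (auto simp: space_\<nu>)
  also have "\<dots> = ennreal (1 / s * measure \<nu> (space \<nu>))"
    using s by (simp add: emeasure_eq_measure flip: ennreal_mult)
  also have "\<dots> \<le> ennreal ((measure \<nu> (space \<nu>) + 1) * s powr (1 - 2 / 1))"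
    using s by (intro ennreal_leI) (simp add: powr_minus_divide field_simps)
  finally show "(\<integral>\<^sup>+ r. ennreal (1 / ((1 - r) + s)) \<partial>\<nu>) \<le> ennreal ((measure \<nu> (space \<nu>) + 1) * s powr (1 - 2 / 1))" .
qed auto

lemma bounded_kernel_two:
  assumes atom: "emeasure \<nu> {1} = 0"
    and fin: "(\<integral>\<^sup>+ r\<in>{0..<1}. ennreal (1 / (1 - r\<^sup>2)) \<partial>\<nu>) < \<infinity>"
  obtains M where "bounded_shimorin_kernel \<nu> 2 M"
proof -
  define L where "L = enn2real (\<integral>\<^sup>+ r\<in>{0..<1}. ennreal (1 / (1 - r\<^sup>2)) \<partial>\<nu>)"
  have L: "0 \<le> L" "(\<integral>\<^sup>+ r\<in>{0..<1}. ennreal (1 / (1 - r\<^sup>2)) \<partial>\<nu>) = ennreal L"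
    using fin by (auto simp: L_def less_top)
  have s1: "{1} \<in> sets \<nu>" unfolding sets_\<nu> by (subst sets_restrict_space_iff) auto
  then have "AE r in \<nu>. r \<noteq> 1" using atom by (intro AE_I[of _ _ "{1}"]) auto
  have "bounded_shimorin_kernel \<nu> 2 (3 * (2 * L + 1))"
  proof (rule bounded_shimorin_kernelI)
    show "0 < 2 * L + 1" using L by simp
    fix s :: real assume s: "0 < s"
    have "(\<integral>\<^sup>+ r. ennreal (1 / ((1 - r) + s)) \<partial>\<nu>) \<le> (\<integral>\<^sup>+ r. ennreal 2 * (ennreal (1 / (1 - r\<^sup>2)) * indicator {0..<1} r) \<partial>\<nu>)"
    proof (intro nn_integral_mono_AE)
      show "AE r in \<nu>. ennreal (1 / ((1 - r) + s)) \<le> ennreal 2 * (ennreal (1 / (1 - r\<^sup>2)) * indicator {0..<1} r)"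
        using \<open>AE r in \<nu>. r \<noteq> 1\<close> AE_space
      proof eventually_elim
        fix r assume "r \<noteq> 1" "r \<in> space \<nu>"
        then have r: "0 \<le> r" "r < 1" by (auto simp: space_\<nu>)
        then have r2: "0 < 1 - r\<^sup>2" by (simp add: power_less_one_iff)
        have "(1 - r\<^sup>2) / 2 = (1 - r) * ((1 + r) / 2)" by (simp add: power2_eq_square field_simps)
        also have "\<dots> \<le> (1 - r) * 1" using r by (intro mult_left_mono) auto
        finally have "1 / ((1 - r) + s) \<le> 1 / ((1 - r\<^sup>2) / 2)"
          using r2 s by (intro frac_le) auto
        also have "\<dots> = 2 * (1 / (1 - r\<^sup>2))" by simp
        finally have "ennreal (1 / ((1 - r) + s)) \<le> ennreal (2 * (1 / (1 - r\<^sup>2)))" by (rule ennreal_leI)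
        also have "\<dots> = ennreal 2 * ennreal (1 / (1 - r\<^sup>2))" using r2 by (intro ennreal_mult) auto
        finally show "ennreal (1 / ((1 - r) + s)) \<le> ennreal 2 * (ennreal (1 / (1 - r\<^sup>2)) * indicator {0..<1} r)"
          using r by simp
      qed
    qed
    also have "\<dots> = ennreal 2 * ennreal L"
      unfolding L(2)[symmetric] by (intro nn_integral_cmult borel_measurable_\<nu>) measurable
    also have "\<dots> = ennreal (2 * L)" using L by (intro ennreal_mult[symmetric]) auto
    also have "\<dots> \<le> ennreal ((2 * L + 1) * s powr (1 - 2 / 2))" using s by (intro ennreal_leI) simp
    finally show "(\<integral>\<^sup>+ r. ennreal (1 / ((1 - r) + s)) \<partial>\<nu>) \<le> ennreal ((2 * L + 1) * s powr (1 - 2 / 2))" .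
  qed auto
  then show ?thesis by (rule that)
qed

text \<open>The layer-cake formula and the bound on the masses lead to the integral of u^(a-2) over
  u \<ge> s, with a = 2 - 2/c. It converges at infinity exactly because a < 1, that is c < 2; the
  factor 1/(2/c - 1) in the constant blows up at c = 2.\<close>

lemma bounded_kernel_between:
  assumes c: "1 < c" "c < 2" and atom: "emeasure \<nu> {1} = 0" and M: "0 < M"
    and Carleson: "\<And>t. 0 < t \<Longrightarrow> t \<le> 1 \<Longrightarrow> emeasure \<nu> {1 - t..<1} \<le> ennreal (M * t powr (2 - 2 / c))"
  shows "bounded_shimorin_kernel \<nu> c (3 * (M / (2 / c - 1)))"
proof (rule bounded_shimorin_kernelI)
  define a where "a = 2 - 2 / c"
  have a: "0 < a" "a < 1" using c by (auto simp: a_def field_simps)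
  show "0 < M / (2 / c - 1)" using M a by (simp add: a_def)
  have s1: "{1} \<in> sets \<nu>" unfolding sets_\<nu> by (subst sets_restrict_space_iff) auto
  \<comment> \<open>The level set contains the point 1, which has measure 0 by assumption. For t > 1
    it is all of [0,1], so the bound at t = 1 is enlarged.\<close>
  have level: "emeasure \<nu> {r \<in> space \<nu>. 1 - r \<le> t} \<le> ennreal (M * t powr a)" if t: "0 < t" for t
  proof -
    let ?t = "min t 1"
    have m: "{1 - ?t..<1} \<in> sets \<nu>" unfolding sets_\<nu> by (subst sets_restrict_space_iff) auto
    have "{r \<in> space \<nu>. 1 - r \<le> t} \<subseteq> {1 - ?t..<1} \<union> {1}" by (auto simp: space_\<nu>)
    then have "emeasure \<nu> {r \<in> space \<nu>. 1 - r \<le> t} \<le> emeasure \<nu> ({1 - ?t..<1} \<union> {1})"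
      by (intro emeasure_mono sets.Un m s1)
    also have "\<dots> \<le> emeasure \<nu> {1 - ?t..<1} + emeasure \<nu> {1}" by (intro emeasure_subadditive m s1)
    also have "\<dots> \<le> ennreal (M * ?t powr a)" using Carleson[of ?t] t by (simp add: atom a_def)
    also have "\<dots> \<le> ennreal (M * t powr a)"
      using t M a by (intro ennreal_leI mult_left_mono powr_mono2) auto
    finally show ?thesis .
  qed
  fix s :: real assume s: "0 < s"
  interpret pair_sigma_finite \<nu> lborel ..
  have [measurable]: "(\<lambda>x. fst x) \<in> borel_measurable (\<nu> \<Otimes>\<^sub>M (lborel :: real measure))"
    by (rule measurable_compose[OF measurable_fst borel_measurable_\<nu>]) simp
  have "(\<integral>\<^sup>+ r. ennreal (1 / ((1 - r) + s)) \<partial>\<nu>)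
    = (\<integral>\<^sup>+ r. \<integral>\<^sup>+ u. ennreal (if (1 - r) + s \<le> u then u powr - 2 else 0) \<partial>lborel \<partial>\<nu>)"
    using s by (intro nn_integral_cong inverse_eq_nn_integral_tail(1)) (auto simp: space_\<nu>)
  also have "\<dots> = (\<integral>\<^sup>+ u. \<integral>\<^sup>+ r. ennreal (if (1 - r) + s \<le> u then u powr - 2 else 0) \<partial>\<nu> \<partial>lborel)"
    by (intro Fubini'[symmetric]) (simp add: case_prod_beta')
  also have "\<dots> \<le> (\<integral>\<^sup>+ u. ennreal M * ennreal (if s \<le> u then u powr (- 1 - (1 - a)) else 0) \<partial>lborel)"
  proof (intro nn_integral_mono)
    fix u :: real
    have mset: "{r \<in> space \<nu>. 1 - r \<le> u - s} \<in> sets \<nu>"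
    proof -
      have "(\<lambda>r. r) \<in> borel_measurable \<nu>" by (rule borel_measurable_\<nu>) simp
      then show ?thesis by measurable
    qed
    have eq: "(\<integral>\<^sup>+ r. ennreal (if (1 - r) + s \<le> u then u powr - 2 else 0) \<partial>\<nu>)
      = ennreal (u powr - 2) * emeasure \<nu> {r \<in> space \<nu>. 1 - r \<le> u - s}"
      by (subst nn_integral_cmult_indicator[OF mset, symmetric])
        (intro nn_integral_cong, auto simp: indicator_def)
    have "emeasure \<nu> {r \<in> space \<nu>. 1 - r \<le> u - s} \<le> ennreal (if s \<le> u then M * u powr a else 0)"
    proof (cases u s rule: linorder_cases)
      case less
      then have E: "{r \<in> space \<nu>. 1 - r \<le> u - s} = {}" by (auto simp: space_\<nu>)
      show ?thesis unfolding E by simp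
    next
      case equal
      then have E: "{r \<in> space \<nu>. 1 - r \<le> u - s} = {1}" by (auto simp: space_\<nu>)
      show ?thesis unfolding E atom by simp
    next
      case greater
      then have "emeasure \<nu> {r \<in> space \<nu>. 1 - r \<le> u - s} \<le> ennreal (M * (u - s) powr a)"
        by (intro level) simp
      also have "\<dots> \<le> ennreal (M * u powr a)"
        using M a s greater by (intro ennreal_leI mult_left_mono powr_mono2) auto
      finally show ?thesis using greater by simp
    qed
    then have "ennreal (u powr - 2) * emeasure \<nu> {r \<in> space \<nu>. 1 - r \<le> u - s}
      \<le> ennreal (u powr - 2) * ennreal (if s \<le> u then M * u powr a else 0)"
      by (rule mult_left_mono) simp
    also have "\<dots> = ennreal M * ennreal (if s \<le> u then u powr (- 1 - (1 - a)) else 0)"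
    proof (cases "s \<le> u")
      case True
      have "u powr - 2 * u powr a = u powr (- 1 - (1 - a))"
        by (simp only: powr_add[symmetric]) simp
      then have "u powr - 2 * (M * u powr a) = M * u powr (- 1 - (1 - a))"
        by (metis mult.left_commute)
      then show ?thesis using True M
        by (simp del: powr_minus add: ennreal_mult[symmetric])
    qed simp
    finally show "(\<integral>\<^sup>+ r. ennreal (if (1 - r) + s \<le> u then u powr - 2 else 0) \<partial>\<nu>)
      \<le> ennreal M * ennreal (if s \<le> u then u powr (- 1 - (1 - a)) else 0)"
      unfolding eq .
  qed
  also have "\<dots> = ennreal M * (\<integral>\<^sup>+ u. ennreal (if s \<le> u then u powr (- 1 - (1 - a)) else 0) \<partial>lborel)"
    by (intro nn_integral_cmult) measurable
  also have "\<dots> = ennreal M * ennreal (s powr - (1 - a) / (1 - a))"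
    using a s by (subst inverse_eq_nn_integral_tail(2)) auto
  also have "\<dots> = ennreal (M * (s powr - (1 - a) / (1 - a)))"
    using M a by (intro ennreal_mult[symmetric]) auto
  also have "M * (s powr - (1 - a) / (1 - a)) = M / (2 / c - 1) * s powr (1 - 2 / c)"
    by (simp add: a_def)
  finally show "(\<integral>\<^sup>+ r. ennreal (1 / ((1 - r) + s)) \<partial>\<nu>) \<le> ennreal (M / (2 / c - 1) * s powr (1 - 2 / c))" .
qed (use c in auto)

end

section \<open>A lower bound for the kernel near the boundary point 1\<close>

lemma Re_inverse_one_plus_ge:
  fixes q :: complex
  assumes "norm q \<le> 1 / 3"
  shows "1 / 4 \<le> Re (1 / (1 + q))"
proof -
  have n: "norm (1 + q) \<le> 4 / 3" using norm_triangle_ineq[of 1 q] assms by simp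
  have r: "2 / 3 \<le> Re (1 + q)" using abs_Re_le_cmod[of q] assms by simp
  have "1 + q \<noteq> 0"
  proof
    assume "1 + q = 0"
    with r show False by (simp del: plus_complex.sel)
  qed
  have "(norm (1 + q))\<^sup>2 \<le> (4 / 3)\<^sup>2" using n by (intro power_mono) auto
  then have "(2 / 3) / (4 / 3)\<^sup>2 \<le> Re (1 + q) / (norm (1 + q))\<^sup>2"
    using r \<open>1 + q \<noteq> 0\<close> by (intro frac_le) (auto simp del: plus_complex.sel)
  also have "\<dots> = Re (1 / (1 + q))"
    by (simp add: Re_divide cmod_power2 del: plus_complex.sel)
  finally show ?thesis by (simp add: power2_eq_square)
qed

text \<open>At the centre x = 1 - \<delta> the two denominators are the positive numbers a = 1 - x^2
  and b = 1 - r x^2. The radius \<delta>/16 perturbs z cnj w by at most 7/50 \<delta>, hence each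
  denominator by a relative error of at most 7/50, and the product by less than 1/3. With a \<le> 2
  \<delta>, b \<le> 2 ((1 - r) + \<delta>) and the factor 1/4 this gives 1/16. Uniformity in r
  prevents cancellation when \<nu> is integrated.\<close>

lemma Re_product_kernel_ge:
  fixes \<delta> r :: real and z w :: complex
  assumes \<delta>: "0 < \<delta>" "\<delta> \<le> 1" and r: "0 \<le> r" "r \<le> 1"
    and z: "z \<in> ball (of_real (1 - \<delta>)) (\<delta> / 16)" and w: "w \<in> ball (of_real (1 - \<delta>)) (\<delta> / 16)"
  shows "1 / (16 * \<delta>) * (1 / ((1 - r) + \<delta>)) \<le> Re (1 / (1 - z * cnj w) * (1 / (1 - of_real r * (z * cnj w))))"
proof -
  define x where "x = 1 - \<delta>"
  have x: "0 \<le> x" "x \<le> 1" using \<delta> by (auto simp: x_def)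
  define h where "h = z - of_real x"
  define k where "k = cnj w - of_real x"
  have hk: "norm h < \<delta> / 16" "norm k < \<delta> / 16"
  proof -
    show "norm h < \<delta> / 16" using z by (simp add: h_def x_def dist_norm norm_minus_commute)
    have "k = cnj (w - of_real x)" by (simp add: k_def)
    then have "norm k = norm (w - of_real x)" by (simp only: complex_mod_cnj)
    then show "norm k < \<delta> / 16" using w by (simp add: x_def dist_norm norm_minus_commute)
  qed
  define e where "e = of_real x * (h + k) + h * k"
  have zw: "z * cnj w = of_real (x\<^sup>2) + e"
    by (simp add: e_def h_def k_def power2_eq_square algebra_simps)
  have "norm e \<le> x * (norm h + norm k) + norm h * norm k"
    unfolding e_def using x
    by (intro order_trans[OF norm_triangle_ineq] add_mono)
      (auto simp: norm_mult intro!: mult_left_mono norm_triangle_ineq)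
  also have "\<dots> \<le> 1 * (\<delta> / 16 + \<delta> / 16) + \<delta> / 16 * (1 / 16)"
    using x hk \<delta> by (intro add_mono mult_mono) auto
  finally have e: "norm e \<le> 7 / 50 * \<delta>" using \<delta>(1) by simp
  define a where "a = 1 - x\<^sup>2"
  define b where "b = 1 - r * x\<^sup>2"
  have "a = \<delta> * (2 - \<delta>)" by (simp add: a_def x_def power2_eq_square algebra_simps)
  then have a: "\<delta> \<le> a" "a \<le> 2 * \<delta>" using \<delta> by (simp_all add: mult_le_cancel_left1)
  have b_eq: "b = (1 - r) + r * a" by (simp add: a_def b_def algebra_simps)
  have "r * a \<le> 1 * a" using r a \<delta> by (intro mult_right_mono) auto
  then have b2: "b \<le> 2 * ((1 - r) + \<delta>)" using b_eq a r by simp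
  have "r * x\<^sup>2 \<le> 1 * x\<^sup>2" using r by (intro mult_right_mono) auto
  then have b1: "\<delta> \<le> b" using a by (simp add: a_def b_def)
  define u where "u = - e / of_real a"
  define v where "v = - of_real r * e / of_real b"
  have u: "norm u \<le> 7 / 50"
  proof -
    have "norm u = norm e / a" using a \<delta> by (simp add: u_def norm_divide)
    also have "\<dots> \<le> (7 / 50 * \<delta>) / \<delta>" using e a \<delta> by (intro frac_le) auto
    finally show ?thesis using \<delta> by simp
  qed
  have v: "norm v \<le> 7 / 50"
  proof -
    have "norm v = r * norm e / b" using b1 \<delta> r by (simp add: v_def norm_divide norm_mult)
    also have "\<dots> \<le> (7 / 50 * \<delta>) / \<delta>"
      using e b1 \<delta> r mult_mono[of r 1 "norm e" "7 / 50 * \<delta>"] by (intro frac_le) auto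
    finally show ?thesis using \<delta> by simp
  qed
  define q where "q = u + v + u * v"
  have "norm q \<le> norm u + norm v + norm u * norm v"
    unfolding q_def by (intro order_trans[OF norm_triangle_ineq] add_mono) (auto simp: norm_mult norm_triangle_ineq)
  also have "\<dots> \<le> 7 / 50 + 7 / 50 + 7 / 50 * (7 / 50)"
    using u v by (intro add_mono mult_mono) auto
  finally have q: "1 / 4 \<le> Re (1 / (1 + q))" by (intro Re_inverse_one_plus_ge) simp
  have a1: "1 - z * cnj w = of_real a * (1 + u)"
  proof -
    have "of_real a * u = - e" using a \<delta> by (simp add: u_def)
    then have "of_real a * (1 + u) = of_real a - e" by (simp add: distrib_left)
    then show ?thesis by (simp add: zw a_def)
  qed
  have b1': "1 - of_real r * (z * cnj w) = of_real b * (1 + v)"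
  proof -
    have "of_real b * v = - of_real r * e" using b1 \<delta> by (simp add: v_def)
    then have "of_real b * (1 + v) = of_real b - of_real r * e" by (simp add: distrib_left)
    then show ?thesis by (simp add: zw b_def distrib_left)
  qed
  have "1 / (1 - z * cnj w) * (1 / (1 - of_real r * (z * cnj w))) = of_real (1 / (a * b)) * (1 / (1 + q))"
    unfolding a1 b1' q_def by (simp add: algebra_simps)
  then have "Re (1 / (1 - z * cnj w) * (1 / (1 - of_real r * (z * cnj w)))) = 1 / (a * b) * Re (1 / (1 + q))"
    by (simp only: Re_complex_of_real times_complex.sel Im_complex_of_real)
  also have "1 / (a * b) * (1 / 4) \<le> \<dots>"
    using a b1 \<delta> q by (intro mult_left_mono) auto
  finally have 1: "1 / (a * b) * (1 / 4) \<le> Re (1 / (1 - z * cnj w) * (1 / (1 - of_real r * (z * cnj w))))" .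
  have "a * b \<le> (2 * \<delta>) * (2 * ((1 - r) + \<delta>))"
    using a b1 b2 \<delta> by (intro mult_mono) auto
  then have "1 / ((2 * \<delta>) * (2 * ((1 - r) + \<delta>))) \<le> 1 / (a * b)"
    using a b1 \<delta> by (intro frac_le mult_pos_pos) auto
  then have "1 / ((2 * \<delta>) * (2 * ((1 - r) + \<delta>))) * (1 / 4) \<le> 1 / (a * b) * (1 / 4)"
    by (rule mult_right_mono) simp
  moreover have "1 / (16 * \<delta>) * (1 / X) = 1 / ((2 * \<delta>) * (2 * X)) * (1 / 4)" for X :: real
    by simp
  ultimately have "1 / (16 * \<delta>) * (1 / ((1 - r) + \<delta>)) \<le> 1 / (a * b) * (1 / 4)"
    by (simp only:)
  with 1 show ?thesis by (rule order_trans[rotated])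
qed

section \<open>Necessity and the characterization\<close>

context unit_interval_measure
begin

text \<open>Testing the weak type estimate on the indicator of a disk \<open>B\<close> of radius comparable to its
  distance \<open>\<delta>\<close> from the boundary point 1: on \<open>B \<times> B\<close> both factors of the kernel are nearly positive,
  so there is no cancellation.\<close>

lemma weak_type_necessary:
  assumes c: "1 \<le> c" and bdd: "bounded_operator (Lp_norm 1) (weak_Lp_norm c) (shimorin_op \<nu>)"
  obtains C where "C > 0"
    "\<And>\<delta>. 0 < \<delta> \<Longrightarrow> \<delta> \<le> 1 \<Longrightarrow> (\<integral>\<^sup>+ r. ennreal (1 / ((1 - r) + \<delta>)) \<partial>\<nu>) \<le> ennreal (C * \<delta> powr (1 - 2 / c))"
proof -
  \<comment> \<open>Used only qualitatively, for measurability and convergence; its constant does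
    not enter the final bound.\<close>
  interpret one: bounded_shimorin_kernel \<nu> 1 "3 * (measure \<nu> (space \<nu>) + 1)" by (rule bounded_kernel_one)
  obtain C\<^sub>0 where C0: "0 \<le> C\<^sub>0" "\<And>f. f \<in> fun_space (Lp_norm 1) \<Longrightarrow>
      weak_Lp_norm c (shimorin_op \<nu> f) \<le> ennreal C\<^sub>0 * Lp_norm 1 f"
    using bdd unfolding bounded_operator_def by blast
  show ?thesis
  \<comment> \<open>8192 = 32 * 256: the kernel bound contributes 16, halving the level in t
    contributes 2, and the area of the test disk contributes at most 16^2.\<close>
  proof (rule that[of "8192 * (C\<^sub>0 + 1)"])
    show "0 < 8192 * (C\<^sub>0 + 1)" using C0(1) by simp
    fix \<delta> :: real assume \<delta>: "0 < \<delta>" "\<delta> \<le> 1"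
    define B :: "complex set" where "B = ball (of_real (1 - \<delta>)) (\<delta> / 16)"
    define m where "m = (\<delta> / 16)\<^sup>2"
    define I where "I = (\<integral>r. 1 / ((1 - r) + \<delta>) \<partial>\<nu>)"
    have m: "0 < m" using \<delta> by (simp add: m_def)
    have Bsub: "B \<subseteq> unit_disk"
    proof
      fix z assume "z \<in> B"
      then have "norm (of_real (1 - \<delta>) - z) < \<delta> / 16" by (simp add: B_def dist_norm)
      moreover have "norm z \<le> norm (of_real (1 - \<delta>) :: complex) + norm (of_real (1 - \<delta>) - z)"
        by (metis norm_minus_commute norm_triangle_sub)
      moreover have "norm (of_real (1 - \<delta>) :: complex) = 1 - \<delta>" using \<delta> by (simp only: norm_of_real abs_of_nonneg)
      ultimately show "z \<in> unit_disk" using \<delta> by simp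
    qed
    have mB: "emeasure area B = ennreal m"
      using emeasure_area_ball[OF _ Bsub[unfolded B_def]] \<delta> by (simp add: B_def m_def)
    have [measurable]: "B \<in> sets area"
      using borel_subset_area[of B] Bsub by (simp add: B_def Int_absorb2)
    have mid: "(\<lambda>r. 1 / ((1 - r) + \<delta>)) \<in> borel_measurable \<nu>"
      by (rule borel_measurable_\<nu>) measurable
    have nn: "0 \<le> 1 / ((1 - r) + \<delta>)" "1 / ((1 - r) + \<delta>) \<le> 1 / \<delta>" if "r \<in> space \<nu>" for r
      using that \<delta> by (auto simp: space_\<nu> intro!: frac_le)
    have intI: "integrable \<nu> (\<lambda>r. 1 / ((1 - r) + \<delta>))"
      by (rule integrable_const_bound[where B = "1 / \<delta>"])
        (use nn mid in \<open>auto intro!: AE_I2\<close>)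
    have I_eq: "(\<integral>\<^sup>+ r. ennreal (1 / ((1 - r) + \<delta>)) \<partial>\<nu>) = ennreal I"
      unfolding I_def by (intro nn_integral_eq_integral intI AE_I2 nn)
    have I0: "0 \<le> I" unfolding I_def by (intro Bochner_Integration.integral_nonneg nn)
    have ReK: "1 / (16 * \<delta>) * I \<le> Re (shimorin_kernel \<nu> z w)" if "z \<in> B" "w \<in> B" for z w
    proof -
      let ?g = "\<lambda>r. 1 / (1 - z * cnj w) * (1 / (1 - of_real r * (z * cnj w)))"
      have \<zeta>: "norm (z * cnj w) < 1" using that Bsub by (intro mult_cnj_in_disk) auto
      have int: "integrable \<nu> ?g" by (intro integrable_mult_right one.integrable_cauchy \<zeta>)
      have "shimorin_kernel \<nu> z w = (\<integral>r. ?g r \<partial>\<nu>)"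
        unfolding shimorin_kernel_def by (simp only: mult.assoc integral_mult_right_zero)
      then have "Re (shimorin_kernel \<nu> z w) = (\<integral>r. Re (?g r) \<partial>\<nu>)"
        using int by (simp only: integral_Re)
      moreover have "1 / (16 * \<delta>) * I = (\<integral>r. 1 / (16 * \<delta>) * (1 / ((1 - r) + \<delta>)) \<partial>\<nu>)"
        unfolding I_def by (simp only: integral_mult_right_zero)
      moreover have "(\<integral>r. 1 / (16 * \<delta>) * (1 / ((1 - r) + \<delta>)) \<partial>\<nu>) \<le> (\<integral>r. Re (?g r) \<partial>\<nu>)"
        using that \<delta> by (intro integral_mono integrable_mult_right intI integrable_Re int Re_product_kernel_ge)
          (auto simp: space_\<nu> B_def)
      ultimately show ?thesis by simp
    qed
    define f :: "complex \<Rightarrow> complex" where "f = indicator B"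
    have f [measurable]: "f \<in> borel_measurable area" by (simp add: f_def)
    have "(\<integral>\<^sup>+ z. ennreal (norm (f z) powr 1) \<partial>area) = (\<integral>\<^sup>+ z. indicator B z \<partial>area)"
      by (intro nn_integral_cong) (simp add: f_def indicator_def)
    then have "(\<integral>\<^sup>+ z. ennreal (norm (f z) powr 1) \<partial>area) \<le> ennreal m" by (simp add: mB)
    then have "Lp_norm (ennreal 1) f \<le> ennreal (m powr (1 / 1))" using m by (intro Lp_norm_le) auto
    then have Lf: "Lp_norm 1 f \<le> ennreal m" using m by simp
    have "f \<in> fun_space (Lp_norm 1)"
      using Lf by (auto simp: fun_space_def intro: le_less_trans)
    then have "weak_Lp_norm c (shimorin_op \<nu> f) \<le> ennreal C\<^sub>0 * ennreal m"
      using C0(2) Lf by (meson mult_left_mono order_trans zero_le)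
    \<comment> \<open>The weak quasi-norm is an infimum; a strict upper bound is needed to extract
      an actual admissible constant \<open>C\<^sub>1\<close>.\<close>
    also have "\<dots> < ennreal ((C\<^sub>0 + 1) * m)"
      using C0(1) m by (simp add: ennreal_mult[symmetric] ennreal_less_iff)
    finally obtain C\<^sub>1 where C1: "0 < C\<^sub>1" "ennreal C\<^sub>1 < ennreal ((C\<^sub>0 + 1) * m)"
      "\<And>t. 0 < t \<Longrightarrow> emeasure area {z \<in> unit_disk. norm (shimorin_op \<nu> f z) > t} \<le> ennreal (C\<^sub>1 powr c / t powr c)"
      unfolding weak_Lp_norm_def Inf_less_iff by auto
    have C1': "C\<^sub>1 \<le> (C\<^sub>0 + 1) * m" using C1(1,2) by (simp add: ennreal_less_iff)
    have T_ge: "I / (16 * \<delta>) * m \<le> norm (shimorin_op \<nu> f z)" if z: "z \<in> B" for z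
    proof -
      have zD: "z \<in> unit_disk" using z Bsub by auto
      note [measurable] = one.borel_measurable_kernel_snd[OF zD]
      have int: "integrable area (\<lambda>w. shimorin_kernel \<nu> z w * f w)"
      proof (rule area.integrable_const_bound)
        let ?M = "3 * (measure \<nu> (space \<nu>) + 1)"
        show "AE w in area. norm (shimorin_kernel \<nu> z w * f w) \<le> ?M * (1 - norm z) powr - 2"
        proof (rule AE_area_in_disk)
          fix w assume w: "w \<in> unit_disk"
          have "norm (shimorin_kernel \<nu> z w * f w) \<le> norm (shimorin_kernel \<nu> z w)"
            by (simp add: f_def indicator_def)
          also have "\<dots> \<le> ?M * norm (1 - z * cnj w) powr - (2 / 1)" by (rule one.norm_kernel_le[OF zD w])
          also have "\<dots> \<le> ?M * (1 - norm z) powr - (2 / 1)"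
            using one.M zD norm_one_minus_ge[OF w, of z] by (intro mult_left_mono powr_mono2') auto
          finally show "norm (shimorin_kernel \<nu> z w * f w) \<le> ?M * (1 - norm z) powr - 2" by simp
        qed
      qed measurable
      have "I / (16 * \<delta>) * m = (\<integral>w. I / (16 * \<delta>) * indicator B w \<partial>area)"
        using m mB by (simp add: measure_def Int_absorb2[OF Bsub])
      also have "\<dots> \<le> (\<integral>w. Re (shimorin_kernel \<nu> z w * f w) \<partial>area)"
      proof (intro integral_mono integrable_Re int integrable_mult_right)
        show "integrable area (indicator B :: complex \<Rightarrow> real)" by (simp add: mB)
        show "I / (16 * \<delta>) * indicator B w \<le> Re (shimorin_kernel \<nu> z w * f w)" for w
          using ReK[OF z, of w] by (simp add: f_def indicator_def)
      qed
      also have "\<dots> = Re (shimorin_op \<nu> f z)"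
        unfolding shimorin_op_eq by (intro integral_Re int)
      also have "\<dots> \<le> norm (shimorin_op \<nu> f z)" by (rule complex_Re_le_cmod)
      finally show ?thesis .
    qed
    have "I \<le> 8192 * (C\<^sub>0 + 1) * \<delta> powr (1 - 2 / c)"
    proof (cases "I = 0")
      case True
      then show ?thesis using C0(1) by simp
    next
      case False
      then have I1: "0 < I" using I0 by simp
      \<comment> \<open>Half of the lower bound for |T f| on B, because the level set is defined by
        a strict inequality.\<close>
      define t where "t = I / (16 * \<delta>) * m / 2"
      have t: "0 < t" using I1 \<delta> m by (simp add: t_def)
      have T_meas [measurable]: "shimorin_op \<nu> f \<in> borel_measurable area"
        by (rule one.borel_measurable_shimorin_op[OF f])
      have "{z \<in> unit_disk. norm (shimorin_op \<nu> f z) > t} = {z \<in> space area. norm (shimorin_op \<nu> f z) > t}"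
        by simp
      also have "\<dots> \<in> sets area" by measurable
      finally have lev: "{z \<in> unit_disk. norm (shimorin_op \<nu> f z) > t} \<in> sets area" .
      have "t < I / (16 * \<delta>) * m" using t by (simp add: t_def)
      then have "B \<subseteq> {z \<in> unit_disk. norm (shimorin_op \<nu> f z) > t}"
        using T_ge Bsub by force
      then have "ennreal m \<le> emeasure area {z \<in> unit_disk. norm (shimorin_op \<nu> f z) > t}"
        unfolding mB[symmetric] by (intro emeasure_mono lev)
      also have "\<dots> \<le> ennreal (C\<^sub>1 powr c / t powr c)" by (rule C1(3)[OF t])
      finally have "m \<le> C\<^sub>1 powr c / t powr c" using m by simp
      also have "\<dots> = (C\<^sub>1 / t) powr c" using C1(1) t by (simp add: powr_divide)
      also have "\<dots> \<le> ((C\<^sub>0 + 1) * m / t) powr c"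
        using C1' C1(1) t c by (intro powr_mono2 divide_right_mono) auto
      finally have "m powr (1 / c) \<le> (((C\<^sub>0 + 1) * m / t) powr c) powr (1 / c)"
        using m c by (intro powr_mono2) auto
      also have "\<dots> = (C\<^sub>0 + 1) * m / t" using c C0(1) m t by (simp add: powr_powr)
      finally have "t * m powr (1 / c) \<le> (C\<^sub>0 + 1) * m" using t by (simp add: field_simps)
      then have "I * m powr (1 / c) * m \<le> 32 * \<delta> * (C\<^sub>0 + 1) * m" using \<delta> by (simp add: t_def field_simps)
      then have "I * m powr (1 / c) \<le> 32 * \<delta> * (C\<^sub>0 + 1)" using m by (rule mult_right_le_imp_le)
      moreover have "\<delta> powr (2 / c) / 256 \<le> m powr (1 / c)"
      proof -
        have "m = (\<delta> / 16) powr 2" using \<delta> by (simp add: m_def)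
        then have "m powr (1 / c) = (\<delta> / 16) powr (2 / c)" by (simp only: powr_powr) simp
        also have "\<dots> = \<delta> powr (2 / c) / 16 powr (2 / c)" by (rule powr_divide)
        also have "\<dots> \<ge> \<delta> powr (2 / c) / 16 powr 2"
          using c by (intro divide_left_mono powr_mono) (auto simp: field_simps)
        finally show ?thesis by simp
      qed
      ultimately have "I * (\<delta> powr (2 / c) / 256) \<le> 32 * \<delta> * (C\<^sub>0 + 1)"
        using I1 by (meson mult_left_mono less_imp_le order_trans)
      then have "I * \<delta> powr (2 / c) \<le> 8192 * (C\<^sub>0 + 1) * \<delta>" by (simp add: algebra_simps)
      then have "I * \<delta> powr (2 / c) * \<delta> powr - (2 / c) \<le> 8192 * (C\<^sub>0 + 1) * \<delta> * \<delta> powr - (2 / c)"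
        by (rule mult_right_mono) simp
      moreover have "\<delta> powr (2 / c) * \<delta> powr - (2 / c) = 1"
        using \<delta> by (simp only: powr_add[symmetric]) simp
      moreover have "\<delta> * \<delta> powr - (2 / c) = \<delta> powr (1 - 2 / c)"
        using \<delta> powr_add[of \<delta> 1 "- (2 / c)"] by simp
      ultimately show ?thesis by (simp only: mult.assoc mult_1_right)
    qed
    then show "(\<integral>\<^sup>+ r. ennreal (1 / ((1 - r) + \<delta>)) \<partial>\<nu>) \<le> ennreal (8192 * (C\<^sub>0 + 1) * \<delta> powr (1 - 2 / c))"
      unfolding I_eq by (rule ennreal_leI)
  qed
qed

text \<open>With \<delta> = t the integrand is at least 1/(2 t) on [1 - t, 1). Multiplying by 2 t
  raises the exponent from 1 - 2/c to 2 - 2/c.\<close>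

lemma Carleson_necessary:
  assumes c: "1 \<le> c" and bdd: "bounded_operator (Lp_norm 1) (weak_Lp_norm c) (shimorin_op \<nu>)"
  obtains C where "C > 0" "\<And>t. 0 < t \<Longrightarrow> t \<le> 1 \<Longrightarrow> emeasure \<nu> {1 - t..<1} \<le> ennreal (C * t powr (2 - 2 / c))"
proof -
  obtain C where C: "C > 0"
    "\<And>\<delta>. 0 < \<delta> \<Longrightarrow> \<delta> \<le> 1 \<Longrightarrow> (\<integral>\<^sup>+ r. ennreal (1 / ((1 - r) + \<delta>)) \<partial>\<nu>) \<le> ennreal (C * \<delta> powr (1 - 2 / c))"
    using weak_type_necessary[OF c bdd] by blast
  show ?thesis
  proof (rule that[of "2 * C"])
    show "0 < 2 * C" using C by simp
    fix t :: real assume t: "0 < t" "t \<le> 1"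
    have s: "{1 - t..<1} \<in> sets \<nu>" unfolding sets_\<nu> using t by (subst sets_restrict_space_iff) auto
    have "ennreal (1 / (2 * t)) * emeasure \<nu> {1 - t..<1} = (\<integral>\<^sup>+ r. ennreal (1 / (2 * t)) * indicator {1 - t..<1} r \<partial>\<nu>)"
      by (intro nn_integral_cmult_indicator[symmetric] s)
    also have "\<dots> \<le> (\<integral>\<^sup>+ r. ennreal (1 / ((1 - r) + t)) \<partial>\<nu>)"
      using t by (intro nn_integral_mono) (auto simp: indicator_def intro!: ennreal_leI frac_le)
    also have "\<dots> \<le> ennreal (C * t powr (1 - 2 / c))" by (rule C(2)[OF t])
    finally have "ennreal (2 * t) * (ennreal (1 / (2 * t)) * emeasure \<nu> {1 - t..<1}) \<le> ennreal (2 * t) * ennreal (C * t powr (1 - 2 / c))"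
      by (rule mult_left_mono) simp
    also have "ennreal (2 * t) * (ennreal (1 / (2 * t)) * emeasure \<nu> {1 - t..<1}) = emeasure \<nu> {1 - t..<1}"
      using t by (simp add: mult.assoc[symmetric] flip: ennreal_mult)
    also have "ennreal (2 * t) * ennreal (C * t powr (1 - 2 / c)) = ennreal (2 * C * t powr (2 - 2 / c))"
    proof -
      have e: "1 + (1 - 2 / c) = 2 - 2 / c" by simp
      have "t * t powr (1 - 2 / c) = t powr (2 - 2 / c)"
        using powr_mult_base[of t "1 - 2 / c"] t unfolding e by simp
      then have "2 * t * (C * t powr (1 - 2 / c)) = 2 * C * t powr (2 - 2 / c)" by simp
      then show ?thesis using t C(1) by (subst ennreal_mult[symmetric]) auto
    qed
    finally show "emeasure \<nu> {1 - t..<1} \<le> ennreal (2 * C * t powr (2 - 2 / c))" .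
  qed
qed

text \<open>For c = 2 the necessary bound is uniform in \<delta>, and monotone convergence along
  \<delta> = 1/(n+1) gives the integral of 1/(1 - r), which dominates the one in question on
  [0,1).\<close>

lemma integrability_necessary:
  assumes bdd: "bounded_operator (Lp_norm 1) (weak_Lp_norm 2) (shimorin_op \<nu>)"
  shows "(\<integral>\<^sup>+ r\<in>{0..<1}. ennreal (1 / (1 - r\<^sup>2)) \<partial>\<nu>) < \<infinity>"
proof -
  obtain C where C: "C > 0"
    "\<And>\<delta>. 0 < \<delta> \<Longrightarrow> \<delta> \<le> 1 \<Longrightarrow> (\<integral>\<^sup>+ r. ennreal (1 / ((1 - r) + \<delta>)) \<partial>\<nu>) \<le> ennreal (C * \<delta> powr (1 - 2 / 2))"
    using weak_type_necessary[of 2, OF _ bdd] by auto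
  define \<phi> where "\<phi> n r = ennreal (1 / ((1 - r) + 1 / real (Suc n))) * indicator {0..<1} r" for n r
  have "(\<lambda>n. \<integral>\<^sup>+ r. \<phi> n r \<partial>\<nu>) \<longlonglongrightarrow> (\<integral>\<^sup>+ r\<in>{0..<1}. ennreal (1 / (1 - r)) \<partial>\<nu>)"
  proof (rule nn_integral_LIMSEQ)
    show "incseq \<phi>"
      unfolding incseq_def le_fun_def
    proof (intro allI impI)
      fix m n :: nat and r :: real assume "m \<le> n"
      then have *: "1 / real (Suc n) \<le> 1 / real (Suc m)" by (intro frac_le) auto
      have "1 / ((1 - r) + 1 / real (Suc m)) \<le> 1 / ((1 - r) + 1 / real (Suc n))" if "r < 1"
        using that by (intro frac_le add_left_mono * add_pos_pos) auto
      then show "\<phi> m r \<le> \<phi> n r" by (auto simp: \<phi>_def indicator_def intro!: ennreal_leI)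
    qed
    show "\<phi> n \<in> borel_measurable \<nu>" for n
      unfolding \<phi>_def by (rule borel_measurable_\<nu>) measurable
    show "(\<lambda>n. \<phi> n r) \<longlonglongrightarrow> ennreal (1 / (1 - r)) * indicator {0..<1} r" for r
    proof (cases "r \<in> {0..<1}")
      case True
      have "(\<lambda>n. 1 / ((1 - r) + 1 / real (Suc n))) \<longlonglongrightarrow> 1 / ((1 - r) + 0)"
        using True by (intro tendsto_intros LIMSEQ_Suc[OF lim_1_over_n]) auto
      then show ?thesis using True by (simp add: \<phi>_def)
    qed (simp add: \<phi>_def)
  qed
  moreover have "(\<integral>\<^sup>+ r. \<phi> n r \<partial>\<nu>) \<le> ennreal C" for n
  proof -
    have "(\<integral>\<^sup>+ r. \<phi> n r \<partial>\<nu>) \<le> (\<integral>\<^sup>+ r. ennreal (1 / ((1 - r) + 1 / real (Suc n))) \<partial>\<nu>)"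
      by (intro nn_integral_mono) (simp add: \<phi>_def indicator_def)
    also have "\<dots> \<le> ennreal (C * (1 / real (Suc n)) powr (1 - 2 / 2))" by (intro C(2)) auto
    finally show ?thesis by simp
  qed
  ultimately have le: "(\<integral>\<^sup>+ r\<in>{0..<1}. ennreal (1 / (1 - r)) \<partial>\<nu>) \<le> ennreal C"
    by (intro LIMSEQ_le_const2) auto
  have "(\<integral>\<^sup>+ r\<in>{0..<1}. ennreal (1 / (1 - r\<^sup>2)) \<partial>\<nu>) \<le> (\<integral>\<^sup>+ r\<in>{0..<1}. ennreal (1 / (1 - r)) \<partial>\<nu>)"
  proof (intro nn_integral_mono)
    fix r :: real
    have "1 / (1 - r\<^sup>2) \<le> 1 / (1 - r)" if "0 \<le> r" "r < 1"
      using that by (intro frac_le) (auto simp: power2_eq_square mult_left_le)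
    then show "ennreal (1 / (1 - r\<^sup>2)) * indicator {0..<1} r \<le> ennreal (1 / (1 - r)) * indicator {0..<1} r"
      by (auto simp: indicator_def intro!: ennreal_leI)
  qed
  also note le
  also have "ennreal C < \<infinity>" by simp
  finally show ?thesis .
qed

lemma standard_Bergman_estimateI:
  assumes "bounded_shimorin_kernel \<nu> (critical_index \<nu>) M"
  shows "standard_Bergman_estimate \<nu>"
proof -
  interpret bounded_shimorin_kernel \<nu> "critical_index \<nu>" M by (rule assms)
  show ?thesis
    unfolding standard_Bergman_estimate_def Let_def
  proof (intro conjI allI impI weak_type_bound BMO_bound)
    fix p q :: real
    assume pq: "1 < p \<and> ennreal p < dual_exponent (critical_index \<nu>) \<and> 1 / q = 1 / p + 1 / critical_index \<nu> - 1"
    \<comment> \<open>The restriction p < c' says exactly that 1/q is positive; for c = 1 it holds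
      for every finite p.\<close>
    have "0 < 1 / p + 1 / critical_index \<nu> - 1"
    proof (cases "critical_index \<nu> = 1")
      case False
      then have c: "1 < critical_index \<nu>" using c by simp
      then have "p < critical_index \<nu> / (critical_index \<nu> - 1)"
        using pq False ennreal_less_iff[of p] by (simp add: dual_exponent_def)
      then show ?thesis using c pq by (simp add: field_simps)
    qed (use pq in simp)
    then have "0 < q" using pq by (metis zero_less_divide_1_iff)
    then show "bounded_operator (Lp_norm (ennreal p)) (Lp_norm (ennreal q)) (shimorin_op \<nu>)"
      using pq by (intro strong_type_bound) auto
  qed
qed

end

theorem theorem1p2:
  fixes \<nu> :: "real measure"
  assumes "sets \<nu> = sets (restrict_space borel {0..1})"
    and "finite_measure \<nu>"
  shows "standard_Bergman_estimate \<nu> \<longleftrightarrow>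
    (critical_index \<nu> = 1 \<longrightarrow> finite_measure \<nu>) \<and>
    (1 < critical_index \<nu> \<and> critical_index \<nu> < 2 \<longrightarrow>
      (SUP t\<in>{0<..1}. emeasure \<nu> {1 - t..<1} /
         ennreal (t powr enn2real (2 / dual_exponent (critical_index \<nu>)))) < \<infinity>) \<and>
    (critical_index \<nu> = 2 \<longrightarrow>
      (\<integral>\<^sup>+ r\<in>{0..<1}. ennreal (1 / (1 - r\<^sup>2)) \<partial>\<nu>) < \<infinity>)"
proof -
  let ?Carleson = "(SUP t\<in>{0<..1}. emeasure \<nu> {1 - t..<1} /
    ennreal (t powr enn2real (2 / dual_exponent (critical_index \<nu>)))) < \<infinity>"
  let ?integrable = "(\<integral>\<^sup>+ r\<in>{0..<1}. ennreal (1 / (1 - r\<^sup>2)) \<partial>\<nu>) < \<infinity>"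
  interpret unit_interval_measure \<nu>
    using assms by (simp add: unit_interval_measure_def unit_interval_measure_axioms_def)
  define c where "c = critical_index \<nu>"
  have c12: "1 \<le> c" "c \<le> 2" using critical_index_bounds by (auto simp: c_def)
  \<comment> \<open>The supremum over t and a bound with a positive constant are interchanged here
    once, with 2/c' written as 2 - 2/c.\<close>
  have Carleson_iff: "?Carleson \<longleftrightarrow>
      (\<exists>C>0. \<forall>t. 0 < t \<and> t \<le> 1 \<longrightarrow> emeasure \<nu> {1 - t..<1} \<le> ennreal (C * t powr (2 - 2 / c)))" if c: "1 < c"
  proof
    assume ?Carleson
    then obtain L where L: "0 \<le> L"
      "(SUP t\<in>{0<..1}. emeasure \<nu> {1 - t..<1} / ennreal (t powr (2 - 2 / c))) = ennreal L"
      using two_div_dual_exponent[OF c] by (cases rule: ennreal_cases) (auto simp: c_def)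
    have "emeasure \<nu> {1 - t..<1} \<le> ennreal ((L + 1) * t powr (2 - 2 / c))" if t: "0 < t" "t \<le> 1" for t
    proof -
      have "emeasure \<nu> {1 - t..<1} / ennreal (t powr (2 - 2 / c)) \<le> ennreal L"
        unfolding L(2)[symmetric] using t by (intro SUP_upper) auto
      then have "measure \<nu> {1 - t..<1} / t powr (2 - 2 / c) \<le> L"
        using t L(1) by (simp add: emeasure_eq_measure divide_ennreal)
      then have "measure \<nu> {1 - t..<1} \<le> L * t powr (2 - 2 / c)"
        using t by (simp add: divide_le_eq)
      also have "\<dots> \<le> (L + 1) * t powr (2 - 2 / c)" by (intro mult_right_mono) auto
      finally show ?thesis by (simp add: emeasure_eq_measure ennreal_leI)
    qed
    then show "\<exists>C>0. \<forall>t. 0 < t \<and> t \<le> 1 \<longrightarrow> emeasure \<nu> {1 - t..<1} \<le> ennreal (C * t powr (2 - 2 / c))"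
      using L(1) by (intro exI[of _ "L + 1"]) auto
  next
    assume "\<exists>C>0. \<forall>t. 0 < t \<and> t \<le> 1 \<longrightarrow> emeasure \<nu> {1 - t..<1} \<le> ennreal (C * t powr (2 - 2 / c))"
    then obtain C where C: "C > 0"
      "\<And>t. 0 < t \<Longrightarrow> t \<le> 1 \<Longrightarrow> emeasure \<nu> {1 - t..<1} \<le> ennreal (C * t powr (2 - 2 / c))" by blast
    have "(SUP t\<in>{0<..1}. emeasure \<nu> {1 - t..<1} / ennreal (t powr (2 - 2 / c))) \<le> ennreal C"
    proof (rule SUP_least)
      fix t :: real assume "t \<in> {0<..1}"
      then have t: "0 < t" "t \<le> 1" by auto
      have "emeasure \<nu> {1 - t..<1} / ennreal (t powr (2 - 2 / c)) \<le> ennreal (C * t powr (2 - 2 / c)) / ennreal (t powr (2 - 2 / c))"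
        by (intro divide_right_mono_ennreal C t)
      also have "\<dots> = ennreal C" using t C(1) by (simp add: divide_ennreal)
      finally show "emeasure \<nu> {1 - t..<1} / ennreal (t powr (2 - 2 / c)) \<le> ennreal C" .
    qed
    then show ?Carleson
      using two_div_dual_exponent[OF c] by (auto simp: c_def intro: le_less_trans)
  qed
  show ?thesis
  proof
    assume "standard_Bergman_estimate \<nu>"
    then have weak: "bounded_operator (Lp_norm 1) (weak_Lp_norm c) (shimorin_op \<nu>)"
      by (simp add: standard_Bergman_estimate_def Let_def c_def)
    have "?Carleson" if "1 < c" "c < 2"
    proof -
      obtain C where "C > 0" "\<And>t. 0 < t \<Longrightarrow> t \<le> 1 \<Longrightarrow> emeasure \<nu> {1 - t..<1} \<le> ennreal (C * t powr (2 - 2 / c))"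
        using Carleson_necessary[OF c12(1) weak] by blast
      then show ?thesis using Carleson_iff[OF that(1)] by blast
    qed
    moreover have "?integrable" if "c = 2"
      using integrability_necessary weak that by simp
    ultimately show "(critical_index \<nu> = 1 \<longrightarrow> finite_measure \<nu>) \<and>
      (1 < critical_index \<nu> \<and> critical_index \<nu> < 2 \<longrightarrow> ?Carleson) \<and> (critical_index \<nu> = 2 \<longrightarrow> ?integrable)"
      using assms(2) by (simp only: c_def[symmetric]) blast
  next
    assume cond: "(critical_index \<nu> = 1 \<longrightarrow> finite_measure \<nu>) \<and>
      (1 < critical_index \<nu> \<and> critical_index \<nu> < 2 \<longrightarrow> ?Carleson) \<and> (critical_index \<nu> = 2 \<longrightarrow> ?integrable)"
    \<comment> \<open>Each case supplies the kernel bound with exponent c. In the last two, c > 1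
      excludes an atom at 1, which the conditions on [0,1) do not detect.\<close>
    consider "c = 1" | "1 < c" "c < 2" | "c = 2" using c12 by linarith
    then show "standard_Bergman_estimate \<nu>"
    proof cases
      case 1
      then show ?thesis using standard_Bergman_estimateI bounded_kernel_one by (simp add: c_def)
    next
      case 2
      then have ?Carleson using cond by (simp add: c_def)
      then obtain C where C: "C > 0"
        "\<And>t. 0 < t \<Longrightarrow> t \<le> 1 \<Longrightarrow> emeasure \<nu> {1 - t..<1} \<le> ennreal (C * t powr (2 - 2 / c))"
        using Carleson_iff[OF 2(1)] by blast
      have "bounded_shimorin_kernel \<nu> c (3 * (C / (2 / c - 1)))"
        using 2 C no_atom_at_one by (intro bounded_kernel_between) (auto simp: c_def)
      then show ?thesis using standard_Bergman_estimateI by (simp add: c_def)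
    next
      case 3
      then have "?integrable" using cond by (simp add: c_def)
      moreover have "emeasure \<nu> {1} = 0" using 3 no_atom_at_one by (simp add: c_def)
      ultimately obtain M where "bounded_shimorin_kernel \<nu> 2 M" using bounded_kernel_two by blast
      then show ?thesis using standard_Bergman_estimateI 3 by (simp add: c_def)
    qed
  qed
qed

end
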